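(* Let $u\in W^{1,\mathcal H}(\Omega)$ be a local minimizer of the multi-phase functional $\mathbb F$, where $a_i\in A_{p_i}$ for every $i\in I_N$. Then there exists a constant $C>0$ depending only on $\mathtt{data}$ such that $$\|u\|_{L^\infty(B)}\le C\,r\left[\fint_{2B}\mathcal H\left(x,\frac{|u-(u)_{2B}|}{r}\right)dx\right]^{\frac1p}+|(u)_{2B}|$$ for every ball $B:=B_r$ whose concentric double $2B:=B_{2r}$ satisfies $2B\Subset\Omega$.
   Context: Let $n\ge2$, $\Omega\subset\mathbb R^n$ a bounded open set, $N\ge1$, $I_N=\{1,\dots,N\}$, and $1<p\le p_1\le\dots\le p_N<\infty$. For $\gamma>1$, a non-negative $\omega\in L^1_{\mathrm{loc}}(\mathbb R^n)$ belongs to the Muckenhoupt class $A_\gamma$ if $[\omega]_{A_\gamma}:=\sup_B\left(\fint_B\omega\,dx\right)\left(\fint_B\omega^{-\frac1{\gamma-1}}dx\right)^{\gamma-1}<\infty$, the supremum being over all balls $B\subset\mathbb R^n$. The coefficients $a_i:\mathbb R^n\to[0,\infty)$ satisfy $a_i\in A_{p_i}$. Set $\mathcal H(x,t)=t^p+\sum_{i=1}^N a_i(x)t^{p_i}$ for $t\ge0$, and for measurable $S\subset\Omega$ set $\mathbb F(v,S)=\int_S\mathcal H(x,|\nabla v|)\,dx$. $L^{\mathcal H}(\Omega)$ is the linear hull of the set of measurable $f:\Omega\to\mathbb R$ with $\int_\Omega\mathcal H(x,|f|)dx<\infty$ (with the Luxemburg norm), $W^{1,\mathcal H}(\Omega)=\{f\in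 L^{\mathcal H}(\Omega):|\nabla f|\in L^{\mathcal H}(\Omega)\}$ (distributional gradient), and $W^{1,\mathcal H}_{\mathrm{loc}}(\Omega)$ is the corresponding local space. A function $u\in W^{1,\mathcal H}(\Omega)$ is a local minimizer of $\mathbb F$ if $\mathbb F(u,\mathrm{supp}(u-w))\le\mathbb F(w,\mathrm{supp}(u-w))$ for every $w\in W^{1,\mathcal H}_{\mathrm{loc}}(\Omega)$ with $\mathrm{supp}(u-w)\Subset\Omega$. $\mathtt{data}$ denotes the collection $n,N,p,\{p_i\}_{i=1}^N,\{[a_i]_{A_{p_i}}\}_{i=1}^N$. $(f)_E=\fint_E f=\frac1{|E|}\int_E f$. *)

theory Defs
  imports "HOL-Analysis.Analysis" "HOL-Probability.Essential_Supremum"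
begin

definition ennreal_powr :: "ennreal \<Rightarrow> real \<Rightarrow> ennreal" (* only meant for exponents s > 0 *)
  where "ennreal_powr t s = (if t = \<infinity> then \<infinity> else ennreal (enn2real t powr s))"

definition avg :: "(real ^ 'n) set \<Rightarrow> (real ^ 'n \<Rightarrow> real) \<Rightarrow> real"
  where "avg E f = (\<integral>x. f x \<partial>lebesgue_on E) / measure lebesgue E"

definition nn_avg :: "(real ^ 'n) set \<Rightarrow> (real ^ 'n \<Rightarrow> ennreal) \<Rightarrow> ennreal"
  where "nn_avg E f = (\<integral>\<^sup>+x. f x \<partial>lebesgue_on E) / emeasure lebesgue E"

definition compactly_contained :: "'a::topological_space set \<Rightarrow> 'a set \<Rightarrow> bool"
  where "compactly_contained S T \<longleftrightarrow> compact (closure S) \<and> closure S \<subseteq> T"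

definition locally_integrable ::
    "(real ^ 'n) set \<Rightarrow> (real ^ 'n \<Rightarrow> 'b::{banach, second_countable_topology}) \<Rightarrow> bool"
  where "locally_integrable \<Omega> f \<longleftrightarrow> (\<forall>K. compact K \<and> K \<subseteq> \<Omega> \<longrightarrow> integrable (lebesgue_on K) f)"

(* The negative power w^(-1/(g-1)) is written (1/w)^(1/(g-1)) in [0,\<infinity>], so that it is \<infinity> where w
   vanishes.  The convention 0 * \<infinity> = 0 of type ennreal is relevant only for w = 0 a.e. *)
definition muckenhoupt_const :: "real \<Rightarrow> (real ^ 'n \<Rightarrow> real) \<Rightarrow> ennreal"
  where "muckenhoupt_const \<gamma> \<omega> =
    (SUP (c, r) \<in> UNIV \<times> {0<..}.
       nn_avg (ball c r) (\<lambda>x. ennreal (\<omega> x)) *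
       ennreal_powr
         (nn_avg (ball c r) (\<lambda>x. ennreal_powr (inverse (ennreal (\<omega> x))) (1 / (\<gamma> - 1))))
         (\<gamma> - 1))"

definition muckenhoupt_class :: "real \<Rightarrow> (real ^ 'n \<Rightarrow> real) set"
  where "muckenhoupt_class \<gamma> =
    {\<omega>. (\<forall>x. \<omega> x \<ge> 0) \<and> locally_integrable UNIV \<omega> \<and> muckenhoupt_const \<gamma> \<omega> < \<infinity>}"

definition multiphase ::
    "nat \<Rightarrow> real \<Rightarrow> (nat \<Rightarrow> real) \<Rightarrow> (nat \<Rightarrow> real ^ 'n \<Rightarrow> real) \<Rightarrow> real ^ 'n \<Rightarrow> real \<Rightarrow> real"
  where "multiphase N p q a x t = t powr p + (\<Sum>i=1..N. a i x * t powr q i)"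

(* In the following, H is a generalized integrand H x t, used with H = multiphase N p q a.
   Functions on \<Omega> are total functions of which only the values on \<Omega> matter. *)

definition modular_class ::
    "(real ^ 'n \<Rightarrow> real \<Rightarrow> real) \<Rightarrow> (real ^ 'n) set \<Rightarrow> (real ^ 'n \<Rightarrow> real) set"
  where "modular_class H \<Omega> =
    {f. f \<in> borel_measurable (lebesgue_on \<Omega>) \<and> (\<integral>\<^sup>+x. ennreal (H x \<bar>f x\<bar>) \<partial>lebesgue_on \<Omega>) < \<infinity>}"

(* linear hull of the modular class *)
definition L_space ::
    "(real ^ 'n \<Rightarrow> real \<Rightarrow> real) \<Rightarrow> (real ^ 'n) set \<Rightarrow> (real ^ 'n \<Rightarrow> real) set"
  where "L_space H \<Omega> =
    {f. \<exists>(k::nat) c g. (\<forall>j<k. g j \<in> modular_class H \<Omega>) \<and> (\<forall>x\<in>\<Omega>. f x = (\<Sum>j<k. c j * g j x))}"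

definition partial_deriv :: "'n \<Rightarrow> (real ^ 'n \<Rightarrow> real) \<Rightarrow> real ^ 'n \<Rightarrow> real"
  where "partial_deriv i f x = frechet_derivative f (at x) (axis i 1)"

primrec k_times_cont_diff :: "nat \<Rightarrow> (real ^ 'n \<Rightarrow> real) \<Rightarrow> bool" where
  "k_times_cont_diff 0 f \<longleftrightarrow> continuous_on UNIV f"
| "k_times_cont_diff (Suc k) f \<longleftrightarrow>
     f differentiable_on UNIV \<and> (\<forall>i. k_times_cont_diff k (partial_deriv i f))"

definition test_functions :: "(real ^ 'n) set \<Rightarrow> (real ^ 'n \<Rightarrow> real) set"
  where "test_functions \<Omega> =
    {\<phi>. (\<forall>k. k_times_cont_diff k \<phi>) \<and> compactly_contained {x. \<phi> x \<noteq> 0} \<Omega>}"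

definition is_weak_gradient ::
    "(real ^ 'n) set \<Rightarrow> (real ^ 'n \<Rightarrow> real) \<Rightarrow> (real ^ 'n \<Rightarrow> real ^ 'n) \<Rightarrow> bool"
  where "is_weak_gradient \<Omega> f g \<longleftrightarrow>
    locally_integrable \<Omega> f \<and> locally_integrable \<Omega> g \<and>
    (\<forall>\<phi>\<in>test_functions \<Omega>. \<forall>i.
       (\<integral>x. f x * partial_deriv i \<phi> x \<partial>lebesgue_on \<Omega>) = - (\<integral>x. g x $ i * \<phi> x \<partial>lebesgue_on \<Omega>))"

(* a representative; weak gradients are unique a.e. on \<Omega> *)
definition weak_gradient ::
    "(real ^ 'n) set \<Rightarrow> (real ^ 'n \<Rightarrow> real) \<Rightarrow> real ^ 'n \<Rightarrow> real ^ 'n"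
  where "weak_gradient \<Omega> f = (SOME g. is_weak_gradient \<Omega> f g)"

definition W_space ::
    "(real ^ 'n \<Rightarrow> real \<Rightarrow> real) \<Rightarrow> (real ^ 'n) set \<Rightarrow> (real ^ 'n \<Rightarrow> real) set"
  where "W_space H \<Omega> =
    {f \<in> L_space H \<Omega>. \<exists>g. is_weak_gradient \<Omega> f g \<and> (\<lambda>x. norm (g x)) \<in> L_space H \<Omega>}"

definition W_loc_space ::
    "(real ^ 'n \<Rightarrow> real \<Rightarrow> real) \<Rightarrow> (real ^ 'n) set \<Rightarrow> (real ^ 'n \<Rightarrow> real) set"
  where "W_loc_space H \<Omega> = {f. \<forall>U. open U \<and> compactly_contained U \<Omega> \<longrightarrow> f \<in> W_space H U}"

definition energy ::
    "(real ^ 'n \<Rightarrow> real \<Rightarrow> real) \<Rightarrow> (real ^ 'n) set \<Rightarrow> (real ^ 'n \<Rightarrow> real) \<Rightarrow> (real ^ 'n) set \<Rightarrow> ennreal"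
  where "energy H \<Omega> v S = (\<integral>\<^sup>+x. ennreal (H x (norm (weak_gradient \<Omega> v x))) \<partial>lebesgue_on S)"

(* Support of a function defined a.e. on \<Omega>: the complement in \<Omega> of the largest open set on which
   f = 0 a.e.  It is relatively closed in the open set \<Omega>, hence measurable. *)
definition ess_supp :: "(real ^ 'n) set \<Rightarrow> (real ^ 'n \<Rightarrow> real) \<Rightarrow> (real ^ 'n) set"
  where "ess_supp \<Omega> f =
    {x\<in>\<Omega>. \<not> (\<exists>U. open U \<and> x \<in> U \<and> U \<subseteq> \<Omega> \<and> (AE y in lebesgue_on U. f y = 0))}"

definition local_minimizer ::
    "(real ^ 'n \<Rightarrow> real \<Rightarrow> real) \<Rightarrow> (real ^ 'n) set \<Rightarrow> (real ^ 'n \<Rightarrow> real) \<Rightarrow> bool"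
  where "local_minimizer H \<Omega> u \<longleftrightarrow>
    u \<in> W_space H \<Omega> \<and>
    (\<forall>w\<in>W_loc_space H \<Omega>.
       let S = ess_supp \<Omega> (\<lambda>x. u x - w x) in
       compactly_contained S \<Omega> \<longrightarrow> energy H \<Omega> u S \<le> energy H \<Omega> w S)"

definition Linf_norm :: "(real ^ 'n) set \<Rightarrow> (real ^ 'n \<Rightarrow> real) \<Rightarrow> ennreal"
  where "Linf_norm E f = esssup (lebesgue_on E) (\<lambda>x. ennreal \<bar>f x\<bar>)"

end

theory Submission
  imports Defs
begin

text \<open>
  De Giorgi iteration on the levels k_j = d (1 - 2^(-j)) and the radii r_j = r (1 + 2^(-j)), for u and for -u.
  Comparing u with u - \<sigma> \<eta> (\<sigma> (u - m) - k)_+, where |grad \<eta>| \<le> M \<eta>^(1 - 1/Q) and Q is the largest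
  exponent, convexity of the integrand gives a Caccioppoli inequality without a hole-filling argument.
  The gain at each step comes from a weighted Faber--Krahn inequality: a function whose support has
  measure at most \<rho>^n / 2 satisfies \<integral> w |f|^q \<le> C \<rho>^q \<integral> w |grad f|^q for w in A_q. In it the smallness of the
  support is measured by Lebesgue measure, which Chebyshev's inequality controls through the unweighted
  term t^p of the integrand. It is proved by telescoping |f| over its averages on dyadic cells of side
  \<rho> / 2^j: f vanishes on half of each cell of side \<rho>, so the Poincare inequality bounds the first average,
  and it also bounds consecutive differences by the side length times the average of |grad f|; the A_q
  condition bounds each averaging operator on L^q(w) uniformly in the scale. No reverse Hoelder
  inequality and no maximal function is needed.
\<close>

section \<open>Smooth functions and the fundamental lemma\<close>

text \<open>Nothing relates the exponents to each other and the coefficients are merely Muckenhoupt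
  weights, so one phase cannot be estimated by another. Each term is handled with its own weight and
  exponent. What must be common to all of them is the gain, and
  \<open>(\<rho> / r) powr e \<le> \<rho> / r\<close> for all exponents e >= 1 makes it so.

  The recursion for the energies is linear rather than superlinear. The bound Y r^n kappa^j is
  carried through the induction, and it is exactly strong enough to make the support at step j
  smaller than rho_j^n / 2 with rho_j = delta r 2^(-Q j). The gain rho_j / r cancels the factor 2^(j
  Q) caused by the gradient of the cutoff, and delta is chosen to leave at most kappa. The height d
  solves (d / r)^p = const Y, which is where the exponent 1/p of the estimate comes from.

  Cells replace balls because dyadic cells partition the space and are nested, as telescoping of
  averages requires. Weak derivatives of truncations are obtained from difference quotients, which
  converge strongly in L^1.\<close>

definition smooth :: "(real ^ 'n \<Rightarrow> real) \<Rightarrow> bool"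
  where "smooth f \<longleftrightarrow> (\<forall>k. k_times_cont_diff k f)"

lemma partial_deriv_eq:
  assumes "(f has_derivative f') (at x)"
  shows "partial_deriv i f x = f' (axis i 1)"
  unfolding partial_deriv_def using frechet_derivative_at[OF assms] by simp

lemma k_times_cont_diff_Suc_imp: "k_times_cont_diff (Suc k) f \<Longrightarrow> k_times_cont_diff k f"
proof (induction k arbitrary: f)
  case 0
  then show ?case by (simp add: differentiable_imp_continuous_on)
next
  case (Suc k)
  then show ?case by auto
qed

lemma k_times_cont_diff_const: "k_times_cont_diff k (\<lambda>x::real^'n. c)"
proof (induction k arbitrary: c)
  case (Suc k)
  have "partial_deriv i (\<lambda>x::real^'n. c) = (\<lambda>x. 0)" for i
    by (rule ext, subst partial_deriv_eq, rule has_derivative_const) auto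
  then show ?case using Suc by auto
qed auto

lemma k_times_cont_diff_nth: "k_times_cont_diff k (\<lambda>x::real^'n. x $ j)"
proof (cases k)
  case (Suc k)
  have "((\<lambda>x::real^'n. x $ j) has_derivative (\<lambda>h. h $ j)) (at x)" for x
    by (rule bounded_linear_imp_has_derivative, rule bounded_linear_vec_nth)
  then have "partial_deriv i (\<lambda>x::real^'n. x $ j) = (\<lambda>x. axis i 1 $ j)"
    and "(\<lambda>x::real^'n. x $ j) differentiable_on UNIV" for i
    by (auto intro!: ext partial_deriv_eq simp: differentiable_on_def differentiable_def)
  then show ?thesis using Suc k_times_cont_diff_const by auto
qed (auto intro: continuous_intros)

lemma k_times_cont_diff_add:
  "k_times_cont_diff k f \<Longrightarrow> k_times_cont_diff k g \<Longrightarrow> k_times_cont_diff k (\<lambda>x. f x + g x)"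
proof (induction k arbitrary: f g)
  case (Suc k)
  have d: "(f has_derivative frechet_derivative f (at x)) (at x)"
    "(g has_derivative frechet_derivative g (at x)) (at x)" for x
    using Suc.prems by (auto simp: differentiable_on_def frechet_derivative_works)
  have "partial_deriv i (\<lambda>x. f x + g x) = (\<lambda>x. partial_deriv i f x + partial_deriv i g x)" for i
    by (rule ext, subst partial_deriv_eq, rule has_derivative_add[OF d]) (simp add: partial_deriv_def)
  then show ?case using Suc by (auto intro: differentiable_on_add)
qed (auto intro: continuous_intros)

lemma k_times_cont_diff_mult:
  "k_times_cont_diff k f \<Longrightarrow> k_times_cont_diff k g \<Longrightarrow> k_times_cont_diff k (\<lambda>x. f x * g x)"
proof (induction k arbitrary: f g)
  case (Suc k)
  have d: "(f has_derivative frechet_derivative f (at x)) (at x)"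
    "(g has_derivative frechet_derivative g (at x)) (at x)" for x
    using Suc.prems by (auto simp: differentiable_on_def frechet_derivative_works)
  have "partial_deriv i (\<lambda>x. f x * g x) = (\<lambda>x. f x * partial_deriv i g x + partial_deriv i f x * g x)" for i
    by (rule ext, subst partial_deriv_eq, rule has_derivative_mult[OF d]) (simp add: partial_deriv_def)
  moreover have "k_times_cont_diff k f" "k_times_cont_diff k g"
    using Suc.prems k_times_cont_diff_Suc_imp by blast+
  ultimately show ?case using Suc by (auto intro: differentiable_on_mult k_times_cont_diff_add)
qed (auto intro: continuous_intros)

text \<open>The class of these functions is closed under derivatives, which makes smoothness of exp (- 1 / t) an induction over the order.\<close>

definition flat_fun :: "real poly \<Rightarrow> real \<Rightarrow> real"
  where "flat_fun P t = (if t > 0 then poly P (1 / t) * exp (- (1 / t)) else 0)"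

lemma poly_times_exp_minus_tendsto_0: "((\<lambda>y. poly P y * exp (- y)) \<longlongrightarrow> (0::real)) at_top"
proof -
  have "((\<lambda>y. \<Sum>i\<le>degree P. coeff P i * (y ^ i / exp y)) \<longlongrightarrow> (\<Sum>i\<le>degree P. coeff P i * 0)) at_top"
    by (intro tendsto_intros tendsto_power_div_exp_0)
  then show ?thesis
    by (simp add: poly_altdef exp_minus divide_inverse sum_distrib_right mult.assoc)
qed

text \<open>With s = 1 / t the chain rule gives s^2 (P(s) - P'(s)) exp(-s), which is again of the
  form \<open>flat_fun\<close>. At 0 the right difference quotient is s P(s) exp(-s) with s tending
  to infinity, hence tends to 0.\<close>

lemma flat_fun_has_derivative:
  "(flat_fun P has_real_derivative flat_fun (monom 1 2 * (P - pderiv P)) t) (at t)"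
proof -
  consider "t > 0" | "t < 0" | "t = 0" by linarith
  then show ?thesis
  proof cases
    case 1
    have "((\<lambda>t. poly P (1 / t) * exp (- (1 / t))) has_real_derivative
        flat_fun (monom 1 2 * (P - pderiv P)) t) (at t)"
      using 1 by (auto intro!: derivative_eq_intros DERIV_chain2[OF poly_DERIV]
          simp: flat_fun_def poly_monom field_simps power2_eq_square)
    then show ?thesis
      by (rule has_field_derivative_transform_within_open[where S="{0<..}"]) (use 1 in \<open>auto simp: flat_fun_def\<close>)
  next
    case 2
    have "((\<lambda>t. 0) has_real_derivative flat_fun (monom 1 2 * (P - pderiv P)) t) (at t)"
      using 2 by (auto simp: flat_fun_def)
    then show ?thesis
      by (rule has_field_derivative_transform_within_open[where S="{..<0}"]) (use 2 in \<open>auto simp: flat_fun_def\<close>)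
  next
    case 3
    have "((\<lambda>h. flat_fun P h / h) \<longlongrightarrow> 0) (at_left 0)"
      by (rule tendsto_eventually) (auto simp: flat_fun_def eventually_at intro!: exI[of _ 1])
    moreover have "((\<lambda>h. flat_fun P h / h) \<longlongrightarrow> 0) (at_right 0)"
      unfolding filterlim_at_right_to_top
    proof (rule Lim_transform_eventually)
      show "((\<lambda>y. poly (monom 1 1 * P) y * exp (- y)) \<longlongrightarrow> (0::real)) at_top"
        by (rule poly_times_exp_minus_tendsto_0)
      show "\<forall>\<^sub>F y in at_top. poly (monom 1 1 * P) y * exp (- y) = flat_fun P (inverse y) / inverse y"
        using eventually_gt_at_top[of 0]
        by eventually_elim (auto simp: flat_fun_def poly_monom field_simps)
    qed
    ultimately have "((\<lambda>h. flat_fun P h / h) \<longlongrightarrow> 0) (at 0)"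
      by (simp add: filterlim_split_at)
    then show ?thesis unfolding 3 DERIV_def by (simp add: flat_fun_def)
  qed
qed

lemma k_times_cont_diff_flat_fun:
  "k_times_cont_diff k h \<Longrightarrow> k_times_cont_diff k (\<lambda>x. flat_fun P (h x))"
proof (induction k arbitrary: P)
  case 0
  have "continuous_on UNIV (flat_fun P)"
    using flat_fun_has_derivative DERIV_continuous_on has_field_derivative_at_within by blast
  then show ?case using 0 continuous_on_compose2 by fastforce
next
  case (Suc k)
  let ?P = "monom 1 2 * (P - pderiv P)"
  have h: "(h has_derivative frechet_derivative h (at x)) (at x)" for x
    using Suc.prems by (auto simp: differentiable_on_def frechet_derivative_works)
  have d: "((\<lambda>x. flat_fun P (h x)) has_derivative (\<lambda>y. flat_fun ?P (h x) * frechet_derivative h (at x) y)) (at x)" for x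
    using diff_chain_at[OF h flat_fun_has_derivative[unfolded has_field_derivative_def]]
    by (simp add: o_def)
  then have "(\<lambda>x. flat_fun P (h x)) differentiable_on UNIV"
    by (auto simp: differentiable_on_def differentiable_def)
  moreover have "partial_deriv i (\<lambda>x. flat_fun P (h x)) = (\<lambda>x. flat_fun ?P (h x) * partial_deriv i h x)" for i
    by (rule ext, subst partial_deriv_eq[OF d]) (simp add: partial_deriv_def)
  moreover have "k_times_cont_diff k h"
    using Suc.prems k_times_cont_diff_Suc_imp by blast
  ultimately show ?case using Suc by (auto intro: k_times_cont_diff_mult)
qed

lemma smooth_const [intro]: "smooth (\<lambda>x. c)"
  and smooth_nth [intro]: "smooth (\<lambda>x. x $ j)"
  by (auto simp: smooth_def k_times_cont_diff_const k_times_cont_diff_nth)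

lemma smooth_add [intro]: "smooth f \<Longrightarrow> smooth g \<Longrightarrow> smooth (\<lambda>x. f x + g x)"
  and smooth_mult [intro]: "smooth f \<Longrightarrow> smooth g \<Longrightarrow> smooth (\<lambda>x. f x * g x)"
  and smooth_flat_fun [intro]: "smooth f \<Longrightarrow> smooth (\<lambda>x. flat_fun P (f x))"
  by (auto simp: smooth_def k_times_cont_diff_add k_times_cont_diff_mult k_times_cont_diff_flat_fun)

lemma smooth_diff [intro]: "smooth f \<Longrightarrow> smooth g \<Longrightarrow> smooth (\<lambda>x. f x - g x)"
  using smooth_add[OF _ smooth_mult[OF smooth_const[of "-1"]], of f g] by simp

lemma smooth_sum [intro]: "(\<And>i. i \<in> I \<Longrightarrow> smooth (f i)) \<Longrightarrow> smooth (\<lambda>x. \<Sum>i\<in>I. f i x)"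
  by (induction I rule: infinite_finite_induct) auto

lemma smooth_prod [intro]: "(\<And>i. i \<in> I \<Longrightarrow> smooth (f i)) \<Longrightarrow> smooth (\<lambda>x. \<Prod>i\<in>I. f i x)"
  by (induction I rule: infinite_finite_induct) auto

lemma smooth_norm_power2 [intro]: "smooth (\<lambda>x::real^'n. norm (x - c) ^ 2)"
proof -
  have "norm (x - c) ^ 2 = (\<Sum>i\<in>UNIV. (x $ i - c $ i) * (x $ i - c $ i))" for x :: "real^'n"
    by (simp add: power2_norm_eq_inner inner_vec_def)
  then show ?thesis
    by (simp only:) (intro smooth_sum smooth_mult smooth_diff smooth_const smooth_nth)
qed

lemma smooth_partial_deriv: "smooth f \<Longrightarrow> smooth (partial_deriv i f)"
  unfolding smooth_def by (meson k_times_cont_diff.simps(2))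

lemma smooth_imp_continuous_on: "smooth f \<Longrightarrow> continuous_on S f"
  unfolding smooth_def by (meson continuous_on_subset k_times_cont_diff.simps(1) subset_UNIV)

lemma smooth_has_derivative:
  assumes "smooth f"
  shows "(f has_derivative (\<lambda>h. \<Sum>i\<in>UNIV. h $ i * partial_deriv i f x)) (at x)"
proof -
  have d: "(f has_derivative frechet_derivative f (at x)) (at x)"
    using assms by (auto simp: smooth_def differentiable_on_def frechet_derivative_works dest: spec[of _ "Suc 0"])
  interpret linear "frechet_derivative f (at x)"
    using d has_derivative_linear by blast
  have "frechet_derivative f (at x) h = (\<Sum>i\<in>UNIV. h $ i * partial_deriv i f x)" for h
  proof -
    have "frechet_derivative f (at x) h = frechet_derivative f (at x) (\<Sum>i\<in>UNIV. h $ i *\<^sub>R axis i 1)"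
      by (simp add: basis_expansion flip: scalar_mult_eq_scaleR)
    also have "\<dots> = (\<Sum>i\<in>UNIV. h $ i * partial_deriv i f x)"
      by (simp add: sum scale partial_deriv_def)
    finally show ?thesis .
  qed
  then have "frechet_derivative f (at x) = (\<lambda>h. \<Sum>i\<in>UNIV. h $ i * partial_deriv i f x)" by auto
  with d show ?thesis by simp
qed

lemma partial_deriv_mult:
  assumes "smooth f" "smooth g"
  shows "partial_deriv i (\<lambda>x. f x * g x) x = f x * partial_deriv i g x + partial_deriv i f x * g x"
  by (subst partial_deriv_eq, rule has_derivative_mult[OF assms[THEN smooth_has_derivative]])
     (simp add: axis_def if_distrib[of "\<lambda>x. x * _"] cong: if_cong)

lemma test_functions_iff:
  "\<phi> \<in> test_functions \<Omega> \<longleftrightarrow> smooth \<phi> \<and> compactly_contained {x. \<phi> x \<noteq> 0} \<Omega>"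
  by (auto simp: test_functions_def smooth_def)

lemma compactly_contained_subset:
  "compactly_contained S T \<Longrightarrow> S' \<subseteq> S \<Longrightarrow> T \<subseteq> T' \<Longrightarrow> compactly_contained S' T'"
  unfolding compactly_contained_def
  by (metis (no_types, lifting) closed_closure closure_mono compact_Int_closed dual_order.trans inf.absorb_iff2)

section \<open>Bumps and the fundamental lemma of the calculus of variations\<close>

definition bump :: "real \<Rightarrow> real" where "bump = flat_fun [:1:]"

lemma bump_eq: "bump t = (if t > 0 then exp (- (1 / t)) else 0)"
  by (simp add: bump_def flat_fun_def)

lemma bump_nonneg [simp]: "0 \<le> bump t" and bump_le_1 [simp]: "bump t \<le> 1"
  and bump_pos_iff [simp]: "0 < bump t \<longleftrightarrow> 0 < t"
  and bump_eq_0_iff [simp]: "bump t = 0 \<longleftrightarrow> t \<le> 0"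
  by (auto simp: bump_eq)

lemma bump_mono: "s \<le> t \<Longrightarrow> bump s \<le> bump t"
  by (auto simp: bump_eq field_simps)

lemma smooth_bump [intro]: "smooth f \<Longrightarrow> smooth (\<lambda>x. bump (f x))"
  unfolding bump_def by (rule smooth_flat_fun)

text \<open>Each face of the box contributes a bump of k + 1 times the signed distance to that face:
  it tends to exp 0 = 1 on the inner side and vanishes on the outer side. The sequence carries
  information from test functions to indicators of boxes.\<close>

lemma box_bumps:
  fixes a b :: "real^'n"
  assumes "cbox a b \<subseteq> \<Omega>"
  obtains \<phi> :: "nat \<Rightarrow> real^'n \<Rightarrow> real" where
    "\<And>k. \<phi> k \<in> test_functions \<Omega>" "\<And>k x. 0 \<le> \<phi> k x" "\<And>k x. \<phi> k x \<le> 1"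
    "\<And>k x. x \<notin> box a b \<Longrightarrow> \<phi> k x = 0"
    "\<And>x. (\<lambda>k. \<phi> k x) \<longlonglongrightarrow> indicator (box a b) x"
proof -
  define \<phi> where "\<phi> k x = (\<Prod>i\<in>UNIV. bump (real (Suc k) * (x $ i - a $ i)) * bump (real (Suc k) * (b $ i - x $ i)))"
    for k and x :: "real^'n"
  have lim: "(\<lambda>k. bump (real (Suc k) * y)) \<longlonglongrightarrow> 1" if "y > 0" for y
  proof -
    have "(\<lambda>k. exp (- (inverse (real (Suc k)) * (1/y)))) \<longlonglongrightarrow> exp (- (0 * (1/y)))"
      by (intro tendsto_intros LIMSEQ_inverse_real_of_nat)
    moreover have "bump (real (Suc k) * y) = exp (- (inverse (real (Suc k)) * (1/y)))" for k
      using that by (simp add: bump_eq inverse_eq_divide del: of_nat_Suc)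
    ultimately show ?thesis by simp
  qed
  have out: "\<phi> k x = 0" if "x \<notin> box a b" for k x
  proof -
    obtain i where "x $ i \<le> a $ i \<or> b $ i \<le> x $ i" using \<open>x \<notin> box a b\<close> unfolding mem_box_cart by (metis not_less)
    then show ?thesis unfolding \<phi>_def by (auto simp: mult_le_0_iff intro!: bexI[of _ i])
  qed
  have "(\<lambda>k. \<phi> k x) \<longlonglongrightarrow> indicator (box a b) x" for x
  proof (cases "x \<in> box a b")
    case True
    have "(\<lambda>k. \<phi> k x) \<longlonglongrightarrow> (\<Prod>i\<in>(UNIV::'n set). 1 * 1)"
      unfolding \<phi>_def by (intro tendsto_intros lim) (use True in \<open>auto simp: mem_box_cart\<close>)
    then show ?thesis using True by simp
  qed (simp add: out)
  moreover have "\<phi> k \<in> test_functions \<Omega>" for k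
  proof -
    have "smooth (\<phi> k)" unfolding \<phi>_def
      by (intro smooth_prod smooth_mult smooth_bump smooth_diff smooth_const smooth_nth)
    moreover have "compactly_contained (box a b) \<Omega>"
      using assms closure_box by (cases "box a b = {}") (auto simp: compactly_contained_def)
    ultimately show ?thesis
      unfolding test_functions_iff using out by (auto intro: compactly_contained_subset)
  qed
  moreover have "0 \<le> \<phi> k x" "\<phi> k x \<le> 1" for k x
    unfolding \<phi>_def by (auto intro!: prod_nonneg prod_le_1 mult_le_one)
  ultimately show ?thesis using that out by blast
qed

lemma borel_measurable_lebesgue:
  "f \<in> borel_measurable borel \<Longrightarrow> f \<in> borel_measurable (lebesgue :: 'a::euclidean_space measure)"
  by (rule measurable_completion) simp

lemma continuous_measurable_lebesgue:
  "continuous_on UNIV f \<Longrightarrow> f \<in> borel_measurable (lebesgue :: 'a::euclidean_space measure)"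
  by (intro borel_measurable_lebesgue borel_measurable_continuous_onI)

lemma smooth_measurable: "smooth f \<Longrightarrow> f \<in> borel_measurable lebesgue"
  by (intro continuous_measurable_lebesgue smooth_imp_continuous_on)

lemma locally_integrable_imp_integrable_indicator:
  "locally_integrable \<Omega> F \<Longrightarrow> compact K \<Longrightarrow> K \<subseteq> \<Omega> \<Longrightarrow> integrable lebesgue (\<lambda>x. indicator K x *\<^sub>R F x)"
  unfolding locally_integrable_def
  by (subst integrable_restrict_space[symmetric]) (auto intro: lmeasurable_compact fmeasurableD)

text \<open>Dominated convergence along \<open>box_bumps\<close> makes the integral of F over each
  box with closure in \<Omega> zero. Boxes are an intersection-stable generator of the Borel sets,
  so the integrals over all Borel subsets of one such box vanish, which forces F = 0 a.e. on it.
  Countably many closed boxes exhaust \<Omega>.\<close>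

theorem fundamental_lemma:
  fixes F :: "real^'n \<Rightarrow> real"
  assumes "open \<Omega>" and F: "locally_integrable \<Omega> F"
    and zero: "\<And>\<phi>. \<phi> \<in> test_functions \<Omega> \<Longrightarrow> (\<integral>x. F x * \<phi> x \<partial>lebesgue_on \<Omega>) = 0"
  shows "AE x in lebesgue. x \<in> \<Omega> \<longrightarrow> F x = 0"
proof -
  have [measurable]: "\<Omega> \<in> sets lebesgue" using assms by auto
  have box0: "(\<integral>x. indicator (box a b) x * F x \<partial>lebesgue) = 0" if ab: "cbox a b \<subseteq> \<Omega>" for a b
  proof -
    obtain \<phi> :: "nat \<Rightarrow> real^'n \<Rightarrow> real" where \<phi>: "\<And>k. \<phi> k \<in> test_functions \<Omega>" "\<And>k x. 0 \<le> \<phi> k x" "\<And>k x. \<phi> k x \<le> 1"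
      "\<And>k x. x \<notin> box a b \<Longrightarrow> \<phi> k x = 0"
      "\<And>x. (\<lambda>k. \<phi> k x) \<longlonglongrightarrow> indicator (box a b) x" using box_bumps[OF ab] by blast
    have eq: "indicator (cbox a b) x *\<^sub>R F x * \<phi> k x = indicator \<Omega> x *\<^sub>R (F x * \<phi> k x)" for k x
      using \<phi>(4)[of x k] ab box_subset_cbox[of a b] by (auto simp: indicator_def)
    have int: "integrable lebesgue (\<lambda>x. indicator (cbox a b) x *\<^sub>R F x)"
      using locally_integrable_imp_integrable_indicator[OF F _ ab] by simp
    have "(\<lambda>k. \<integral>x. indicator (cbox a b) x *\<^sub>R F x * \<phi> k x \<partial>lebesgue)
      \<longlonglongrightarrow> (\<integral>x. indicator (cbox a b) x *\<^sub>R F x * indicator (box a b) x \<partial>lebesgue)"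
    proof (rule integral_dominated_convergence)
      show "(\<lambda>x. indicator (cbox a b) x *\<^sub>R F x * \<phi> k x) \<in> borel_measurable lebesgue" for k
        using \<phi>(1)[of k]
        by (intro borel_measurable_times borel_measurable_integrable[OF int] smooth_measurable)
           (simp add: test_functions_iff)
      show "(\<lambda>x. indicator (cbox a b) x *\<^sub>R F x * indicator (box a b) x) \<in> borel_measurable lebesgue"
        by (intro borel_measurable_times borel_measurable_integrable[OF int] borel_measurable_lebesgue) auto
      show "integrable lebesgue (\<lambda>x. norm (indicator (cbox a b) x *\<^sub>R F x))"
        using int by (rule integrable_norm)
      show "AE x in lebesgue. norm (indicator (cbox a b) x *\<^sub>R F x * \<phi> k x) \<le> norm (indicator (cbox a b) x *\<^sub>R F x)" for k
        using \<phi>(2,3) by (auto simp: abs_mult intro!: mult_left_le)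
    qed (use \<phi>(5) in \<open>auto intro!: tendsto_mult\<close>)
    moreover have "(\<integral>x. indicator (cbox a b) x *\<^sub>R F x * \<phi> k x \<partial>lebesgue) = 0" for k
      using zero[OF \<phi>(1)[of k]] unfolding eq by (subst (asm) integral_restrict_space) auto
    moreover have "(\<lambda>x. indicator (cbox a b) x *\<^sub>R F x * indicator (box a b) x) = (\<lambda>x. indicator (box a b) x * F x)"
      using box_subset_cbox[of a b] by (auto simp: indicator_def fun_eq_iff)
    ultimately show ?thesis using LIMSEQ_unique[OF _ tendsto_const] by fastforce
  qed
  have ae: "AE x in lebesgue. x \<in> cbox c d \<longrightarrow> F x = 0" if cd: "cbox c d \<subseteq> \<Omega>" for c d
  proof -
    have "integrable lebesgue (\<lambda>x. indicator (box c d) x *\<^sub>R (indicator (cbox c d) x *\<^sub>R F x))"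
      by (rule integrable_mult_indicator[OF _ locally_integrable_imp_integrable_indicator[OF F _ cd]]) auto
    moreover have "indicator (box c d) x *\<^sub>R (indicator (cbox c d) x *\<^sub>R F x) = indicator (box c d) x * F x" for x
      using box_subset_cbox[of c d] by (auto simp: indicator_def)
    ultimately have int: "integrable lebesgue (\<lambda>x. indicator (box c d) x * F x)" by (simp only:)
    \<comment> \<open>F is only Lebesgue measurable, while the generator argument runs over Borel
      sets; G is a Borel version of F cut off to one box.\<close>
    then obtain G where G[measurable]: "G \<in> borel_measurable lborel" and "AE x in lborel. indicator (box c d) x * F x = G x"
      using completion_ex_borel_measurable_real borel_measurable_integrable by blast
    then have eq: "AE x in lebesgue. indicator (box c d) x * F x = G x"
      by (simp add: AE_completion)
    have "integrable lebesgue G"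
      by (rule integrable_cong_AE_imp[OF int measurable_completion[OF G] eq])
    then have intG: "integrable lborel G" using integrable_completion[OF G] by simp
    note mG = measurable_completion[OF G]
    have mb: "indicat_real (box a b) \<in> borel_measurable lebesgue" for a b :: "real^'n"
      by (intro borel_measurable_lebesgue) auto
    have box: "(LINT x:box a b|lborel. G x) = 0" for a b
    proof -
      obtain a' b' where ab': "box a b \<inter> box c d = box a' b'" by (rule that[OF box_Int_box])
      have "(LINT x:box a b|lborel. G x) = (\<integral>x. indicator (box a b) x * G x \<partial>lebesgue)"
        unfolding set_lebesgue_integral_def by (subst integral_completion) auto
      also have "\<dots> = (\<integral>x. indicator (box a b) x * (indicator (box c d) x * F x) \<partial>lebesgue)"
        by (rule integral_cong_AE[OF borel_measurable_times[OF mb mG]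
              borel_measurable_times[OF mb borel_measurable_integrable[OF int]]]) (use eq in auto)
      also have "\<dots> = (\<integral>x. indicator (box a' b') x * F x \<partial>lebesgue)"
        unfolding ab'[symmetric] by (intro Bochner_Integration.integral_cong) (auto simp: indicator_def)
      also have "\<dots> = 0"
      proof (cases "box a' b' = {}")
        case False
        then have "cbox a' b' = closure (box a b \<inter> box c d)" using ab' closure_box by metis
        also have "\<dots> \<subseteq> cbox c d" by (meson box_subset_cbox closed_cbox closure_minimal inf.coboundedI2)
        finally show ?thesis using cd box0[of a' b'] by auto
      qed simp
      finally show ?thesis .
    qed
    \<comment> \<open>The complement case of the induction over generated sets needs the integral
      over the whole space. It equals the one over the box that carries G.\<close>
    have total: "integral\<^sup>L lborel G = 0"
    proof -
      have "G x * indicator (box c d) x = G x" if "indicator (box c d) x * F x = G x" for x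
        using that by (auto simp: indicator_def)
      then have "integral\<^sup>L lebesgue G = (\<integral>x. indicator (box c d) x * G x \<partial>lebesgue)"
        by (intro integral_cong_AE[OF mG borel_measurable_times[OF mb mG]]) (use eq in \<open>auto simp: mult.commute\<close>)
      also have "\<dots> = (LINT x:box c d|lborel. G x)"
        unfolding set_lebesgue_integral_def by (subst integral_completion) auto
      finally show ?thesis using box by (simp add: integral_completion)
    qed
    have "AE x in lborel. G x = 0"
    proof (rule sigma_finite_measure.density_zero[OF sigma_finite_lborel intG])
      fix A :: "(real^'n) set" assume "A \<in> sets lborel"
      then have As: "A \<in> sigma_sets UNIV (range (\<lambda>(a, b). box a b))"
        by (simp add: borel_eq_box)
      have Is: "Int_stable (range (\<lambda>(a, b). box a b :: (real^'n) set))"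
        by (auto simp: Int_stable_def box_Int_box)
      have sb: "A \<in> sets borel" if "A \<in> sigma_sets UNIV (range (\<lambda>(a, b). box a b))" for A :: "(real^'n) set"
        using that by (simp add: borel_eq_box)
      have Ps: "range (\<lambda>(a, b). box a b :: (real^'n) set) \<subseteq> Pow UNIV" by auto
      show "set_lebesgue_integral lborel A G = 0"
        using Is Ps As
      proof (induction rule: sigma_sets_induct_disjoint)
        case (basic A)
        then show ?case using box by auto
      next
        case (compl A)
        have [measurable]: "A \<in> sets borel" using compl sb by auto
        have "integral\<^sup>L lborel G = (\<integral>x. indicat_real A x *\<^sub>R G x + indicat_real (UNIV - A) x *\<^sub>R G x \<partial>lborel)"
          by (intro Bochner_Integration.integral_cong) (auto simp: indicator_def)
        also have "\<dots> = set_lebesgue_integral lborel A G + set_lebesgue_integral lborel (UNIV - A) G"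
          unfolding set_lebesgue_integral_def
          by (intro Bochner_Integration.integral_add integrable_mult_indicator intG) auto
        finally show ?case using compl total by simp
      next
        case (union A)
        have Ai: "A i \<in> sets lborel" for i using union sb by auto
        have "(\<Union>i. A i) \<in> sets lborel" using Ai by (intro sets.countable_UN) auto
        then have "set_integrable lborel (\<Union>i. A i) G"
          unfolding set_integrable_def by (intro integrable_mult_indicator intG)
        then have "(LINT x:(\<Union>i. A i)|lborel. G x) = (\<Sum>i. (LINT x:(A i)|lborel. G x))"
          using union(1) Ai by (intro lebesgue_integral_countable_add) (auto simp: disjoint_family_on_def)
        then show ?case using union by simp
      qed (auto simp: set_lebesgue_integral_def)
    qed
    then have "AE x in lebesgue. G x = 0" by (simp add: AE_completion)
    moreover have "AE x in lebesgue. x \<notin> cbox c d - box c d"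
      using negligible_frontier_interval[of c d] unfolding negligible_iff_null_sets by (rule AE_not_in)
    ultimately show ?thesis using eq by eventually_elim (auto simp: indicator_def split: if_splits)
  qed
  obtain \<D> where \<D>: "countable \<D>" "\<D> \<subseteq> Pow \<Omega>" "\<And>X. X \<in> \<D> \<Longrightarrow> \<exists>a b. X = cbox a b" "\<Union>\<D> = \<Omega>"
    by (rule open_countable_Union_open_cbox[OF \<open>open \<Omega>\<close>]) (rule that)
  have "AE x in lebesgue. \<forall>X\<in>\<D>. x \<in> X \<longrightarrow> F x = 0"
  proof (subst AE_ball_countable[OF \<D>(1)], rule ballI)
    fix X assume X: "X \<in> \<D>"
    then obtain a b where "X = cbox a b" using \<D>(3) by blast
    then show "AE x in lebesgue. x \<in> X \<longrightarrow> F x = 0" using ae[of a b] \<D>(2) X by auto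
  qed
  then show ?thesis by eventually_elim (use \<D>(4) in auto)
qed

section \<open>Cutoffs, calculus of test functions and uniqueness of weak gradients\<close>

lemma compact_flat_cutoff:
  fixes K :: "(real^'n) set"
  assumes "open \<Omega>" "compact K" "K \<subseteq> \<Omega>"
  obtains \<psi> V where "\<psi> \<in> test_functions \<Omega>" "open V" "K \<subseteq> V" "\<And>x. 0 \<le> \<psi> x" "\<And>x. \<psi> x \<le> 1"
    "\<And>x. x \<in> V \<Longrightarrow> \<psi> x = 1"
proof -
  have "\<forall>x\<in>K. \<exists>e>0. cball x e \<subseteq> \<Omega>" using assms open_contains_cball by blast
  then obtain e where e: "\<And>x. x \<in> K \<Longrightarrow> e x > 0 \<and> cball x (e x) \<subseteq> \<Omega>" by metis
  have "K \<subseteq> (\<Union>x\<in>K. ball x (e x))" using e by auto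
  then obtain D where D: "D \<subseteq> K" "finite D" "K \<subseteq> (\<Union>x\<in>D. ball x (e x))"
    using compactE_image[OF \<open>compact K\<close>, of K "\<lambda>x. ball x (e x)"] by auto
  define T where "T x = (\<Sum>y\<in>D. bump ((e y)\<^sup>2 - norm (x - y) ^ 2))" for x
  have T: "smooth T" unfolding T_def by (intro smooth_sum smooth_bump smooth_diff smooth_const smooth_norm_power2)
  have Tpos: "T x > 0" if "x \<in> K" for x
  proof -
    obtain y where "y \<in> D" "x \<in> ball y (e y)" using D(3) \<open>x \<in> K\<close> by blast
    then have y: "y \<in> D" "norm (x - y) < e y" by (auto simp: dist_norm norm_minus_commute)
    then have "norm (x - y) ^ 2 < (e y) ^ 2" by (intro power_strict_mono) auto
    then show ?thesis unfolding T_def using y D by (intro sum_pos2[of _ y]) auto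
  qed
  have Tsupp: "x \<in> (\<Union>y\<in>D. cball y (e y))" if "T x \<noteq> 0" for x
  proof -
    obtain y where "y \<in> D" "bump ((e y)\<^sup>2 - norm (x - y) ^ 2) \<noteq> 0"
      using \<open>T x \<noteq> 0\<close> unfolding T_def by (meson sum.neutral)
    then have "y \<in> D" "norm (x - y) ^ 2 < (e y)\<^sup>2" by auto
    moreover have "e y > 0" using \<open>y \<in> D\<close> D e by auto
    ultimately have "norm (x - y) < e y" by (simp add: power2_less_imp_less)
    then have "x \<in> cball y (e y)" by (simp add: dist_norm norm_minus_commute)
    then show ?thesis using \<open>y \<in> D\<close> by blast
  qed
  obtain b where b: "b > 0" "\<And>x. x \<in> K \<Longrightarrow> b < T x"
  proof (cases "K = {}")
    case False
    then obtain x0 where "x0 \<in> K" "\<And>x. x \<in> K \<Longrightarrow> T x0 \<le> T x"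
      using continuous_attains_inf[OF \<open>compact K\<close> _ smooth_imp_continuous_on[OF T]] by metis
    then show ?thesis using that[of "T x0 / 2"] Tpos[of x0] by force
  qed (use that[of 1] in auto)
  define a where "a = bump b"
  have a: "a > 0" unfolding a_def using b by simp
  \<comment> \<open>The bump is nested so as to be flat at both ends. Where T > b the inner bump is
    0 and \<psi> = 1; where T = 0 the inner bump is \<open>bump b\<close> = a and \<psi> = 0. Being
    1 on a neighbourhood of K makes the gradient of \<psi> vanish there.\<close>
  define \<psi> where "\<psi> x = inverse (bump a) * bump (a - bump (b - T x))" for x
  have ba: "bump a > 0" using a by simp
  show ?thesis
  proof (rule that[of \<psi> "{x. b < T x}"])
    have "smooth \<psi>" unfolding \<psi>_def by (intro smooth_mult smooth_bump smooth_diff smooth_const T)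
    moreover have "compactly_contained {x. \<psi> x \<noteq> 0} \<Omega>"
    proof -
      have "{x. \<psi> x \<noteq> 0} \<subseteq> (\<Union>y\<in>D. cball y (e y))"
      proof safe
        fix x assume "\<psi> x \<noteq> 0"
        then have "T x \<noteq> 0" by (auto simp: \<psi>_def a_def)
        then show "x \<in> (\<Union>y\<in>D. cball y (e y))" by (rule Tsupp)
      qed
      moreover have "compactly_contained (\<Union>y\<in>D. cball y (e y)) \<Omega>"
      proof -
        have "compact (\<Union>y\<in>D. cball y (e y))" using D by (intro compact_UN) auto
        then show ?thesis unfolding compactly_contained_def using e D
          by (auto simp: closure_closed compact_imp_closed)
      qed
      ultimately show ?thesis using compactly_contained_subset by blast
    qed
    ultimately show "\<psi> \<in> test_functions \<Omega>" unfolding test_functions_iff by simp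
    show "open {x. b < T x}" using smooth_imp_continuous_on[OF T] by (intro open_Collect_less) auto
    show "\<psi> x \<le> 1" for x
    proof -
      have "bump (a - bump (b - T x)) \<le> bump a" by (rule bump_mono) auto
      then show ?thesis unfolding \<psi>_def using ba by (simp add: field_simps)
    qed
    show "\<psi> x = 1" if "x \<in> {x. b < T x}" for x
    proof -
      have "bump (b - T x) = 0" using that by simp
      then have "\<psi> x = inverse (bump a) * bump a" unfolding \<psi>_def by (simp only: diff_zero)
      then show ?thesis using ba a by simp
    qed
  qed (use b ba in \<open>auto simp: \<psi>_def\<close>)
qed

lemma locally_integrable_mult_compact:
  fixes f :: "real^'n \<Rightarrow> 'b::{banach, second_countable_topology}"
  assumes f: "locally_integrable \<Omega> f" and c: "continuous_on UNIV \<eta>"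
    and s: "compactly_contained {x. \<eta> x \<noteq> (0::real)} \<Omega>"
  shows "integrable lebesgue (\<lambda>x. \<eta> x *\<^sub>R f x)"
proof -
  define K where "K = closure {x. \<eta> x \<noteq> 0}"
  have K: "compact K" "K \<subseteq> \<Omega>" using s by (auto simp: K_def compactly_contained_def)
  have K0: "x \<notin> K \<Longrightarrow> \<eta> x = 0" for x using closure_subset[of "{x. \<eta> x \<noteq> 0}"] by (auto simp: K_def)
  have "bounded (\<eta> ` K)" using K c by (meson compact_continuous_image compact_imp_bounded continuous_on_subset subset_UNIV)
  then obtain B where B: "\<And>x. x \<in> K \<Longrightarrow> \<bar>\<eta> x\<bar> \<le> B" by (auto simp: bounded_iff)
  have B': "\<bar>\<eta> x\<bar> \<le> \<bar>B\<bar>" for x using B[of x] K0[of x] by (cases "x \<in> K") auto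
  have int: "integrable lebesgue (\<lambda>x. indicator K x *\<^sub>R f x)"
    using locally_integrable_imp_integrable_indicator[OF f K] .
  have eq: "\<eta> x *\<^sub>R f x = \<eta> x *\<^sub>R (indicator K x *\<^sub>R f x)" for x using K0 by (auto simp: indicator_def)
  show ?thesis unfolding eq
  proof (rule Bochner_Integration.integrable_bound)
    show "integrable lebesgue (\<lambda>x. \<bar>B\<bar> *\<^sub>R norm (indicator K x *\<^sub>R f x))"
      using int by (intro integrable_scaleR_right integrable_norm)
    show "(\<lambda>x. \<eta> x *\<^sub>R (indicator K x *\<^sub>R f x)) \<in> borel_measurable lebesgue"
      using c by (intro borel_measurable_scaleR borel_measurable_integrable[OF int] continuous_measurable_lebesgue)
    show "AE x in lebesgue. norm (\<eta> x *\<^sub>R (indicator K x *\<^sub>R f x)) \<le> norm (\<bar>B\<bar> *\<^sub>R norm (indicator K x *\<^sub>R f x))"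
      using B' by (auto simp: indicator_def intro!: mult_right_mono)
  qed
qed

lemma locally_integrable_nth:
  "locally_integrable \<Omega> g \<Longrightarrow> locally_integrable \<Omega> (\<lambda>x. g x $ i)"
  unfolding locally_integrable_def
  by (auto intro: integrable_bounded_linear[OF bounded_linear_vec_nth])

lemma integral_lebesgue_on_eq:
  fixes f :: "real^'n \<Rightarrow> 'b::{banach, second_countable_topology}"
  assumes "open \<Omega>" "\<And>x. x \<notin> \<Omega> \<Longrightarrow> f x = 0"
  shows "integral\<^sup>L (lebesgue_on \<Omega>) f = integral\<^sup>L lebesgue f"
proof -
  have "(\<lambda>x. indicator \<Omega> x *\<^sub>R f x) = f" using assms(2) by (auto simp: indicator_def)
  then show ?thesis using assms(1) by (subst integral_restrict_space) auto
qed

lemma test_function_outside: "\<phi> \<in> test_functions \<Omega> \<Longrightarrow> x \<notin> \<Omega> \<Longrightarrow> \<phi> x = 0"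
  using closure_subset[of "{x. \<phi> x \<noteq> 0}"] by (auto simp: test_functions_iff compactly_contained_def)

lemma test_function_mult: "\<phi> \<in> test_functions \<Omega> \<Longrightarrow> smooth f \<Longrightarrow> (\<lambda>x. f x * \<phi> x) \<in> test_functions \<Omega>"
  unfolding test_functions_iff by (auto intro: compactly_contained_subset)

lemma test_function_partial_deriv:
  assumes "\<phi> \<in> test_functions \<Omega>" shows "partial_deriv i \<phi> \<in> test_functions \<Omega>"
proof -
  have "partial_deriv i \<phi> x = 0" if "x \<notin> closure {x. \<phi> x \<noteq> 0}" for x
  proof -
    have "(\<phi> has_derivative (\<lambda>h. 0)) (at x)"
      by (rule has_derivative_transform_within_open[of "\<lambda>x. 0" _ _ _ "- closure {x. \<phi> x \<noteq> 0}"])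
         (use that closure_subset[of "{x. \<phi> x \<noteq> 0}"] in auto)
    then show ?thesis using partial_deriv_eq by blast
  qed
  then have "{x. partial_deriv i \<phi> x \<noteq> 0} \<subseteq> closure {x. \<phi> x \<noteq> 0}" by auto
  moreover have "compactly_contained (closure {x. \<phi> x \<noteq> 0}) \<Omega>"
    using assms by (auto simp: test_functions_iff compactly_contained_def)
  ultimately show ?thesis using assms compactly_contained_subset smooth_partial_deriv
    unfolding test_functions_iff by blast
qed

lemma integrable_mult_test:
  fixes f :: "real^'n \<Rightarrow> real"
  shows "locally_integrable \<Omega> f \<Longrightarrow> \<phi> \<in> test_functions \<Omega> \<Longrightarrow> integrable lebesgue (\<lambda>x. f x * \<phi> x)"
  using locally_integrable_mult_compact[of \<Omega> f \<phi>]
  by (auto simp: test_functions_iff smooth_imp_continuous_on mult.commute)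

lemma is_weak_gradient_lebesgue:
  assumes "open \<Omega>"
  shows "is_weak_gradient \<Omega> f g \<longleftrightarrow> locally_integrable \<Omega> f \<and> locally_integrable \<Omega> g \<and>
    (\<forall>\<phi>\<in>test_functions \<Omega>. \<forall>i.
       (\<integral>x. f x * partial_deriv i \<phi> x \<partial>lebesgue) = - (\<integral>x. g x $ i * \<phi> x \<partial>lebesgue))"
proof -
  have "(\<integral>x. f x * partial_deriv i \<phi> x \<partial>lebesgue_on \<Omega>) = (\<integral>x. f x * partial_deriv i \<phi> x \<partial>lebesgue)"
    "(\<integral>x. g x $ i * \<phi> x \<partial>lebesgue_on \<Omega>) = (\<integral>x. g x $ i * \<phi> x \<partial>lebesgue)" if "\<phi> \<in> test_functions \<Omega>" for \<phi> i
    using that test_function_outside test_function_partial_deriv assms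
    by (auto intro!: integral_lebesgue_on_eq) blast+
  then show ?thesis unfolding is_weak_gradient_def by auto
qed

lemma locally_integrable_diff:
  "locally_integrable \<Omega> f \<Longrightarrow> locally_integrable \<Omega> g \<Longrightarrow> locally_integrable \<Omega> (\<lambda>x. f x - g x)"
  unfolding locally_integrable_def by auto

text \<open>The fundamental lemma, applied to each component of g - g'. It makes the choice in
  \<open>weak_gradient\<close> harmless: an energy may be computed with any representative.\<close>

lemma weak_gradient_unique:
  assumes "open \<Omega>" "is_weak_gradient \<Omega> f g" "is_weak_gradient \<Omega> f g'"
  shows "AE x in lebesgue. x \<in> \<Omega> \<longrightarrow> g x = g' x"
proof -
  have "AE x in lebesgue. x \<in> \<Omega> \<longrightarrow> g x $ i - g' x $ i = 0" for i
  proof (rule fundamental_lemma[OF \<open>open \<Omega>\<close>])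
    show l: "locally_integrable \<Omega> (\<lambda>x. g x $ i - g' x $ i)"
      using assms by (intro locally_integrable_diff locally_integrable_nth) (auto simp: is_weak_gradient_def)
    fix \<phi> assume \<phi>: "\<phi> \<in> test_functions \<Omega>"
    have "(\<integral>x. (g x $ i - g' x $ i) * \<phi> x \<partial>lebesgue_on \<Omega>) = (\<integral>x. g x $ i * \<phi> x - g' x $ i * \<phi> x \<partial>lebesgue)"
      using \<phi> test_function_outside assms(1) by (subst integral_lebesgue_on_eq) (auto simp: algebra_simps)
    also have "\<dots> = (\<integral>x. g x $ i * \<phi> x \<partial>lebesgue) - (\<integral>x. g' x $ i * \<phi> x \<partial>lebesgue)"
      using assms \<phi> by (intro Bochner_Integration.integral_diff integrable_mult_test locally_integrable_nth)
        (auto simp: is_weak_gradient_def)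
    also have "\<dots> = 0"
    proof -
      have "(\<integral>x. f x * partial_deriv i \<phi> x \<partial>lebesgue) = - (\<integral>x. g x $ i * \<phi> x \<partial>lebesgue)"
        "(\<integral>x. f x * partial_deriv i \<phi> x \<partial>lebesgue) = - (\<integral>x. g' x $ i * \<phi> x \<partial>lebesgue)"
        using assms \<phi> by (simp_all add: is_weak_gradient_lebesgue)
      then show ?thesis by simp
    qed
    finally show "(\<integral>x. (g x $ i - g' x $ i) * \<phi> x \<partial>lebesgue_on \<Omega>) = 0" .
  qed
  then have "AE x in lebesgue. \<forall>i\<in>UNIV. x \<in> \<Omega> \<longrightarrow> g x $ i - g' x $ i = 0"
    by (intro eventually_ball_finite) auto
  then show ?thesis by eventually_elim (auto simp: vec_eq_iff)
qed

section \<open>Translations of Lebesgue measure and of test functions\<close>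

lemma distr_lborel_translation: "distr lborel borel (\<lambda>x. x + c) = (lborel :: 'a::euclidean_space measure)"
proof -
  have "(\<lambda>x. x + c) = (+) c" by (simp add: fun_eq_iff add.commute)
  then show ?thesis using lborel_distr_plus[of c] by (simp only:)
qed

lemma nn_integral_lborel_translation:
  assumes [measurable]: "f \<in> borel_measurable (borel :: 'a::euclidean_space measure)"
  shows "(\<integral>\<^sup>+x. f (x + c) \<partial>lborel) = (\<integral>\<^sup>+x. f x \<partial>lborel)"
  by (subst (2) distr_lborel_translation[of c, symmetric]) (simp add: nn_integral_distr)

lemma integral_lborel_translation:
  fixes f :: "'a::euclidean_space \<Rightarrow> 'b::{banach, second_countable_topology}"
  assumes [measurable]: "f \<in> borel_measurable borel"
  shows "(\<integral>x. f (x + c) \<partial>lborel) = (\<integral>x. f x \<partial>lborel)"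
  by (subst (2) distr_lborel_translation[of c, symmetric]) (simp add: integral_distr)

lemma integrable_lborel_translation:
  fixes f :: "'a::euclidean_space \<Rightarrow> 'b::{banach, second_countable_topology}"
  assumes "integrable lborel f"
  shows "integrable lborel (\<lambda>x. f (x + c))"
proof -
  have [measurable]: "f \<in> borel_measurable borel" using assms by auto
  show ?thesis using assms
    by (subst (asm) distr_lborel_translation[of c, symmetric]) (simp add: integrable_distr_eq)
qed

lemma k_times_cont_diff_translation:
  "k_times_cont_diff k f \<Longrightarrow> k_times_cont_diff k (\<lambda>x. f (x + c))"
proof (induction k arbitrary: f)
  case 0
  then show ?case by (auto intro!: continuous_on_compose2[of UNIV f UNIV "\<lambda>x. x + c"] continuous_intros)
next
  case (Suc k)
  have d: "(f has_derivative frechet_derivative f (at x)) (at x)" for x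
    using Suc.prems by (auto simp: differentiable_on_def frechet_derivative_works)
  have e: "((\<lambda>x. f (x + c)) has_derivative frechet_derivative f (at (x + c))) (at x)" for x
    by (rule has_derivative_compose[of "\<lambda>x. x + c" "\<lambda>h. h" x UNIV, OF _ d]) (auto intro!: derivative_eq_intros)
  then have "(\<lambda>x. f (x + c)) differentiable_on UNIV"
    by (auto simp: differentiable_on_def differentiable_def)
  moreover have "partial_deriv i (\<lambda>x. f (x + c)) = (\<lambda>x. partial_deriv i f (x + c))" for i
    by (rule ext, subst partial_deriv_eq[OF e]) (simp add: partial_deriv_def)
  ultimately show ?case using Suc by auto
qed

lemma smooth_translation: "smooth f \<Longrightarrow> smooth (\<lambda>x. f (x + c))"
  by (auto simp: smooth_def k_times_cont_diff_translation)

lemma partial_deriv_translation: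
  assumes "smooth f" shows "partial_deriv i (\<lambda>x. f (x + c)) x = partial_deriv i f (x + c)"
proof -
  have "((\<lambda>x. f (x + c)) has_derivative (\<lambda>h. \<Sum>i\<in>UNIV. h $ i * partial_deriv i f (x + c))) (at x)"
    by (rule has_derivative_compose[of "\<lambda>x. x + c" "\<lambda>h. h" x UNIV, OF _ smooth_has_derivative[OF assms]])
       (auto intro!: derivative_eq_intros)
  from partial_deriv_eq[OF this] show ?thesis
    by (simp add: axis_def if_distrib[of "\<lambda>x. x * _"] cong: if_cong)
qed

lemma compactly_contained_UNIV: "compactly_contained S UNIV \<longleftrightarrow> bounded (S :: 'a::euclidean_space set)"
  by (simp add: compactly_contained_def)

lemma test_function_translation: "\<phi> \<in> test_functions UNIV \<Longrightarrow> (\<lambda>x. \<phi> (x + c)) \<in> test_functions UNIV"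
proof -
  assume "\<phi> \<in> test_functions UNIV"
  then have "smooth \<phi>" "bounded {x. \<phi> x \<noteq> 0}" by (auto simp: test_functions_iff compactly_contained_UNIV)
  moreover have "{x. \<phi> (x + c) \<noteq> 0} = (\<lambda>x. - c + x) ` {x. \<phi> x \<noteq> 0}"
    by (force simp: image_iff algebra_simps)
  moreover have "bounded ((\<lambda>x. - c + x) ` {x. \<phi> x \<noteq> 0})"
    by (rule bounded_translation) fact
  ultimately show ?thesis
    by (simp only: test_functions_iff compactly_contained_UNIV smooth_translation simp_thms)
qed

lemma test_function_bounded:
  assumes "\<phi> \<in> test_functions \<Omega>"
  obtains B where "B \<ge> 0" "\<And>x. \<bar>\<phi> x\<bar> \<le> B"
proof -
  have "bounded (\<phi> ` closure {x. \<phi> x \<noteq> 0})"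
    using assms by (intro compact_imp_bounded compact_continuous_image smooth_imp_continuous_on)
      (auto simp: test_functions_iff compactly_contained_def)
  then obtain B where B: "\<And>x. x \<in> closure {x. \<phi> x \<noteq> 0} \<Longrightarrow> \<bar>\<phi> x\<bar> \<le> B" by (auto simp: bounded_iff)
  have "\<bar>\<phi> x\<bar> \<le> max B 0" for x
    using B[of x] closure_subset[of "{x. \<phi> x \<noteq> 0}"] by (cases "\<phi> x = 0") auto
  then show ?thesis using that[of "max B 0"] by auto
qed

lemma test_function_measurable: "\<phi> \<in> test_functions \<Omega> \<Longrightarrow> \<phi> \<in> borel_measurable borel"
  by (auto simp: test_functions_iff intro!: borel_measurable_continuous_onI smooth_imp_continuous_on)

section \<open>Weak gradients on the whole space\<close>

text \<open>Integrability is taken over \<open>lborel\<close>, not \<open>lebesgue\<close>: the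
  segment formula integrates over product spaces and translates arguments, which needs Borel
  measurable representatives.\<close>

definition W11 :: "(real^'n \<Rightarrow> real) \<Rightarrow> (real^'n \<Rightarrow> real^'n) \<Rightarrow> bool"
  where "W11 f g \<longleftrightarrow> integrable lborel f \<and> integrable lborel g \<and>
    (\<forall>\<phi>\<in>test_functions UNIV. \<forall>i.
       (\<integral>x. f x * partial_deriv i \<phi> x \<partial>lborel) = - (\<integral>x. g x $ i * \<phi> x \<partial>lborel))"

text \<open>The common majorant for all uses of Fubini along segments. For fixed t, translation
  invariance makes the integral of |F (x + t h)| over x independent of t, so the integral over t in
  [0, 1] is finite.\<close>

lemma integrable_segments_bound:
  fixes F :: "real^'n \<Rightarrow> real"
  assumes F: "integrable lborel F" and G: "G \<in> borel_measurable (borel \<Otimes>\<^sub>M borel)"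
    and bound: "\<And>t x. \<bar>G (t, x)\<bar> \<le> indicator {0..1::real} t * (B * \<bar>F (x + t *\<^sub>R h)\<bar>)"
  shows "integrable (lborel \<Otimes>\<^sub>M lborel) G"
proof (rule Bochner_Integration.integrable_bound)
  have [measurable]: "F \<in> borel_measurable borel" using F by auto
  show "G \<in> borel_measurable (lborel \<Otimes>\<^sub>M lborel)" using G by simp
  show "AE z in lborel \<Otimes>\<^sub>M lborel. norm (G z) \<le> norm (case z of (t, x) \<Rightarrow> indicator {0..1::real} t * (B * \<bar>F (x + t *\<^sub>R h)\<bar>))"
    using bound by (intro AE_I2) (smt (verit) case_prod_conv real_norm_def surj_pair)
  have tr: "(\<integral>x. \<bar>F (x + c)\<bar> \<partial>lborel) = (\<integral>x. \<bar>F x\<bar> \<partial>lborel)" for c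
    by (rule integral_lborel_translation) simp
  show "integrable (lborel \<Otimes>\<^sub>M lborel) (\<lambda>(t, x). indicator {0..1::real} t * (B * \<bar>F (x + t *\<^sub>R h)\<bar>))"
  proof (rule lborel_pair.Fubini_integrable)
    show "(\<lambda>(t, x). indicator {0..1::real} t * (B * \<bar>F (x + t *\<^sub>R h)\<bar>)) \<in> borel_measurable (lborel \<Otimes>\<^sub>M lborel)"
      by measurable
    have eq: "(\<integral>x. norm (case (t, x) of (t, x) \<Rightarrow> indicator {0..1::real} t * (B * \<bar>F (x + t *\<^sub>R h)\<bar>)) \<partial>lborel)
      = indicator {0..1} t * (\<bar>B\<bar> * (\<integral>x. \<bar>F x\<bar> \<partial>lborel))" for t
      by (simp add: abs_mult tr)
    show "integrable lborel (\<lambda>t. \<integral>x. norm (case (t, x) of (t, x) \<Rightarrow> indicator {0..1::real} t * (B * \<bar>F (x + t *\<^sub>R h)\<bar>)) \<partial>lborel)"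
      unfolding eq by (intro integrable_mult_left) auto
    show "AE t in lborel. integrable lborel (\<lambda>x. case (t, x) of (t, x) \<Rightarrow> indicator {0..1::real} t * (B * \<bar>F (x + t *\<^sub>R h)\<bar>))"
      by (intro AE_I2) (auto intro!: integrable_mult_right integrable_abs integrable_lborel_translation F)
  qed
qed

lemma test_function_segment:
  assumes "\<phi> \<in> test_functions \<Omega>"
  shows "\<phi> (x + h) - \<phi> x = (\<integral>t. indicator {0..1} t * (\<Sum>i\<in>UNIV. h $ i * partial_deriv i \<phi> (x + t *\<^sub>R h)) \<partial>lborel)"
proof -
  have s: "smooth \<phi>" using assms by (simp add: test_functions_iff)
  have "(\<integral>t. indicator {0..1} t *\<^sub>R (\<Sum>i\<in>UNIV. h $ i * partial_deriv i \<phi> (x + t *\<^sub>R h)) \<partial>lborel)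
    = \<phi> (x + 1 *\<^sub>R h) - \<phi> (x + 0 *\<^sub>R h)"
  proof (rule integral_FTC_Icc[where F="\<lambda>t. \<phi> (x + t *\<^sub>R h)"])
    fix t :: real
    have "((\<lambda>t. x + t *\<^sub>R h) has_derivative (\<lambda>s. s *\<^sub>R h)) (at t within {0..1})"
      by (auto intro!: derivative_eq_intros)
    from has_derivative_compose[OF this smooth_has_derivative[OF s]]
    show "((\<lambda>t. \<phi> (x + t *\<^sub>R h)) has_vector_derivative (\<Sum>i\<in>UNIV. h $ i * partial_deriv i \<phi> (x + t *\<^sub>R h))) (at t within {0..1})"
      by (simp add: has_vector_derivative_def sum_distrib_left mult_ac)
  next
    show "continuous_on {0..1} (\<lambda>t. \<Sum>i\<in>UNIV. h $ i * partial_deriv i \<phi> (x + t *\<^sub>R h))"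
      by (intro continuous_intros continuous_on_compose2[OF smooth_imp_continuous_on[OF smooth_partial_deriv[OF s], of UNIV]]) auto
  qed simp
  then show ?thesis by simp
qed

lemma W11_nth_integrable: "W11 f g \<Longrightarrow> integrable lborel (\<lambda>x. g x $ i)"
  unfolding W11_def by (auto intro: integrable_bounded_linear[OF bounded_linear_vec_nth])

lemma integrable_mult_bounded:
  fixes f :: "'a \<Rightarrow> real"
  assumes "integrable M f" "\<phi> \<in> borel_measurable M" "\<And>x. \<bar>\<phi> x\<bar> \<le> B"
  shows "integrable M (\<lambda>x. f x * \<phi> x)"
proof (rule Bochner_Integration.integrable_bound)
  show "integrable M (\<lambda>x. B * \<bar>f x\<bar>)" using assms by auto
  show "AE x in M. norm (f x * \<phi> x) \<le> norm (B * \<bar>f x\<bar>)"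
  proof (intro AE_I2)
    fix x
    have "\<bar>\<phi> x\<bar> * \<bar>f x\<bar> \<le> \<bar>B\<bar> * \<bar>f x\<bar>"
      using assms(3)[of x] by (intro mult_right_mono) auto
    then show "norm (f x * \<phi> x) \<le> norm (B * \<bar>f x\<bar>)" by (simp add: abs_mult mult.commute)
  qed
qed (use assms in auto)

lemma integrable_lebesgue_imp_locally_integrable:
  fixes f :: "real^'n \<Rightarrow> 'b::{banach, second_countable_topology}"
  assumes "integrable lebesgue f" shows "locally_integrable \<Omega> f"
  unfolding locally_integrable_def
  using assms by (auto simp: integrable_restrict_space lmeasurable_compact fmeasurableD intro!: integrable_mult_indicator)

text \<open>The fundamental theorem of calculus on segments, by duality: test with \<phi>, move the
  shift from f to \<phi>, apply the classical theorem to \<phi> along -h, and integrate by parts for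
  each t. The vector h is fixed and the exceptional null set depends on it.\<close>

theorem W11_segment:
  fixes f :: "real^'n \<Rightarrow> real"
  assumes W: "W11 f g"
  shows "AE x in lborel. f (x + h) - f x = (\<integral>t. indicator {0..1} t * (g (x + t *\<^sub>R h) \<bullet> h) \<partial>lborel)"
    and "integrable lborel (\<lambda>x. \<integral>t. indicator {0..1} t * (g (x + t *\<^sub>R h) \<bullet> h) \<partial>lborel)"
proof -
  have f: "integrable lborel f" and g: "integrable lborel g" using W by (auto simp: W11_def)
  have [measurable]: "f \<in> borel_measurable borel" "g \<in> borel_measurable borel" using f g by auto
  have gh: "integrable lborel (\<lambda>x. g x \<bullet> h)"
    using g by (rule integrable_inner_left)
  define I where "I x = (\<integral>t. indicator {0..1} t * (g (x + t *\<^sub>R h) \<bullet> h) \<partial>lborel)" for x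
  have intJ: "integrable (lborel \<Otimes>\<^sub>M lborel) (\<lambda>(t, x). indicator {0..1::real} t * (g (x + t *\<^sub>R h) \<bullet> h))"
  proof (rule integrable_segments_bound[OF gh, where B=1 and h=h])
    show "(\<lambda>(t, x). indicator {0..1::real} t * (g (x + t *\<^sub>R h) \<bullet> h)) \<in> borel_measurable (borel \<Otimes>\<^sub>M borel)"
      by measurable
  qed (auto simp: abs_mult)
  have I: "integrable lborel I"
    unfolding I_def using lborel_pair.integrable_snd[OF intJ] by simp
  have key: "(\<integral>x. (f (x + h) - f x) * \<phi> x \<partial>lborel) = (\<integral>x. I x * \<phi> x \<partial>lborel)" if \<phi>: "\<phi> \<in> test_functions UNIV" for \<phi>
  proof -
    have [measurable]: "\<phi> \<in> borel_measurable borel" "\<And>i. partial_deriv i \<phi> \<in> borel_measurable borel"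
      using \<phi> test_function_measurable test_function_partial_deriv by blast+
    obtain B where B: "B \<ge> 0" "\<And>x. \<bar>\<phi> x\<bar> \<le> B" using test_function_bounded[OF \<phi>] by metis
    have "\<forall>i. \<exists>C. C \<ge> 0 \<and> (\<forall>x. \<bar>partial_deriv i \<phi> x\<bar> \<le> C)"
      using test_function_bounded[OF test_function_partial_deriv[OF \<phi>]] by metis
    then obtain C where C: "\<And>i. C i \<ge> 0" "\<And>i x. \<bar>partial_deriv i \<phi> x\<bar> \<le> C i" by metis
    define D where "D x = (\<Sum>i\<in>UNIV. h $ i * partial_deriv i \<phi> x)" for x
    have [measurable]: "D \<in> borel_measurable borel" unfolding D_def by measurable
    define C' where "C' = (\<Sum>i\<in>UNIV. \<bar>h $ i\<bar> * C i)"
    have DC: "\<bar>D x\<bar> \<le> C'" for x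
      unfolding D_def C'_def by (rule order_trans[OF sum_abs]) (auto simp: abs_mult intro!: sum_mono mult_left_mono C)
    have fint: "integrable lborel (\<lambda>x. f (x + h) * \<phi> x)" "integrable lborel (\<lambda>x. f x * \<phi> x)"
        "integrable lborel (\<lambda>x. f x * \<phi> (x + (- h)))"
      using B f by (auto intro!: integrable_mult_bounded[where B=B] integrable_lborel_translation)
    have "(\<integral>x. (f (x + h) - f x) * \<phi> x \<partial>lborel) = (\<integral>x. f (x + h) * \<phi> x \<partial>lborel) - (\<integral>x. f x * \<phi> x \<partial>lborel)"
      using fint by (simp add: left_diff_distrib)
    also have "(\<integral>x. f (x + h) * \<phi> x \<partial>lborel) = (\<integral>x. f x * \<phi> (x + (- h)) \<partial>lborel)"
      using integral_lborel_translation[of "\<lambda>x. f x * \<phi> (x + (- h))" h] by simp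
    also have "(\<integral>x. f x * \<phi> (x + (- h)) \<partial>lborel) - (\<integral>x. f x * \<phi> x \<partial>lborel) = (\<integral>x. f x * (\<phi> (x + (- h)) - \<phi> x) \<partial>lborel)"
      using fint by (simp add: right_diff_distrib)
    also have "\<dots> = (\<integral>x. (\<integral>t. f x * (indicator {0..1} t * - D (x + t *\<^sub>R (- h))) \<partial>lborel) \<partial>lborel)"
      unfolding D_def by (subst test_function_segment[OF \<phi>]) (simp add: sum_negf)
    also have "\<dots> = (\<integral>t. (\<integral>x. f x * (indicator {0..1} t * - D (x + t *\<^sub>R (- h))) \<partial>lborel) \<partial>lborel)"
    proof (rule lborel_pair.Fubini_integral)
      show "integrable (lborel \<Otimes>\<^sub>M lborel) (\<lambda>(t, x). f x * (indicator {0..1::real} t * - D (x + t *\<^sub>R (- h))))"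
      proof (rule integrable_segments_bound[OF f, where B=C' and h=0])
        show "\<bar>case (t, x) of (t, x) \<Rightarrow> f x * (indicator {0..1::real} t * - D (x + t *\<^sub>R (- h)))\<bar>
          \<le> indicator {0..1} t * (C' * \<bar>f (x + t *\<^sub>R 0)\<bar>)" for t x
          using mult_right_mono[OF DC[of "x - t *\<^sub>R h"], of "\<bar>f x\<bar>"] by (auto simp: abs_mult indicator_def mult_ac)
      qed measurable
    qed
    \<comment> \<open>For fixed t the weak derivative is tested with the translate of \<phi> by -t
      h; shifting the variable back by t h moves the translation onto g.\<close>
    also have "\<dots> = (\<integral>t. (\<integral>x. indicator {0..1} t * (g (x + t *\<^sub>R h) \<bullet> h) * \<phi> x \<partial>lborel) \<partial>lborel)"
    proof (rule Bochner_Integration.integral_cong)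
      fix t :: real
      have \<phi>t: "(\<lambda>x. \<phi> (x + t *\<^sub>R (- h))) \<in> test_functions UNIV" using \<phi> by (rule test_function_translation)
      have pd: "partial_deriv i (\<lambda>x. \<phi> (x + t *\<^sub>R (- h))) x = partial_deriv i \<phi> (x + t *\<^sub>R (- h))" for i x
        using \<phi> by (intro partial_deriv_translation) (simp add: test_functions_iff)
      have int1: "integrable lborel (\<lambda>x. f x * partial_deriv i \<phi> (x + t *\<^sub>R (- h)))" for i
        using C f by (intro integrable_mult_bounded[where B="C i"]) auto
      have int2: "integrable lborel (\<lambda>x. g x $ i * \<phi> (x + t *\<^sub>R (- h)))" for i
        using B W11_nth_integrable[OF W] by (intro integrable_mult_bounded[where B=B]) auto
      have "(\<integral>x. f x * - D (x + t *\<^sub>R (- h)) \<partial>lborel)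
        = (\<integral>x. (\<Sum>i\<in>UNIV. - h $ i * (f x * partial_deriv i \<phi> (x + t *\<^sub>R (- h)))) \<partial>lborel)"
        unfolding D_def by (intro Bochner_Integration.integral_cong) (auto simp: sum_distrib_left sum_negf mult_ac)
      also have "\<dots> = (\<Sum>i\<in>UNIV. - h $ i * (\<integral>x. f x * partial_deriv i \<phi> (x + t *\<^sub>R (- h)) \<partial>lborel))"
        using int1 by (subst Bochner_Integration.integral_sum) auto
      also have "\<dots> = (\<Sum>i\<in>UNIV. h $ i * (\<integral>x. g x $ i * \<phi> (x + t *\<^sub>R (- h)) \<partial>lborel))"
      proof (intro sum.cong refl)
        fix i
        have "(\<integral>x. f x * partial_deriv i (\<lambda>x. \<phi> (x + t *\<^sub>R (- h))) x \<partial>lborel) = - (\<integral>x. g x $ i * \<phi> (x + t *\<^sub>R (- h)) \<partial>lborel)"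
          using W \<phi>t unfolding W11_def by blast
        then show "- h $ i * (\<integral>x. f x * partial_deriv i \<phi> (x + t *\<^sub>R (- h)) \<partial>lborel) = h $ i * (\<integral>x. g x $ i * \<phi> (x + t *\<^sub>R (- h)) \<partial>lborel)"
          by (simp only: pd)
      qed
      also have "\<dots> = (\<integral>x. (g x \<bullet> h) * \<phi> (x + t *\<^sub>R (- h)) \<partial>lborel)"
        using int2 by (subst Bochner_Integration.integral_mult_right[symmetric], simp, subst Bochner_Integration.integral_sum[symmetric])
           (auto simp: inner_vec_def sum_distrib_left sum_distrib_right mult_ac)
      also have "\<dots> = (\<integral>x. (g (x + t *\<^sub>R h) \<bullet> h) * \<phi> x \<partial>lborel)"
        using integral_lborel_translation[of "\<lambda>x. (g x \<bullet> h) * \<phi> (x + t *\<^sub>R (- h))" "t *\<^sub>R h"] by simp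
      finally show "(\<integral>x. f x * (indicator {0..1} t * - D (x + t *\<^sub>R (- h))) \<partial>lborel)
          = (\<integral>x. indicator {0..1} t * (g (x + t *\<^sub>R h) \<bullet> h) * \<phi> x \<partial>lborel)"
        by (simp add: indicator_def)
    qed simp
    also have "\<dots> = (\<integral>x. (\<integral>t. indicator {0..1} t * (g (x + t *\<^sub>R h) \<bullet> h) * \<phi> x \<partial>lborel) \<partial>lborel)"
    proof (rule lborel_pair.Fubini_integral[symmetric])
      show "integrable (lborel \<Otimes>\<^sub>M lborel) (\<lambda>(t, x). indicator {0..1::real} t * (g (x + t *\<^sub>R h) \<bullet> h) * \<phi> x)"
      proof (rule integrable_segments_bound[OF gh, where B=B and h=h])
        show "\<bar>case (t, x) of (t, x) \<Rightarrow> indicator {0..1::real} t * (g (x + t *\<^sub>R h) \<bullet> h) * \<phi> x\<bar>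
          \<le> indicator {0..1} t * (B * \<bar>g (x + t *\<^sub>R h) \<bullet> h\<bar>)" for t x
          using mult_right_mono[OF B(2)[of x], of "\<bar>g (x + t *\<^sub>R h) \<bullet> h\<bar>"] by (auto simp: abs_mult indicator_def mult_ac)
      qed measurable
    qed
    finally show ?thesis by (simp add: I_def)
  qed
  have meas: "(\<lambda>x. f (x + h) - f x - I x) \<in> borel_measurable lborel" using I by simp
  have int: "integrable lborel (\<lambda>x. f (x + h) - f x - I x)"
    using f I by (auto intro!: integrable_lborel_translation)
  have "AE x in lebesgue. x \<in> UNIV \<longrightarrow> f (x + h) - f x - I x = 0"
  proof (rule fundamental_lemma)
    show "locally_integrable UNIV (\<lambda>x. f (x + h) - f x - I x)"
      using int by (intro integrable_lebesgue_imp_locally_integrable) (simp add: integrable_completion)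
    fix \<phi> :: "real^'n \<Rightarrow> real" assume \<phi>: "\<phi> \<in> test_functions UNIV"
    have [measurable]: "\<phi> \<in> borel_measurable borel" using \<phi> by (rule test_function_measurable)
    obtain B where B: "B \<ge> 0" "\<And>x. \<bar>\<phi> x\<bar> \<le> B" using test_function_bounded[OF \<phi>] by metis
    have "integrable lborel (\<lambda>x. (f (x + h) - f x) * \<phi> x)" "integrable lborel (\<lambda>x. I x * \<phi> x)"
      using B f I by (auto intro!: integrable_mult_bounded[where B=B] integrable_lborel_translation)
    then have "(\<integral>x. (f (x + h) - f x - I x) * \<phi> x \<partial>lborel) = 0"
      using key[OF \<phi>] by (simp add: left_diff_distrib[of _ "I _"])
    then show "(\<integral>x. (f (x + h) - f x - I x) * \<phi> x \<partial>lebesgue_on UNIV) = 0"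
      using meas by (subst integral_lebesgue_on_eq) (auto simp: integral_completion)
  qed simp
  then show "AE x in lborel. f (x + h) - f x = (\<integral>t. indicator {0..1} t * (g (x + t *\<^sub>R h) \<bullet> h) \<partial>lborel)"
    by (simp add: AE_completion_iff I_def)
  show "integrable lborel (\<lambda>x. \<integral>t. indicator {0..1} t * (g (x + t *\<^sub>R h) \<bullet> h) \<partial>lborel)"
    using I unfolding I_def .
qed

section \<open>Continuity of translations in L^1 and difference quotients\<close>

lemma integrable_unit_indicator: "integrable lborel (indicat_real {0..1::real})"
  by (intro integrable_real_indicator) auto

lemma integral_lborel_abs_translation:
  fixes f :: "'a::euclidean_space \<Rightarrow> real"
  shows "integrable lborel f \<Longrightarrow> (\<integral>x. \<bar>f (x + c)\<bar> \<partial>lborel) = (\<integral>x. \<bar>f x\<bar> \<partial>lborel)"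
  using integral_lborel_translation[of "\<lambda>x. \<bar>f x\<bar>" c] by auto

text \<open>Openness controls one sign: a point of U stays in U under small shifts, so max 0 (1_U(x)
  - 1_U(x + h_k)) tends to 0 pointwise, dominated by 1_U. The other sign follows since both
  indicators have the same integral, by |s| = s + 2 max 0 (-s).\<close>

lemma translation_open_continuous_L1:
  fixes U :: "'a::euclidean_space set"
  assumes "open U" and fin: "emeasure lborel U < \<infinity>" and h: "h \<longlonglongrightarrow> 0"
  shows "(\<lambda>k. \<integral>x. \<bar>indicat_real U (x + h k) - indicator U x\<bar> \<partial>lborel) \<longlonglongrightarrow> 0"
proof -
  have U[measurable]: "U \<in> sets borel" using assms by auto
  have i: "integrable lborel (indicat_real U)" using fin by (auto intro!: integrable_real_indicator)
  have it: "integrable lborel (\<lambda>x. indicat_real U (x + c))" for c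
    by (rule integrable_lborel_translation[OF i])
  have "(\<lambda>k. \<integral>x. max 0 (indicat_real U x - indicator U (x + h k)) \<partial>lborel) \<longlonglongrightarrow> (\<integral>x. (0::real) \<partial>(lborel :: 'a measure))"
  proof (rule integral_dominated_convergence)
    show "integrable lborel (indicat_real U)" by (rule i)
    show "AE x in lborel. (\<lambda>k. max 0 (indicat_real U x - indicator U (x + h k))) \<longlonglongrightarrow> 0"
    proof (intro AE_I2)
      fix x
      show "(\<lambda>k. max 0 (indicat_real U x - indicator U (x + h k))) \<longlonglongrightarrow> 0"
      proof (cases "x \<in> U")
        case True
        have "(\<lambda>k. x + h k) \<longlonglongrightarrow> x + 0" by (intro tendsto_intros h)
        then have "\<forall>\<^sub>F k in sequentially. x + h k \<in> U"
          using topological_tendstoD[of _ x _ U] \<open>open U\<close> True by auto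
        then have "\<forall>\<^sub>F k in sequentially. max 0 (indicat_real U x - indicator U (x + h k)) = 0"
          by eventually_elim (use True in auto)
        then show ?thesis by (rule tendsto_eventually)
      qed (auto simp: indicator_def)
    qed
  qed (auto simp: indicator_def)
  moreover have "(\<integral>x. \<bar>indicat_real U (x + c) - indicator U x\<bar> \<partial>lborel)
     = 2 * (\<integral>x. max 0 (indicat_real U x - indicator U (x + c)) \<partial>lborel)" for c
  proof -
    have m: "integrable lborel (\<lambda>x. max 0 (indicat_real U x - indicator U (x + c)))"
      using i it by (intro integrable_max) auto
    have "(\<integral>x. \<bar>indicat_real U (x + c) - indicator U x\<bar> \<partial>lborel) =
       (\<integral>x. (indicat_real U (x + c) - indicator U x) + 2 * max 0 (indicat_real U x - indicator U (x + c)) \<partial>lborel)"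
      by (intro Bochner_Integration.integral_cong) (auto simp: indicator_def)
    also have "\<dots> = ((\<integral>x. indicat_real U (x + c) \<partial>lborel) - (\<integral>x. indicat_real U x \<partial>lborel))
       + 2 * (\<integral>x. max 0 (indicat_real U x - indicator U (x + c)) \<partial>lborel)"
      using i it m by (simp add: )
    also have "(\<integral>x. indicat_real U (x + c) \<partial>lborel) = (\<integral>x. indicat_real U x \<partial>lborel)"
      by (rule integral_lborel_translation) simp
    finally show ?thesis by simp
  qed
  ultimately show ?thesis using tendsto_mult[OF tendsto_const[of 2]] by fastforce
qed

lemma integral_abs_triangle:
  fixes f g :: "'a \<Rightarrow> real"
  assumes "integrable M f" "integrable M g" "integrable M u" "integrable M v"
    and "\<And>x. \<bar>u x\<bar> \<le> \<bar>f x\<bar> + \<bar>g x\<bar> + \<bar>v x\<bar>"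
  shows "(\<integral>x. \<bar>u x\<bar> \<partial>M) \<le> (\<integral>x. \<bar>f x\<bar> \<partial>M) + (\<integral>x. \<bar>g x\<bar> \<partial>M) + (\<integral>x. \<bar>v x\<bar> \<partial>M)"
proof -
  have "(\<integral>x. \<bar>u x\<bar> \<partial>M) \<le> (\<integral>x. \<bar>f x\<bar> + \<bar>g x\<bar> + \<bar>v x\<bar> \<partial>M)"
    using assms by (intro integral_mono) auto
  then show ?thesis using assms by simp
qed

text \<open>The e/3 argument: translation is an isometry of L^1, so the distance to s is paid twice.
  It is used for the sets and for the limits in the induction over integrable functions.\<close>

lemma translation_approx_L1:
  fixes f :: "'a::euclidean_space \<Rightarrow> real"
  assumes f: "integrable lborel f"
    and approx: "\<And>e. e > 0 \<Longrightarrow> \<exists>s. integrable lborel s \<and> (\<integral>x. \<bar>f x - s x\<bar> \<partial>lborel) < e \<and>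
      (\<lambda>k. \<integral>x. \<bar>s (x + h k) - s x\<bar> \<partial>lborel) \<longlonglongrightarrow> 0"
  shows "(\<lambda>k. \<integral>x. \<bar>f (x + h k) - f x\<bar> \<partial>lborel) \<longlonglongrightarrow> 0"
proof (rule LIMSEQ_I)
  fix e :: real assume "e > 0"
  then obtain s where s: "integrable lborel s" "(\<integral>x. \<bar>f x - s x\<bar> \<partial>lborel) < e / 3"
    "(\<lambda>k. \<integral>x. \<bar>s (x + h k) - s x\<bar> \<partial>lborel) \<longlonglongrightarrow> 0" using approx[of "e / 3"] by auto
  obtain k0 where k0: "\<And>k. k \<ge> k0 \<Longrightarrow> \<bar>\<integral>x. \<bar>s (x + h k) - s x\<bar> \<partial>lborel\<bar> < e / 3"
    using LIMSEQ_D[OF s(3), of "e / 3"] \<open>e > 0\<close> by auto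
  have "norm ((\<integral>x. \<bar>f (x + h k) - f x\<bar> \<partial>lborel) - 0) < e" if "k \<ge> k0" for k
  proof -
    have fs: "integrable lborel (\<lambda>x. f x - s x)" using f s by auto
    have "(\<integral>x. \<bar>f (x + h k) - f x\<bar> \<partial>lborel) \<le> (\<integral>x. \<bar>f (x + h k) - s (x + h k)\<bar> \<partial>lborel)
      + (\<integral>x. \<bar>s (x + h k) - s x\<bar> \<partial>lborel) + (\<integral>x. \<bar>f x - s x\<bar> \<partial>lborel)"
      using f s(1) by (intro integral_abs_triangle Bochner_Integration.integrable_diff integrable_lborel_translation) auto
    also have "(\<integral>x. \<bar>f (x + h k) - s (x + h k)\<bar> \<partial>lborel) = (\<integral>x. \<bar>f x - s x\<bar> \<partial>lborel)"
      using integral_lborel_abs_translation[OF fs] .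
    finally show ?thesis using k0[OF that] s(2) by simp
  qed
  then show "\<exists>no. \<forall>n\<ge>no. norm ((\<integral>x. \<bar>f (x + h n) - f x\<bar> \<partial>lborel) - 0) < e" by blast
qed

text \<open>Outer regularity replaces a measurable set of finite measure by an open one, for which
  continuity is known; sums and dominated limits then reach every integrable function.\<close>

theorem translation_continuous_L1:
  fixes f :: "'a::euclidean_space \<Rightarrow> real"
  assumes f: "integrable lborel f" and h: "h \<longlonglongrightarrow> 0"
  shows "(\<lambda>k. \<integral>x. \<bar>f (x + h k) - f x\<bar> \<partial>lborel) \<longlonglongrightarrow> 0"
  using f
proof (induction rule: integrable_induct)
  case (base A c)
  have A[measurable]: "A \<in> sets borel" using base by simp
  have iA: "integrable lborel (indicat_real A)" using base by (auto intro!: integrable_real_indicator)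
  have "(\<lambda>k. \<integral>x. \<bar>indicat_real A (x + h k) - indicator A x\<bar> \<partial>lborel) \<longlonglongrightarrow> 0"
  proof (rule translation_approx_L1[OF iA])
    fix e :: real assume "e > 0"
    then obtain U where U: "open U" "A \<subseteq> U" "emeasure lborel (U - A) < e"
      using outer_regular_lborel[of A e] by auto
    have [measurable]: "U \<in> sets borel" using U by auto
    have "emeasure lborel U \<le> emeasure lborel (A \<union> (U - A))" by (intro emeasure_mono) auto
    also have "\<dots> \<le> emeasure lborel A + emeasure lborel (U - A)" by (intro emeasure_subadditive) auto
    also have "\<dots> < \<infinity>" using base U(3) by (auto simp: less_top intro: order.strict_trans)
    finally have fin: "emeasure lborel U < \<infinity>" .
    have "(\<integral>x. \<bar>indicat_real A x - indicator U x\<bar> \<partial>lborel) = (\<integral>x. indicat_real (U - A) x \<partial>lborel)"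
      using U(2) by (intro Bochner_Integration.integral_cong) (auto simp: indicator_def)
    also have "\<dots> < e" using U(3) \<open>e > 0\<close>
      by (auto simp: measure_def enn2real_less_iff ennreal_less_iff less_top)
         (metis enn2real_less_iff ennreal_less_top less_trans not_le)
    finally show "\<exists>s. integrable lborel s \<and> (\<integral>x. \<bar>indicat_real A x - s x\<bar> \<partial>lborel) < e \<and>
      (\<lambda>k. \<integral>x. \<bar>s (x + h k) - s x\<bar> \<partial>lborel) \<longlonglongrightarrow> 0"
      using translation_open_continuous_L1[OF U(1) fin h] fin
      by (intro exI[of _ "indicat_real U"]) (auto intro!: integrable_real_indicator)
  qed
  from tendsto_mult_right[OF this, of "\<bar>c\<bar>"]
  have "(\<lambda>k. \<integral>x. \<bar>indicat_real A (x + h k) - indicator A x\<bar> * \<bar>c\<bar> \<partial>lborel) \<longlonglongrightarrow> 0"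
    by simp
  then show ?case by (simp add: left_diff_distrib[symmetric] abs_mult)
next
  case (add f g)
  have "(\<lambda>k. (\<integral>x. \<bar>f (x + h k) - f x\<bar> \<partial>lborel) + (\<integral>x. \<bar>g (x + h k) - g x\<bar> \<partial>lborel)) \<longlonglongrightarrow> 0 + 0"
    using add by (intro tendsto_add) auto
  moreover have "(\<integral>x. \<bar>f (x + h k) + g (x + h k) - (f x + g x)\<bar> \<partial>lborel) \<le>
     (\<integral>x. \<bar>f (x + h k) - f x\<bar> \<partial>lborel) + (\<integral>x. \<bar>g (x + h k) - g x\<bar> \<partial>lborel)" for k
  proof -
    have i: "integrable lborel (\<lambda>x. f (x + h k) - f x)" "integrable lborel (\<lambda>x. g (x + h k) - g x)"
      using add by (auto intro!: Bochner_Integration.integrable_diff integrable_lborel_translation)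
    then have "integrable lborel (\<lambda>x. (f (x + h k) - f x) + (g (x + h k) - g x))"
      by (rule Bochner_Integration.integrable_add)
    then have "integrable lborel (\<lambda>x. f (x + h k) + g (x + h k) - (f x + g x))" by (simp add: algebra_simps)
    then have "(\<integral>x. \<bar>f (x + h k) + g (x + h k) - (f x + g x)\<bar> \<partial>lborel) \<le>
       (\<integral>x. \<bar>f (x + h k) - f x\<bar> \<partial>lborel) + (\<integral>x. \<bar>g (x + h k) - g x\<bar> \<partial>lborel) + (\<integral>x. \<bar>0\<bar> \<partial>(lborel :: 'a measure))"
      by (rule integral_abs_triangle[OF i _ integrable_zero]) auto
    then show ?thesis by simp
  qed
  ultimately have "(\<lambda>k. (\<integral>x. \<bar>f (x + h k) - f x\<bar> \<partial>lborel) + (\<integral>x. \<bar>g (x + h k) - g x\<bar> \<partial>lborel)) \<longlonglongrightarrow> 0"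
     and le: "\<And>k. (\<integral>x. \<bar>f (x + h k) + g (x + h k) - (f x + g x)\<bar> \<partial>lborel) \<le>
     (\<integral>x. \<bar>f (x + h k) - f x\<bar> \<partial>lborel) + (\<integral>x. \<bar>g (x + h k) - g x\<bar> \<partial>lborel)" by simp_all
  from tendsto_sandwich[OF _ _ tendsto_const this(1)]
  show ?case using le by simp
next
  case (lim f s)
  show ?case
  proof (rule translation_approx_L1[OF lim.hyps(4)])
    fix e :: real assume "e > 0"
    have "(\<lambda>i. \<integral>x. \<bar>f x - s i x\<bar> \<partial>lborel) \<longlonglongrightarrow> (\<integral>x. 0 \<partial>(lborel :: 'a measure))"
    proof (rule integral_dominated_convergence)
      show "integrable lborel (\<lambda>x. 3 * \<bar>f x\<bar>)" using lim by auto
      show "AE x in lborel. (\<lambda>i. \<bar>f x - s i x\<bar>) \<longlonglongrightarrow> 0"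
      proof (intro AE_I2)
        fix x
        have "(\<lambda>i. \<bar>f x - s i x\<bar>) \<longlonglongrightarrow> \<bar>f x - f x\<bar>" using lim.hyps(2) by (intro tendsto_intros) auto
        then show "(\<lambda>i. \<bar>f x - s i x\<bar>) \<longlonglongrightarrow> 0" by simp
      qed
      show "AE x in lborel. norm \<bar>f x - s i x\<bar> \<le> 3 * \<bar>f x\<bar>" for i
      proof (intro AE_I2)
        fix x show "norm \<bar>f x - s i x\<bar> \<le> 3 * \<bar>f x\<bar>" using lim.hyps(3)[of x i] by auto
      qed
    qed (use lim in auto)
    then obtain i where "\<bar>\<integral>x. \<bar>f x - s i x\<bar> \<partial>lborel\<bar> < e"
      using LIMSEQ_D[of _ 0 e] \<open>e > 0\<close> by fastforce
    then show "\<exists>s. integrable lborel s \<and> (\<integral>x. \<bar>f x - s x\<bar> \<partial>lborel) < e \<and>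
      (\<lambda>k. \<integral>x. \<bar>s (x + h k) - s x\<bar> \<partial>lborel) \<longlonglongrightarrow> 0"
      using lim by (intro exI[of _ "s i"]) auto
  qed
qed

text \<open>By the segment formula, the quotient minus the i-th component G of g is the average over
  s in [0, 1] of G(x + s t_k e) - G(x). Its L^1 norm is at most the average of the L^1 modulus of
  continuity of G, which tends to 0 for each s and is bounded by twice the norm of G.\<close>

lemma difference_quotient_L1:
  fixes f :: "real^'n \<Rightarrow> real"
  assumes W: "W11 f g" and t: "t \<longlonglongrightarrow> 0" "\<And>k. t k \<noteq> 0"
  shows "(\<lambda>k. \<integral>x. \<bar>(f (x + t k *\<^sub>R axis i 1) - f x) / t k - g x $ i\<bar> \<partial>lborel) \<longlonglongrightarrow> 0"
proof -
  define e :: "real^'n" where "e = axis i 1"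
  define G where "G x = g x $ i" for x
  have G: "integrable lborel G" unfolding G_def by (rule W11_nth_integrable[OF W])
  have f: "integrable lborel f" using W by (simp add: W11_def)
  have [measurable]: "G \<in> borel_measurable borel" using G by auto
  define \<omega> where "\<omega> h = (\<integral>x. \<bar>G (x + h) - G x\<bar> \<partial>lborel)" for h
  have pair: "integrable (lborel \<Otimes>\<^sub>M lborel) (\<lambda>(s, x). indicator {0..1::real} s * (G (x + s *\<^sub>R h) - G x))" for h
  proof -
    have "integrable (lborel \<Otimes>\<^sub>M lborel) (\<lambda>(s, x). indicator {0..1::real} s * G (x + s *\<^sub>R h))"
      by (rule integrable_segments_bound[OF G, where B=1 and h=h]) (auto simp: abs_mult)
    moreover have "integrable (lborel \<Otimes>\<^sub>M lborel) (\<lambda>(s, x). indicator {0..1::real} s * G x)"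
      by (rule integrable_segments_bound[OF G, where B=1 and h=0]) (auto simp: abs_mult)
    ultimately have "integrable (lborel \<Otimes>\<^sub>M lborel) (\<lambda>z. (case z of (s, x) \<Rightarrow> indicator {0..1::real} s * G (x + s *\<^sub>R h))
       - (case z of (s, x) \<Rightarrow> indicator {0..1::real} s * G x))"
      by (rule Bochner_Integration.integrable_diff)
    then show ?thesis by (rule Bochner_Integration.integrable_cong[THEN iffD1, rotated 2]) (auto simp: right_diff_distrib)
  qed
  have pair': "integrable (lborel \<Otimes>\<^sub>M lborel) (\<lambda>(s, x). indicator {0..1::real} s * \<bar>G (x + s *\<^sub>R h) - G x\<bar>)" for h
    using integrable_abs[OF pair[of h]]
    by (rule Bochner_Integration.integrable_cong[THEN iffD1, rotated 2]) (auto simp: abs_mult)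
  have \<omega>_bound: "0 \<le> \<omega> h" "\<omega> h \<le> 2 * (\<integral>x. \<bar>G x\<bar> \<partial>lborel)" for h
  proof -
    show "\<omega> h \<ge> 0" unfolding \<omega>_def by simp
    have "\<omega> h \<le> (\<integral>x. \<bar>G (x + h)\<bar> \<partial>lborel) + (\<integral>x. \<bar>G x\<bar> \<partial>lborel) + (\<integral>x. \<bar>0\<bar> \<partial>(lborel :: (real^'n) measure))"
      unfolding \<omega>_def
      by (rule integral_abs_triangle[OF integrable_lborel_translation[OF G] G
            Bochner_Integration.integrable_diff[OF integrable_lborel_translation[OF G] G] integrable_zero]) auto
    then show "\<omega> h \<le> 2 * (\<integral>x. \<bar>G x\<bar> \<partial>lborel)" using integral_lborel_abs_translation[OF G] by simp
  qed
  have main: "(\<integral>x. \<bar>(f (x + t k *\<^sub>R e) - f x) / t k - g x $ i\<bar> \<partial>lborel)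
     \<le> (\<integral>s. indicator {0..1} s * \<omega> (s *\<^sub>R t k *\<^sub>R e) \<partial>lborel)" for k
  proof -
    let ?h = "t k *\<^sub>R e"
    have ae: "AE x in lborel. (f (x + ?h) - f x) / t k - g x $ i = (\<integral>s. indicator {0..1} s * (G (x + s *\<^sub>R ?h) - G x) \<partial>lborel)"
      using W11_segment(1)[OF W, of ?h] lborel_pair.AE_integrable_snd[OF pair[of ?h]]
    proof eventually_elim
      case (elim x)
      have ind: "integrable lborel (\<lambda>s. indicator {0..1::real} s * G x)" by (intro integrable_mult_left integrable_unit_indicator)
      have "integrable lborel (\<lambda>s. indicator {0..1} s * (G (x + s *\<^sub>R ?h) - G x) + indicator {0..1} s * G x)"
        using elim(2) ind by (intro Bochner_Integration.integrable_add) auto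
      then have int: "integrable lborel (\<lambda>s. indicator {0..1} s * G (x + s *\<^sub>R ?h))" by (simp add: right_diff_distrib)
      have "f (x + ?h) - f x = t k * (\<integral>s. indicator {0..1} s * G (x + s *\<^sub>R ?h) \<partial>lborel)"
      proof -
        have "(\<lambda>s. indicator {0..1} s * (g (x + s *\<^sub>R ?h) \<bullet> ?h)) = (\<lambda>s. t k * (indicator {0..1} s * G (x + s *\<^sub>R ?h)))"
          by (auto simp: fun_eq_iff G_def e_def inner_axis)
        then show ?thesis using elim(1) by simp
      qed
      then have "(f (x + ?h) - f x) / t k = (\<integral>s. indicator {0..1} s * G (x + s *\<^sub>R ?h) \<partial>lborel)"
        using t(2)[of k] by simp
      moreover have "(\<integral>s. indicator {0..1::real} s * G x \<partial>lborel) = G x" by simp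
      ultimately show ?case using int ind by (simp add: right_diff_distrib G_def)
    qed
    have "(\<integral>x. \<bar>(f (x + ?h) - f x) / t k - g x $ i\<bar> \<partial>lborel) = (\<integral>x. \<bar>\<integral>s. indicator {0..1} s * (G (x + s *\<^sub>R ?h) - G x) \<partial>lborel\<bar> \<partial>lborel)"
      using ae f G lborel_pair.integrable_snd[OF pair[of ?h]]
      by (intro integral_cong_AE) (auto simp flip: G_def intro!: borel_measurable_integrable integrable_lborel_translation)
    also have "\<dots> \<le> (\<integral>x. (\<integral>s. indicator {0..1} s * \<bar>G (x + s *\<^sub>R ?h) - G x\<bar> \<partial>lborel) \<partial>lborel)"
    proof (intro integral_mono)
      show "integrable lborel (\<lambda>x. \<bar>\<integral>s. indicator {0..1} s * (G (x + s *\<^sub>R ?h) - G x) \<partial>lborel\<bar>)"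
        using lborel_pair.integrable_snd[OF pair[of ?h]] by auto
      show "integrable lborel (\<lambda>x. (\<integral>s. indicator {0..1} s * \<bar>G (x + s *\<^sub>R ?h) - G x\<bar> \<partial>lborel))"
        using lborel_pair.integrable_snd[OF pair'[of ?h]] by auto
      show "\<bar>\<integral>s. indicator {0..1} s * (G (x + s *\<^sub>R ?h) - G x) \<partial>lborel\<bar> \<le> (\<integral>s. indicator {0..1} s * \<bar>G (x + s *\<^sub>R ?h) - G x\<bar> \<partial>lborel)" for x
        using integral_abs_bound[of lborel "\<lambda>s. indicator {0..1} s * (G (x + s *\<^sub>R ?h) - G x)"] by (simp add: abs_mult)
    qed
    also have "\<dots> = (\<integral>s. (\<integral>x. indicator {0..1} s * \<bar>G (x + s *\<^sub>R ?h) - G x\<bar> \<partial>lborel) \<partial>lborel)"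
      by (rule lborel_pair.Fubini_integral[OF pair'[of ?h]])
    also have "\<dots> = (\<integral>s. indicator {0..1} s * \<omega> (s *\<^sub>R ?h) \<partial>lborel)" unfolding \<omega>_def by simp
    finally show ?thesis .
  qed
  have [measurable]: "\<omega> \<in> borel_measurable borel"
    unfolding \<omega>_def by measurable
  have "(\<lambda>k. \<integral>s. indicator {0..1} s * \<omega> (s *\<^sub>R t k *\<^sub>R e) \<partial>lborel) \<longlonglongrightarrow> (\<integral>s. 0 \<partial>(lborel :: real measure))"
  proof (rule integral_dominated_convergence)
    show "integrable lborel (\<lambda>s. indicator {0..1::real} s * (2 * (\<integral>x. \<bar>G x\<bar> \<partial>lborel)))"
      by (intro integrable_mult_left integrable_unit_indicator)
    show "AE s in lborel. (\<lambda>k. indicator {0..1} s * \<omega> (s *\<^sub>R t k *\<^sub>R e)) \<longlonglongrightarrow> 0"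
    proof (intro AE_I2)
      fix s :: real
      have "(\<lambda>k. s *\<^sub>R t k *\<^sub>R e) \<longlonglongrightarrow> s *\<^sub>R 0 *\<^sub>R e" by (intro tendsto_intros t)
      then have "(\<lambda>k. s *\<^sub>R t k *\<^sub>R e) \<longlonglongrightarrow> 0" by simp
      from tendsto_mult_left[OF translation_continuous_L1[OF G this], of "indicator {0..1} s"]
      show "(\<lambda>k. indicator {0..1} s * \<omega> (s *\<^sub>R t k *\<^sub>R e)) \<longlonglongrightarrow> 0" unfolding \<omega>_def
        by simp
    qed
    show "AE s in lborel. norm (indicator {0..1} s * \<omega> (s *\<^sub>R t k *\<^sub>R e)) \<le> indicator {0..1::real} s * (2 * (\<integral>x. \<bar>G x\<bar> \<partial>lborel))" for k
      using \<omega>_bound by (auto simp: indicator_def)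
  qed auto
  then have lim: "(\<lambda>k. \<integral>s. indicator {0..1} s * \<omega> (s *\<^sub>R t k *\<^sub>R e) \<partial>lborel) \<longlonglongrightarrow> 0" by simp
  show ?thesis
    by (rule tendsto_sandwich[OF _ _ tendsto_const lim]) (use main in \<open>auto simp: e_def\<close>)
qed

section \<open>Truncation of functions with integrable gradient\<close>

text \<open>Dominated convergence with majorants that vary and converge in L^1. Clip
  \<open>A k\<close> to the interval between -|D0| and |D0|: the clipped functions obey the usual
  theorem, and clipping changes \<open>A k\<close> by at most |D k - D0|.\<close>

lemma integral_tendsto_dominated_L1:
  fixes A D :: "nat \<Rightarrow> 'a \<Rightarrow> real"
  assumes D: "\<And>k. integrable M (D k)" "integrable M D0"
    and conv: "(\<lambda>k. \<integral>x. \<bar>D k x - D0 x\<bar> \<partial>M) \<longlonglongrightarrow> 0"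
    and A[measurable]: "\<And>k. A k \<in> borel_measurable M" "A0 \<in> borel_measurable M"
    and bound: "\<And>k x. \<bar>A k x\<bar> \<le> \<bar>D k x\<bar>" "AE x in M. \<bar>A0 x\<bar> \<le> \<bar>D0 x\<bar>"
    and lim: "AE x in M. (\<lambda>k. A k x) \<longlonglongrightarrow> A0 x"
  shows "(\<lambda>k. \<integral>x. A k x \<partial>M) \<longlonglongrightarrow> (\<integral>x. A0 x \<partial>M)"
proof -
  have [measurable]: "D0 \<in> borel_measurable M" using D by auto
  define B where "B k x = max (- \<bar>D0 x\<bar>) (min \<bar>D0 x\<bar> (A k x))" for k x
  have [measurable]: "B k \<in> borel_measurable M" for k unfolding B_def by measurable
  have intA: "integrable M (A k)" for k
    by (rule Bochner_Integration.integrable_bound[OF D(1)[of k]]) (use bound in auto)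
  have intB: "integrable M (B k)" for k
    by (rule Bochner_Integration.integrable_bound[OF D(2)]) (auto simp: B_def)
  have 1: "(\<lambda>k. \<integral>x. B k x \<partial>M) \<longlonglongrightarrow> (\<integral>x. A0 x \<partial>M)"
  proof (rule integral_dominated_convergence[where w="\<lambda>x. \<bar>D0 x\<bar>"])
    show "AE x in M. (\<lambda>k. B k x) \<longlonglongrightarrow> A0 x"
      using lim bound(2)
    proof eventually_elim
      case (elim x)
      have "(\<lambda>k. B k x) \<longlonglongrightarrow> max (- \<bar>D0 x\<bar>) (min \<bar>D0 x\<bar> (A0 x))"
        unfolding B_def by (intro tendsto_intros elim(1))
      moreover have "max (- \<bar>D0 x\<bar>) (min \<bar>D0 x\<bar> (A0 x)) = A0 x" using elim(2) by linarith
      ultimately show ?case by (simp only:)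
    qed
  qed (use D in \<open>auto simp: B_def\<close>)
  have 2: "(\<lambda>k. \<integral>x. A k x - B k x \<partial>M) \<longlonglongrightarrow> 0"
  proof (rule Lim_null_comparison[OF _ conv], intro always_eventually allI)
    fix k
    have "\<bar>\<integral>x. A k x - B k x \<partial>M\<bar> \<le> (\<integral>x. \<bar>A k x - B k x\<bar> \<partial>M)" by (rule integral_abs_bound)
    also have "\<dots> \<le> (\<integral>x. \<bar>D k x - D0 x\<bar> \<partial>M)"
    proof (rule integral_mono)
      fix x show "\<bar>A k x - B k x\<bar> \<le> \<bar>D k x - D0 x\<bar>"
        using bound(1)[of k x] unfolding B_def by linarith
    qed (use intA intB D in auto)
    finally show "norm (\<integral>x. A k x - B k x \<partial>M) \<le> (\<integral>x. \<bar>D k x - D0 x\<bar> \<partial>M)" by simp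
  qed
  show ?thesis using tendsto_add[OF 2 1] intA intB by simp
qed

lemma test_function_integrable:
  assumes "\<phi> \<in> test_functions \<Omega>" shows "integrable lborel \<phi>"
proof -
  have "integrable lborel (\<lambda>x. indicator (closure {x. \<phi> x \<noteq> 0}) x *\<^sub>R \<phi> x)"
    using assms by (intro borel_integrable_compact) (auto simp: test_functions_iff compactly_contained_def intro: smooth_imp_continuous_on)
  moreover have "indicator (closure {x. \<phi> x \<noteq> 0}) x *\<^sub>R \<phi> x = \<phi> x" for x
    using closure_subset[of "{x. \<phi> x \<noteq> 0}"] by (auto simp: indicator_def)
  ultimately show ?thesis by (simp only:)
qed

lemma test_function_DERIV:
  assumes "\<phi> \<in> test_functions \<Omega>"
  shows "((\<lambda>s. \<phi> (x + s *\<^sub>R axis i 1)) has_real_derivative partial_deriv i \<phi> (x + s *\<^sub>R axis i 1)) (at s)"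
proof -
  have "((\<lambda>s. x + s *\<^sub>R axis i 1) has_derivative (\<lambda>h. h *\<^sub>R axis i 1)) (at s)"
    by (auto intro!: derivative_eq_intros)
  from has_derivative_compose[OF this smooth_has_derivative] assms
  have "((\<lambda>s. \<phi> (x + s *\<^sub>R axis i 1)) has_derivative (\<lambda>h. \<Sum>j\<in>UNIV. (h *\<^sub>R axis i 1) $ j * partial_deriv j \<phi> (x + s *\<^sub>R axis i 1))) (at s)"
    by (simp add: test_functions_iff)
  moreover have "(\<Sum>j\<in>UNIV. (h *\<^sub>R axis i 1) $ j * partial_deriv j \<phi> (x + s *\<^sub>R axis i 1)) = partial_deriv i \<phi> (x + s *\<^sub>R axis i 1) * h" for h
    by (simp add: axis_def if_distrib[of "\<lambda>x. x * _"] if_distrib[of "\<lambda>x. _ * x"] cong: if_cong)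
  ultimately show ?thesis by (simp add: has_field_derivative_def)
qed

text \<open>The difference quotients of the truncation, taken along t \<rightarrow> 0 with sign \<sigma>, converge on {f = k} to a
limit depending on \<sigma>. Both limits represent the same weak derivative, so it vanishes there.\<close>

lemma truncation_one_sided:
  fixes f :: "real^'n \<Rightarrow> real"
  assumes W: "W11 f g" and \<phi>: "\<phi> \<in> test_functions UNIV" and \<sigma>: "\<sigma> = 1 \<or> \<sigma> = -1"
  shows "(\<integral>x. max (f x - k) 0 * partial_deriv i \<phi> x \<partial>lborel) =
    - (\<integral>x. (if f x > k then g x $ i else if f x = k then \<sigma> * max (\<sigma> * g x $ i) 0 else 0) * \<phi> x \<partial>lborel)"
proof -
  have \<sigma>2: "\<sigma> * \<sigma> = 1" "\<bar>\<sigma>\<bar> = 1" "\<sigma> \<noteq> 0" using \<sigma> by auto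
  have f: "integrable lborel f" and G: "integrable lborel (\<lambda>x. g x $ i)"
    using W W11_nth_integrable by (auto simp: W11_def)
  have [measurable]: "f \<in> borel_measurable borel" "(\<lambda>x. g x $ i) \<in> borel_measurable borel" using f G by auto
  have [measurable]: "\<phi> \<in> borel_measurable borel" "partial_deriv i \<phi> \<in> borel_measurable borel"
      using \<phi> test_function_measurable test_function_partial_deriv by blast+
  obtain B where B: "B \<ge> 0" "\<And>x. \<bar>\<phi> x\<bar> \<le> B" using test_function_bounded[OF \<phi>] by metis
  obtain C where C: "C \<ge> 0" "\<And>x. \<bar>partial_deriv i \<phi> x\<bar> \<le> C"
    using test_function_bounded[OF test_function_partial_deriv[OF \<phi>]] by metis
  define A0 where "A0 x = (if f x > k then g x $ i else if f x = k then \<sigma> * max (\<sigma> * g x $ i) 0 else 0)" for x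
  have [measurable]: "A0 \<in> borel_measurable borel" unfolding A0_def by measurable
  define F where "F y = max (y - k) 0" for y :: real
  have [measurable]: "F \<in> borel_measurable borel" unfolding F_def by measurable
  define e :: "real^'n" where "e = axis i 1"
  define t where "t j = \<sigma> * inverse (real (Suc j))" for j
  have t: "t \<longlonglongrightarrow> 0" unfolding t_def using tendsto_mult_right_zero[OF LIMSEQ_inverse_real_of_nat] by blast
  have t0: "t j \<noteq> 0" for j unfolding t_def using \<sigma>2 by auto
  have t1: "\<bar>t j\<bar> \<le> 1" for j unfolding t_def using \<sigma>2 by (simp add: abs_mult inverse_eq_divide)
  have t\<sigma>: "\<sigma> * t j > 0" for j unfolding t_def using \<sigma>2 by (simp flip: mult.assoc)
  define DQ where "DQ j x = (f (x + t j *\<^sub>R e) - f x) / t j" for j x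
  have DQ: "integrable lborel (DQ j)" for j
    unfolding DQ_def using f by (auto intro!: Bochner_Integration.integrable_diff integrable_lborel_translation)
  have L1: "(\<lambda>j. \<integral>x. \<bar>DQ j x - g x $ i\<bar> \<partial>lborel) \<longlonglongrightarrow> 0"
    unfolding DQ_def e_def by (rule difference_quotient_L1[OF W t t0])
  \<comment> \<open>L^1 convergence gives pointwise convergence only along a subsequence. That
    suffices, since the limit of the integrals is identified on the side of the test function as
    well.\<close>
  then obtain r where r: "strict_mono r" and ae: "AE x in lborel. (\<lambda>j. DQ (r j) x - g x $ i) \<longlonglongrightarrow> 0"
    using tendsto_L1_AE_subseq[of lborel "\<lambda>j x. DQ j x - g x $ i"] DQ G by auto
  define A where "A j x = (F (f (x + t j *\<^sub>R e)) - F (f x)) / t j" for j x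
  have A_DQ: "\<bar>A j x\<bar> \<le> \<bar>DQ j x\<bar>" for j x
    unfolding A_def DQ_def F_def using t0[of j] by (auto simp: abs_divide intro!: divide_right_mono)
  have AE_lim: "AE x in lborel. (\<lambda>j. A (r j) x) \<longlonglongrightarrow> A0 x"
    using ae
  proof eventually_elim
    case (elim x)
    have dq: "(\<lambda>j. DQ (r j) x) \<longlonglongrightarrow> g x $ i" using tendsto_add[OF elim tendsto_const[of "g x $ i"]] by simp
    have tr: "(\<lambda>j. t (r j)) \<longlonglongrightarrow> 0" using LIMSEQ_subseq_LIMSEQ[OF t r] by (simp add: o_def)
    have fx: "f (x + t j *\<^sub>R e) = f x + t j * DQ j x" for j unfolding DQ_def using t0[of j] by simp
    have fl: "(\<lambda>j. f (x + t (r j) *\<^sub>R e)) \<longlonglongrightarrow> f x"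
      unfolding fx using tendsto_add[OF tendsto_const[of "f x"] tendsto_mult[OF tr dq]] by simp
    consider "f x > k" | "f x < k" | "f x = k" by linarith
    then show ?case
    proof cases
      case 1
      have "\<forall>\<^sub>F j in sequentially. f (x + t (r j) *\<^sub>R e) > k" using order_tendstoD(1)[OF fl 1] .
      then have "\<forall>\<^sub>F j in sequentially. DQ (r j) x = A (r j) x"
        by eventually_elim (use 1 in \<open>simp add: A_def F_def DQ_def\<close>)
      then show ?thesis using Lim_transform_eventually[OF dq] 1 by (simp add: A0_def)
    next
      case 2
      have "\<forall>\<^sub>F j in sequentially. f (x + t (r j) *\<^sub>R e) < k" using order_tendstoD(2)[OF fl 2] .
      then have "\<forall>\<^sub>F j in sequentially. A (r j) x = 0"
        by eventually_elim (use 2 in \<open>simp add: A_def F_def\<close>)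
      then show ?thesis using 2 by (simp add: A0_def tendsto_eventually)
    next
      case 3
      \<comment> \<open>At the level itself the quotient is (t y)_+ / t with y the quotient of f; as
        t has the sign \<sigma>, this is the one-sided part of y selected by \<sigma>.\<close>
      have "A j x = \<sigma> * max (\<sigma> * DQ j x) 0" for j
      proof -
        have "\<sigma> * t j * DQ j x > 0 \<longleftrightarrow> \<sigma> * (t j * DQ j x) > 0" by (simp add: mult.assoc)
        have p: "t j = \<sigma> * (\<sigma> * t j)" using \<sigma>2 by (simp flip: mult.assoc)
        have "max (t j * DQ j x) 0 = (\<sigma> * t j) * max (\<sigma> * DQ j x) 0"
          using t\<sigma>[of j] \<sigma>2(1) max_mult_distrib_left[of "\<sigma> * t j" "\<sigma> * DQ j x" 0]
          by (simp add: mult.assoc) (metis mult.assoc mult.commute mult.left_neutral)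
        then show ?thesis unfolding A_def F_def fx using 3 t0[of j] by (simp add: field_simps)
      qed
      moreover have "(\<lambda>j. \<sigma> * max (\<sigma> * DQ (r j) x) 0) \<longlonglongrightarrow> \<sigma> * max (\<sigma> * g x $ i) 0"
        by (intro tendsto_intros dq)
      ultimately show ?thesis using 3 by (simp add: A0_def)
    qed
  qed
  have step1: "(\<lambda>j. \<integral>x. A (r j) x * \<phi> x \<partial>lborel) \<longlonglongrightarrow> (\<integral>x. A0 x * \<phi> x \<partial>lborel)"
  proof (rule integral_tendsto_dominated_L1[where D="\<lambda>j x. DQ (r j) x * \<phi> x" and ?D0.0="\<lambda>x. g x $ i * \<phi> x"])
    show i1: "integrable lborel (\<lambda>x. DQ (r j) x * \<phi> x)" for j using DQ B by (intro integrable_mult_bounded[where B=B]) auto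
    show i2: "integrable lborel (\<lambda>x. g x $ i * \<phi> x)" using G B by (intro integrable_mult_bounded[where B=B]) auto
    have "(\<lambda>j. \<integral>x. \<bar>DQ (r j) x - g x $ i\<bar> \<partial>lborel) \<longlonglongrightarrow> 0"
      using LIMSEQ_subseq_LIMSEQ[OF L1 r] by (simp add: o_def)
    from tendsto_mult_left[OF this, of B] have l: "(\<lambda>j. B * (\<integral>x. \<bar>DQ (r j) x - g x $ i\<bar> \<partial>lborel)) \<longlonglongrightarrow> 0" by simp
    show "(\<lambda>j. \<integral>x. \<bar>DQ (r j) x * \<phi> x - g x $ i * \<phi> x\<bar> \<partial>lborel) \<longlonglongrightarrow> 0"
    proof (rule tendsto_sandwich[OF _ _ tendsto_const l]; intro always_eventually allI)
      fix j
      have "(\<integral>x. \<bar>DQ (r j) x * \<phi> x - g x $ i * \<phi> x\<bar> \<partial>lborel) \<le> (\<integral>x. B * \<bar>DQ (r j) x - g x $ i\<bar> \<partial>lborel)"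
      proof (rule integral_mono)
        show "integrable lborel (\<lambda>x. \<bar>DQ (r j) x * \<phi> x - g x $ i * \<phi> x\<bar>)" using i1 i2 by auto
        show "integrable lborel (\<lambda>x. B * \<bar>DQ (r j) x - g x $ i\<bar>)" using DQ G by auto
        fix x
        have "\<bar>DQ (r j) x * \<phi> x - g x $ i * \<phi> x\<bar> = \<bar>\<phi> x\<bar> * \<bar>DQ (r j) x - g x $ i\<bar>"
          by (simp flip: left_diff_distrib add: abs_mult)
        then show "\<bar>DQ (r j) x * \<phi> x - g x $ i * \<phi> x\<bar> \<le> B * \<bar>DQ (r j) x - g x $ i\<bar>"
          using B(2)[of x] by (simp add: mult_right_mono)
      qed
      then show "(\<integral>x. \<bar>DQ (r j) x * \<phi> x - g x $ i * \<phi> x\<bar> \<partial>lborel) \<le> B * (\<integral>x. \<bar>DQ (r j) x - g x $ i\<bar> \<partial>lborel)" by simp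
    qed simp
    show "(\<lambda>x. A (r j) x * \<phi> x) \<in> borel_measurable lborel" for j unfolding A_def by measurable
    show "\<bar>A (r j) x * \<phi> x\<bar> \<le> \<bar>DQ (r j) x * \<phi> x\<bar>" for j x
      using A_DQ[of "r j" x] by (simp add: abs_mult mult_right_mono)
    show "AE x in lborel. \<bar>A0 x * \<phi> x\<bar> \<le> \<bar>g x $ i * \<phi> x\<bar>"
      using \<sigma> unfolding A0_def by (intro AE_I2) (auto simp: abs_mult intro!: mult_right_mono)
    show "AE x in lborel. (\<lambda>j. A (r j) x * \<phi> x) \<longlonglongrightarrow> A0 x * \<phi> x"
      using AE_lim by eventually_elim (intro tendsto_intros)
  qed measurable
  have intF: "integrable lborel (\<lambda>x. F (f x) * \<psi> x)" if \<psi>: "\<psi> \<in> test_functions UNIV" for \<psi>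
  proof -
    have [measurable]: "\<psi> \<in> borel_measurable borel" using \<psi> by (rule test_function_measurable)
    obtain B where B: "B \<ge> 0" "\<And>x. \<bar>\<psi> x\<bar> \<le> B" using test_function_bounded[OF \<psi>] by metis
    have "integrable lborel (\<lambda>x. \<bar>f x * \<psi> x\<bar> + \<bar>k\<bar> * \<bar>\<psi> x\<bar>)"
      by (intro Bochner_Integration.integrable_add integrable_mult_right integrable_abs integrable_mult_bounded[where B=B])
         (use f B test_function_integrable[OF \<psi>] in auto)
    then show ?thesis
    proof (rule Bochner_Integration.integrable_bound)
      have "\<bar>F (f x)\<bar> * \<bar>\<psi> x\<bar> \<le> (\<bar>f x\<bar> + \<bar>k\<bar>) * \<bar>\<psi> x\<bar>" for x
        unfolding F_def by (intro mult_right_mono) auto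
      then show "AE x in lborel. norm (F (f x) * \<psi> x) \<le> norm (\<bar>f x * \<psi> x\<bar> + \<bar>k\<bar> * \<bar>\<psi> x\<bar>)"
        by (auto simp: abs_mult algebra_simps)
    qed measurable
  qed
  have step2: "(\<integral>x. A j x * \<phi> x \<partial>lborel) = (\<integral>x. F (f x) * ((\<phi> (x + (- t j) *\<^sub>R e) - \<phi> x) / t j) \<partial>lborel)" for j
  proof -
    have i: "integrable lborel (\<lambda>x. F (f x) * \<phi> x)" "integrable lborel (\<lambda>x. F (f x) * \<phi> (x + (- t j) *\<^sub>R e))"
      by (intro intF \<phi> test_function_translation)+
    have i': "integrable lborel (\<lambda>x. F (f (x + t j *\<^sub>R e)) * \<phi> x)"
      using integrable_lborel_translation[OF i(2), of "t j *\<^sub>R e"] by simp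
    have tr: "(\<integral>x. F (f (x + t j *\<^sub>R e)) * \<phi> x \<partial>lborel) = (\<integral>x. F (f x) * \<phi> (x + (- t j) *\<^sub>R e) \<partial>lborel)"
      using integral_lborel_translation[of "\<lambda>x. F (f x) * \<phi> (x + (- t j) *\<^sub>R e)" "t j *\<^sub>R e"] by simp
    have "(\<integral>x. A j x * \<phi> x \<partial>lborel) = (\<integral>x. (F (f (x + t j *\<^sub>R e)) * \<phi> x - F (f x) * \<phi> x) / t j \<partial>lborel)"
      unfolding A_def by (simp add: left_diff_distrib)
    also have "\<dots> = ((\<integral>x. F (f x) * \<phi> (x + (- t j) *\<^sub>R e) \<partial>lborel) - (\<integral>x. F (f x) * \<phi> x \<partial>lborel)) / t j"
      using i i' tr by simp
    also have "\<dots> = (\<integral>x. (F (f x) * \<phi> (x + (- t j) *\<^sub>R e) - F (f x) * \<phi> x) / t j \<partial>lborel)"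
      using i by simp
    finally show ?thesis by (simp add: right_diff_distrib)
  qed
  have step3: "(\<lambda>j. \<integral>x. F (f x) * ((\<phi> (x + (- t j) *\<^sub>R e) - \<phi> x) / t j) \<partial>lborel) \<longlonglongrightarrow> (\<integral>x. F (f x) * - partial_deriv i \<phi> x \<partial>lborel)"
  proof -
    have "bounded {x. \<phi> x \<noteq> 0}" using \<phi> by (simp add: test_functions_iff compactly_contained_UNIV)
    then obtain R where R: "\<And>x. \<phi> x \<noteq> 0 \<Longrightarrow> norm x \<le> R" by (auto simp: bounded_iff)
    \<comment> \<open>Since |t j| <= 1 and e is a unit vector, all shifted copies of \<phi> are
      supported in this ball, so one integrable majorant serves every j.\<close>
    define K where "K = cball (0::real^'n) (R + 1)"
    have e1: "norm e = 1" unfolding e_def by simp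
    show ?thesis
    proof (rule integral_dominated_convergence[where w="\<lambda>x. C * (indicator K x * \<bar>f x\<bar> + \<bar>k\<bar> * indicator K x)"])
      have "integrable lborel (\<lambda>x. indicator K x *\<^sub>R \<bar>f x\<bar>)"
        using f by (intro integrable_mult_indicator) (auto simp: K_def)
      moreover have "integrable lborel (indicat_real K)" unfolding K_def
        by (intro integrable_real_indicator) (use emeasure_bounded_finite[OF bounded_cball] in auto)
      ultimately show "integrable lborel (\<lambda>x. C * (indicator K x * \<bar>f x\<bar> + \<bar>k\<bar> * indicator K x))"
        by simp
      show "AE x in lborel. (\<lambda>j. F (f x) * ((\<phi> (x + (- t j) *\<^sub>R e) - \<phi> x) / t j)) \<longlonglongrightarrow> F (f x) * - partial_deriv i \<phi> x"
      proof (intro AE_I2 tendsto_mult tendsto_const)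
        fix x
        have d: "((\<lambda>h. (\<phi> (x + h *\<^sub>R e) - \<phi> x) / h) \<longlongrightarrow> partial_deriv i \<phi> x) (at 0)"
          using test_function_DERIV[OF \<phi>, of x i 0] unfolding DERIV_def e_def by simp
        have "filterlim (\<lambda>j. - t j) (at 0) sequentially"
          unfolding filterlim_at using t0 tendsto_minus[OF t] by auto
        from tendsto_minus[OF filterlim_compose[OF d this]]
        show "(\<lambda>j. (\<phi> (x + (- t j) *\<^sub>R e) - \<phi> x) / t j) \<longlonglongrightarrow> - partial_deriv i \<phi> x" by simp
      qed
      show "AE x in lborel. norm (F (f x) * ((\<phi> (x + (- t j) *\<^sub>R e) - \<phi> x) / t j)) \<le> C * (indicator K x * \<bar>f x\<bar> + \<bar>k\<bar> * indicator K x)" for j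
      proof (intro AE_I2)
        fix x
        have "norm (\<phi> (x + (- t j) *\<^sub>R e) - \<phi> (x + 0 *\<^sub>R e)) \<le> C * norm (- t j - 0)"
          unfolding e_def by (rule field_differentiable_bound[of UNIV "\<lambda>s. \<phi> (x + s *\<^sub>R axis i 1)"])
            (use test_function_DERIV[OF \<phi>] C in auto)
        then have 1: "\<bar>(\<phi> (x + (- t j) *\<^sub>R e) - \<phi> x) / t j\<bar> \<le> C" using t0[of j] by (simp add: field_simps)
        have 2: "\<bar>F (f x)\<bar> \<le> \<bar>f x\<bar> + \<bar>k\<bar>" unfolding F_def by auto
        show "norm (F (f x) * ((\<phi> (x + (- t j) *\<^sub>R e) - \<phi> x) / t j)) \<le> C * (indicator K x * \<bar>f x\<bar> + \<bar>k\<bar> * indicator K x)"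
        proof (cases "x \<in> K")
          case True
          have "\<bar>F (f x)\<bar> * \<bar>(\<phi> (x + (- t j) *\<^sub>R e) - \<phi> x) / t j\<bar> \<le> (\<bar>f x\<bar> + \<bar>k\<bar>) * C"
            using 1 2 C(1) by (intro mult_mono) auto
          then show ?thesis using True by (simp add: abs_mult mult.commute)
        next
          case False
          then have "norm x > R + 1" by (simp add: K_def)
          moreover have "norm ((- t j) *\<^sub>R e) \<le> 1" using t1[of j] e1 by simp
          moreover have "norm x \<le> norm (x + (- t j) *\<^sub>R e) + norm ((- t j) *\<^sub>R e)"
            using norm_triangle_ineq4[of "x + (- t j) *\<^sub>R e" "(- t j) *\<^sub>R e"] by simp
          ultimately have "norm (x + (- t j) *\<^sub>R e) > R" "norm x > R" by linarith+
          then have "\<phi> (x + (- t j) *\<^sub>R e) = 0" "\<phi> x = 0" using R not_le by blast+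
          then show ?thesis using False by simp
        qed
      qed
    qed measurable
  qed
  have "(\<lambda>j. \<integral>x. A (r j) x * \<phi> x \<partial>lborel) \<longlonglongrightarrow> (\<integral>x. F (f x) * - partial_deriv i \<phi> x \<partial>lborel)"
    using LIMSEQ_subseq_LIMSEQ[OF step3 r] unfolding step2 by (simp add: o_def)
  from LIMSEQ_unique[OF this step1] show ?thesis unfolding F_def A0_def by simp
qed

theorem W11_truncation:
  fixes f :: "real^'n \<Rightarrow> real"
  assumes W: "W11 f g" and \<phi>: "\<phi> \<in> test_functions UNIV"
  shows "(\<integral>x. max (f x - k) 0 * partial_deriv i \<phi> x \<partial>lborel) = - (\<integral>x. (if f x > k then g x $ i else 0) * \<phi> x \<partial>lborel)"
proof -
  define Ap where "Ap x = (if f x > k then g x $ i else if f x = k then 1 * max (1 * g x $ i) 0 else 0)" for x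
  define Am where "Am x = (if f x > k then g x $ i else if f x = k then - 1 * max (- 1 * g x $ i) 0 else 0)" for x
  have f: "integrable lborel f" and G: "integrable lborel (\<lambda>x. g x $ i)"
    using W W11_nth_integrable by (auto simp: W11_def)
  have [measurable]: "f \<in> borel_measurable borel" "(\<lambda>x. g x $ i) \<in> borel_measurable borel" using f G by auto
  have [measurable]: "Ap \<in> borel_measurable borel" "Am \<in> borel_measurable borel" unfolding Ap_def Am_def by measurable
  have i: "integrable lborel Ap" "integrable lborel Am"
    by (rule Bochner_Integration.integrable_bound[OF G]; auto simp: Ap_def Am_def)+
  have "AE x in lebesgue. x \<in> UNIV \<longrightarrow> Ap x - Am x = 0"
  proof (rule fundamental_lemma)
    show "locally_integrable UNIV (\<lambda>x. Ap x - Am x)"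
      using i by (intro integrable_lebesgue_imp_locally_integrable) (simp add: integrable_completion)
    fix \<psi> :: "real^'n \<Rightarrow> real" assume \<psi>: "\<psi> \<in> test_functions UNIV"
    have [measurable]: "\<psi> \<in> borel_measurable borel" using \<psi> by (rule test_function_measurable)
    obtain B where B: "B \<ge> 0" "\<And>x. \<bar>\<psi> x\<bar> \<le> B" using test_function_bounded[OF \<psi>] by metis
    have "(\<integral>x. (Ap x - Am x) * \<psi> x \<partial>lborel) = (\<integral>x. Ap x * \<psi> x \<partial>lborel) - (\<integral>x. Am x * \<psi> x \<partial>lborel)"
      using i B by (subst Bochner_Integration.integral_diff[symmetric]) (auto intro!: integrable_mult_bounded[where B=B] simp: left_diff_distrib)
    also have "\<dots> = 0"
      using truncation_one_sided[OF W \<psi>, of 1 k i] truncation_one_sided[OF W \<psi>, of "-1" k i]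
      unfolding Ap_def Am_def by simp
    finally show "(\<integral>x. (Ap x - Am x) * \<psi> x \<partial>lebesgue_on UNIV) = 0"
      by (subst integral_lebesgue_on_eq) (auto simp: integral_completion)
  qed simp
  then have ae: "AE x in lborel. Ap x = Am x" by (simp add: AE_completion_iff)
  \<comment> \<open>On the set f = k, \<open>Ap\<close> is the positive part of the derivative and
    \<open>Am\<close> is minus the negative part. They agree only if both vanish.\<close>
  have "AE x in lborel. (if f x > k then g x $ i else 0) * \<phi> x = Ap x * \<phi> x"
    using ae by eventually_elim (auto simp: Ap_def Am_def max_def split: if_splits)
  moreover have [measurable]: "\<phi> \<in> borel_measurable borel" using \<phi> by (rule test_function_measurable)
  ultimately have "(\<integral>x. (if f x > k then g x $ i else 0) * \<phi> x \<partial>lborel) = (\<integral>x. Ap x * \<phi> x \<partial>lborel)"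
    by (intro integral_cong_AE) measurable
  then show ?thesis using truncation_one_sided[OF W \<phi>, of 1 k i] unfolding Ap_def by simp
qed

section \<open>Passing between weak gradients on an open set and on the whole space\<close>

definition grad :: "(real^'n \<Rightarrow> real) \<Rightarrow> real^'n \<Rightarrow> real^'n"
  where "grad \<eta> x = (\<chi> i. partial_deriv i \<eta> x)"

lemma grad_nth [simp]: "grad \<eta> x $ i = partial_deriv i \<eta> x"
  by (simp add: grad_def)

lemma partial_deriv_outside_support:
  assumes "x \<notin> closure {x. \<phi> x \<noteq> 0}"
  shows "partial_deriv i \<phi> x = 0"
proof -
  have "(\<phi> has_derivative (\<lambda>h. 0)) (at x)"
    by (rule has_derivative_transform_within_open[of "\<lambda>x. 0" _ _ _ "- closure {x. \<phi> x \<noteq> 0}"])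
       (use assms closure_subset[of "{x. \<phi> x \<noteq> 0}"] in auto)
  then show ?thesis using partial_deriv_eq by blast
qed

lemma borel_measurable_vec_iff:
  fixes g :: "'a \<Rightarrow> real^'n"
  shows "g \<in> borel_measurable M \<longleftrightarrow> (\<forall>i. (\<lambda>x. g x $ i) \<in> borel_measurable M)"
  unfolding borel_measurable_euclidean_space[of g M]
  by (auto simp: Basis_vec_def inner_axis)

text \<open>The bridge from \<open>is_weak_gradient\<close>, which speaks of Lebesgue measurable
  functions, to the Borel setting of \<open>W11\<close>. A Borel version of the gradient is chosen
  component by component.\<close>

lemma W11_representative:
  fixes F :: "real^'n \<Rightarrow> real" and G :: "real^'n \<Rightarrow> real^'n"
  assumes F: "integrable lebesgue F" and G: "integrable lebesgue G"
    and weak: "\<And>\<phi> i. \<phi> \<in> test_functions UNIV \<Longrightarrow>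
      (\<integral>x. F x * partial_deriv i \<phi> x \<partial>lebesgue) = - (\<integral>x. G x $ i * \<phi> x \<partial>lebesgue)"
  obtains f g where "W11 f g" "AE x in lebesgue. F x = f x" "AE x in lebesgue. G x = g x"
proof -
  obtain f where f: "f \<in> borel_measurable lborel" and "AE x in lborel. F x = f x"
    using completion_ex_borel_measurable_real[OF borel_measurable_integrable[OF F]] by auto
  then have Ff: "AE x in lebesgue. F x = f x" by (simp add: AE_completion)
  have "\<exists>\<gamma>\<in>borel_measurable lborel. AE x in lborel. G x $ i = \<gamma> x" for i
    using completion_ex_borel_measurable_real borel_measurable_integrable
      integrable_bounded_linear[OF bounded_linear_vec_nth G] by blast
  then obtain \<gamma> where \<gamma>: "\<And>i. \<gamma> i \<in> borel_measurable lborel" "\<And>i. AE x in lborel. G x $ i = \<gamma> i x" by metis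
  define g where "g x = (\<chi> i. \<gamma> i x)" for x
  have g: "g \<in> borel_measurable lborel" unfolding borel_measurable_vec_iff g_def using \<gamma>(1) by simp
  have "AE x in lborel. \<forall>i\<in>UNIV. G x $ i = \<gamma> i x" using \<gamma>(2) by (intro eventually_ball_finite) auto
  then have "AE x in lborel. G x = g x" by eventually_elim (auto simp: g_def vec_eq_iff)
  then have Gg: "AE x in lebesgue. G x = g x" by (simp add: AE_completion)
  have mf: "f \<in> borel_measurable lebesgue" and mg: "g \<in> borel_measurable lebesgue"
    by (rule measurable_completion[OF f], rule measurable_completion[OF g])
  have "integrable lebesgue f" by (rule integrable_cong_AE_imp[OF F mf Ff])
  then have if': "integrable lborel f" using integrable_completion[OF f] by simp
  have "integrable lebesgue g" by (rule integrable_cong_AE_imp[OF G mg Gg])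
  then have ig: "integrable lborel g" using integrable_completion[OF g] by simp
  have "(\<integral>x. f x * partial_deriv i \<phi> x \<partial>lborel) = - (\<integral>x. g x $ i * \<phi> x \<partial>lborel)" if \<phi>: "\<phi> \<in> test_functions UNIV" for \<phi> i
  proof -
    have m: "\<phi> \<in> borel_measurable lborel" "partial_deriv i \<phi> \<in> borel_measurable lborel"
      using test_function_measurable[OF \<phi>] test_function_measurable[OF test_function_partial_deriv[OF \<phi>]] by simp_all
    note m' = m[THEN measurable_completion]
    have gi: "(\<lambda>x. g x $ i) \<in> borel_measurable lborel" using g borel_measurable_vec_iff by blast
    have Gi: "(\<lambda>x. G x $ i) \<in> borel_measurable lebesgue" using borel_measurable_integrable[OF G] borel_measurable_vec_iff by blast
    have "(\<integral>x. f x * partial_deriv i \<phi> x \<partial>lborel) = (\<integral>x. f x * partial_deriv i \<phi> x \<partial>lebesgue)"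
      by (rule integral_completion[symmetric, OF borel_measurable_times[OF f m(2)]])
    also have "\<dots> = (\<integral>x. F x * partial_deriv i \<phi> x \<partial>lebesgue)"
      by (rule integral_cong_AE[OF borel_measurable_times[OF mf m'(2)] borel_measurable_times[OF borel_measurable_integrable[OF F] m'(2)]])
         (use Ff in auto)
    also have "\<dots> = - (\<integral>x. G x $ i * \<phi> x \<partial>lebesgue)" by (rule weak[OF \<phi>])
    also have "(\<integral>x. G x $ i * \<phi> x \<partial>lebesgue) = (\<integral>x. g x $ i * \<phi> x \<partial>lebesgue)"
      by (rule integral_cong_AE[OF borel_measurable_times[OF Gi m'(1)] borel_measurable_times[OF measurable_completion[OF gi] m'(1)]])
         (use Gg in auto)
    also have "\<dots> = (\<integral>x. g x $ i * \<phi> x \<partial>lborel)"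
      by (rule integral_completion[OF borel_measurable_times[OF gi m(1)]])
    finally show ?thesis .
  qed
  then have "W11 f g" unfolding W11_def using if' ig by blast
  then show ?thesis using that Ff Gg by blast
qed

lemma test_functions_mono: "\<Omega> \<subseteq> \<Omega>' \<Longrightarrow> test_functions \<Omega> \<subseteq> test_functions \<Omega>'"
  unfolding test_functions_def using compactly_contained_subset by blast

lemma is_weak_gradient_subset:
  assumes "open \<Omega>" "open U" "U \<subseteq> \<Omega>" "is_weak_gradient \<Omega> f g"
  shows "is_weak_gradient U f g"
  using assms test_functions_mono[of U \<Omega>]
  unfolding is_weak_gradient_lebesgue[OF assms(1)] is_weak_gradient_lebesgue[OF assms(2)] locally_integrable_def
  by blast

text \<open>The product \<phi> \<eta> is a test function of \<Omega> for every \<phi> on the whole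
  space. The weak identity for f therefore yields one on the whole space for \<eta> f, whatever the
  values of f outside \<Omega>.\<close>

lemma is_weak_gradient_mult_test:
  fixes f :: "real^'n \<Rightarrow> real"
  assumes "open \<Omega>" and w: "is_weak_gradient \<Omega> f g" and \<eta>: "\<eta> \<in> test_functions \<Omega>"
  shows "integrable lebesgue (\<lambda>x. \<eta> x * f x)" (is ?A)
    and "integrable lebesgue (\<lambda>x. \<eta> x *\<^sub>R g x + f x *\<^sub>R grad \<eta> x)" (is ?B)
    and "\<And>\<phi> i. \<phi> \<in> test_functions UNIV \<Longrightarrow>
      (\<integral>x. (\<eta> x * f x) * partial_deriv i \<phi> x \<partial>lebesgue) = - (\<integral>x. (\<eta> x *\<^sub>R g x + f x *\<^sub>R grad \<eta> x) $ i * \<phi> x \<partial>lebesgue)"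
proof -
  have lf: "locally_integrable \<Omega> f" and lg: "locally_integrable \<Omega> g" using w by (auto simp: is_weak_gradient_def)
  have s: "smooth \<eta>" using \<eta> by (simp add: test_functions_iff)
  show ?A using integrable_mult_test[OF lf \<eta>] by (simp add: mult.commute)
  have "integrable lebesgue (\<lambda>x. \<eta> x *\<^sub>R g x)"
    using \<eta> by (intro locally_integrable_mult_compact[OF lg]) (auto simp: test_functions_iff smooth_imp_continuous_on)
  moreover have "integrable lebesgue (\<lambda>x. \<Sum>i\<in>UNIV. (f x * partial_deriv i \<eta> x) *\<^sub>R axis i 1)"
    by (intro Bochner_Integration.integrable_sum integrable_scaleR_left integrable_mult_test[OF lf] test_function_partial_deriv \<eta>)
  moreover have grad_eq: "f x *\<^sub>R grad \<eta> x = (\<Sum>i\<in>UNIV. (f x * partial_deriv i \<eta> x) *\<^sub>R axis i 1)" for x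
    by (simp add: vec_eq_iff axis_def if_distrib[of "\<lambda>x. _ * x"] cong: if_cong)
  ultimately show ?B unfolding grad_eq by (intro Bochner_Integration.integrable_add)
  fix \<phi> :: "real^'n \<Rightarrow> real" and i assume \<phi>: "\<phi> \<in> test_functions UNIV"
  have s\<phi>: "smooth \<phi>" using \<phi> by (simp add: test_functions_iff)
  have t: "(\<lambda>x. \<phi> x * \<eta> x) \<in> test_functions \<Omega>" "(\<lambda>x. \<phi> x * partial_deriv i \<eta> x) \<in> test_functions \<Omega>"
    using test_function_mult \<eta> test_function_partial_deriv[OF \<eta>] s\<phi> by blast+
  note i = integrable_mult_test[OF lf t(2)] integrable_mult_test[OF lf test_function_partial_deriv[OF t(1)]]
    integrable_mult_test[OF locally_integrable_nth[OF lg] t(1)]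
  have "(\<integral>x. (\<eta> x * f x) * partial_deriv i \<phi> x \<partial>lebesgue) =
    (\<integral>x. f x * partial_deriv i (\<lambda>x. \<phi> x * \<eta> x) x - f x * (\<phi> x * partial_deriv i \<eta> x) \<partial>lebesgue)"
    by (intro Bochner_Integration.integral_cong refl, subst partial_deriv_mult[OF s\<phi> s]) (simp add: algebra_simps)
  also have "\<dots> = - (\<integral>x. g x $ i * (\<phi> x * \<eta> x) \<partial>lebesgue) - (\<integral>x. f x * (\<phi> x * partial_deriv i \<eta> x) \<partial>lebesgue)"
    using w t(1) i unfolding is_weak_gradient_lebesgue[OF assms(1)] by simp
  also have "\<dots> = - (\<integral>x. g x $ i * (\<phi> x * \<eta> x) + f x * (\<phi> x * partial_deriv i \<eta> x) \<partial>lebesgue)"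
    using i by simp
  finally show "(\<integral>x. (\<eta> x * f x) * partial_deriv i \<phi> x \<partial>lebesgue) = - (\<integral>x. (\<eta> x *\<^sub>R g x + f x *\<^sub>R grad \<eta> x) $ i * \<phi> x \<partial>lebesgue)"
    by (simp add: algebra_simps)
qed

lemma locally_integrable_truncation:
  fixes v :: "real^'n \<Rightarrow> real"
  assumes "locally_integrable \<Omega> v"
  shows "locally_integrable \<Omega> (\<lambda>x. max (v x - k) 0)"
  unfolding locally_integrable_def
proof (intro allI impI)
  fix K assume K: "compact K \<and> K \<subseteq> \<Omega>"
  then have v: "integrable (lebesgue_on K) v" using assms by (simp add: locally_integrable_def)
  then have [measurable]: "v \<in> borel_measurable (lebesgue_on K)" by auto
  have "integrable lebesgue (\<lambda>x. indicat_real K x *\<^sub>R \<bar>k\<bar>)"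
    using K lmeasurable_compact[of K]
    by (intro integrable_scaleR_left integrable_real_indicator) (auto simp: fmeasurable_def)
  then have "integrable (lebesgue_on K) (\<lambda>x. \<bar>k\<bar>)"
    using K lmeasurable_compact[of K] by (subst integrable_restrict_space) (auto simp: fmeasurable_def)
  from Bochner_Integration.integrable_add[OF integrable_norm[OF v] this]
  show "integrable (lebesgue_on K) (\<lambda>x. max (v x - k) 0)"
  proof (rule Bochner_Integration.integrable_bound)
    show "AE x in lebesgue_on K. norm (max (v x - k) 0) \<le> norm (norm (v x) + \<bar>k\<bar>)" by (intro AE_I2) auto
  qed measurable
qed

lemma locally_integrable_restrict:
  fixes g :: "real^'n \<Rightarrow> real^'n"
  assumes "locally_integrable \<Omega> v" "locally_integrable \<Omega> g"
  shows "locally_integrable \<Omega> (\<lambda>x. if v x > (k::real) then g x else 0)"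
  unfolding locally_integrable_def
proof (intro allI impI)
  fix K assume K: "compact K \<and> K \<subseteq> \<Omega>"
  then have v: "integrable (lebesgue_on K) v" and g: "integrable (lebesgue_on K) g" using assms by (auto simp: locally_integrable_def)
  then have [measurable]: "v \<in> borel_measurable (lebesgue_on K)" "g \<in> borel_measurable (lebesgue_on K)" by auto
  show "integrable (lebesgue_on K) (\<lambda>x. if v x > k then g x else 0)"
    by (rule Bochner_Integration.integrable_bound[OF g]) auto
qed

text \<open>Truncation acts pointwise, so only the values near the support of \<phi> matter.
  Multiplying v by a cutoff that is 1 on a neighbourhood of that support gives a function on the
  whole space with the same truncation and gradient there.\<close>

theorem is_weak_gradient_truncation:
  fixes v :: "real^'n \<Rightarrow> real"
  assumes "open \<Omega>" and w: "is_weak_gradient \<Omega> v g"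
  shows "is_weak_gradient \<Omega> (\<lambda>x. max (v x - k) 0) (\<lambda>x. if v x > k then g x else 0)"
  unfolding is_weak_gradient_lebesgue[OF assms(1)]
proof (intro conjI ballI allI)
  have lv: "locally_integrable \<Omega> v" and lg: "locally_integrable \<Omega> g" using w by (auto simp: is_weak_gradient_def)
  show l1: "locally_integrable \<Omega> (\<lambda>x. max (v x - k) 0)" by (rule locally_integrable_truncation[OF lv])
  show l2: "locally_integrable \<Omega> (\<lambda>x. if v x > k then g x else 0)" by (rule locally_integrable_restrict[OF lv lg])
  fix \<phi> i assume \<phi>: "\<phi> \<in> test_functions \<Omega>"
  then have \<phi>U: "\<phi> \<in> test_functions UNIV" using test_functions_mono[of \<Omega> UNIV] by auto
  define K where "K = closure {x. \<phi> x \<noteq> 0}"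
  have K: "compact K" "K \<subseteq> \<Omega>" using \<phi> by (auto simp: K_def test_functions_iff compactly_contained_def)
  obtain \<psi> V where \<psi>: "\<psi> \<in> test_functions \<Omega>" "open V" "K \<subseteq> V" "\<And>x. x \<in> V \<Longrightarrow> \<psi> x = 1"
    by (rule compact_flat_cutoff[OF \<open>open \<Omega>\<close> K]) blast
  note prod = is_weak_gradient_mult_test[OF \<open>open \<Omega>\<close> w \<psi>(1)]
  obtain f' g' where W: "W11 f' g'" and f': "AE x in lebesgue. \<psi> x * v x = f' x"
    and g': "AE x in lebesgue. \<psi> x *\<^sub>R g x + v x *\<^sub>R grad \<psi> x = g' x"
    by (rule W11_representative[OF prod], assumption, rule that)
  have K0: "\<phi> x = 0" "partial_deriv i \<phi> x = 0" if "x \<notin> K" for x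
    using that closure_subset[of "{x. \<phi> x \<noteq> 0}"] partial_deriv_outside_support[of x \<phi>] by (auto simp: K_def)
  have dV: "grad \<psi> x = 0" if "x \<in> V" for x
  proof -
    have "(\<psi> has_derivative (\<lambda>h. 0)) (at x)"
      by (rule has_derivative_transform_within_open[of "\<lambda>x. 1" _ _ _ V]) (use that \<psi>(2) in \<open>auto simp: \<psi>(4)\<close>)
    from partial_deriv_eq[OF this] show ?thesis by (simp add: vec_eq_iff)
  qed
  have fm: "f' \<in> borel_measurable lborel" and gm: "g' \<in> borel_measurable lborel" using W by (auto simp: W11_def)
  have gim: "(\<lambda>x. g' x $ i) \<in> borel_measurable lborel" using gm borel_measurable_vec_iff by blast
  have m: "\<phi> \<in> borel_measurable lborel" "partial_deriv i \<phi> \<in> borel_measurable lborel"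
      using test_function_measurable[OF \<phi>] test_function_measurable[OF test_function_partial_deriv[OF \<phi>]] by simp_all
  have m1: "(\<lambda>x. max (f' x - k) 0 * partial_deriv i \<phi> x) \<in> borel_measurable lborel"
    using fm m by measurable
  have m2: "(\<lambda>x. (if f' x > k then g' x $ i else 0) * \<phi> x) \<in> borel_measurable lborel"
    using fm gim m by measurable
  have "(\<integral>x. max (v x - k) 0 * partial_deriv i \<phi> x \<partial>lebesgue) = (\<integral>x. max (f' x - k) 0 * partial_deriv i \<phi> x \<partial>lebesgue)"
  proof (rule integral_cong_AE)
    show "(\<lambda>x. max (v x - k) 0 * partial_deriv i \<phi> x) \<in> borel_measurable lebesgue"
      using integrable_mult_test[OF l1 test_function_partial_deriv[OF \<phi>]] by (rule borel_measurable_integrable)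
    show "AE x in lebesgue. max (v x - k) 0 * partial_deriv i \<phi> x = max (f' x - k) 0 * partial_deriv i \<phi> x"
      using f'
    proof eventually_elim
      case (elim x) then show ?case using K0[of x] \<psi>(3,4) by (cases "x \<in> K") auto
    qed
  qed (rule measurable_completion[OF m1])
  also have "\<dots> = (\<integral>x. max (f' x - k) 0 * partial_deriv i \<phi> x \<partial>lborel)" by (rule integral_completion[OF m1])
  also have "\<dots> = - (\<integral>x. (if f' x > k then g' x $ i else 0) * \<phi> x \<partial>lborel)" by (rule W11_truncation[OF W \<phi>U])
  also have "(\<integral>x. (if f' x > k then g' x $ i else 0) * \<phi> x \<partial>lborel) = (\<integral>x. (if f' x > k then g' x $ i else 0) * \<phi> x \<partial>lebesgue)"
    by (rule integral_completion[OF m2, symmetric])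
  also have "\<dots> = (\<integral>x. (if v x > k then g x else 0) $ i * \<phi> x \<partial>lebesgue)"
  proof (rule integral_cong_AE)
    show "(\<lambda>x. (if v x > k then g x else 0) $ i * \<phi> x) \<in> borel_measurable lebesgue"
      using integrable_mult_test[OF locally_integrable_nth[OF l2] \<phi>] by (rule borel_measurable_integrable)
    show "AE x in lebesgue. (if f' x > k then g' x $ i else 0) * \<phi> x = (if v x > k then g x else 0) $ i * \<phi> x"
      using f' g'
    proof eventually_elim
      case (elim x)
      show ?case
      proof (cases "x \<in> K")
        case True
        then have "x \<in> V" using \<psi> by auto
        then show ?thesis using elim \<psi>(4)[of x] dV[of x] by auto
      qed (use K0 in auto)
    qed
  qed (rule measurable_completion[OF m2])
  finally show "(\<integral>x. max (v x - k) 0 * partial_deriv i \<phi> x \<partial>lebesgue) = - (\<integral>x. (if v x > k then g x else 0) $ i * \<phi> x \<partial>lebesgue)" .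
qed

lemma is_weak_gradient_linear:
  fixes u v :: "real^'n \<Rightarrow> real"
  assumes "open \<Omega>" and u: "is_weak_gradient \<Omega> u g" and v: "is_weak_gradient \<Omega> v h"
  shows "is_weak_gradient \<Omega> (\<lambda>x. a * u x + b * v x) (\<lambda>x. a *\<^sub>R g x + b *\<^sub>R h x)"
  unfolding is_weak_gradient_lebesgue[OF assms(1)]
proof (intro conjI ballI allI)
  have l: "locally_integrable \<Omega> u" "locally_integrable \<Omega> v" "locally_integrable \<Omega> g" "locally_integrable \<Omega> h"
    using u v by (auto simp: is_weak_gradient_def)
  show "locally_integrable \<Omega> (\<lambda>x. a * u x + b * v x)" "locally_integrable \<Omega> (\<lambda>x. a *\<^sub>R g x + b *\<^sub>R h x)"
    using l unfolding locally_integrable_def by (auto intro!: Bochner_Integration.integrable_add integrable_scaleR_right)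
  fix \<phi> i assume \<phi>: "\<phi> \<in> test_functions \<Omega>"
  note i = integrable_mult_test[OF l(1) test_function_partial_deriv[OF \<phi>]] integrable_mult_test[OF l(2) test_function_partial_deriv[OF \<phi>]]
     integrable_mult_test[OF locally_integrable_nth[OF l(3)] \<phi>] integrable_mult_test[OF locally_integrable_nth[OF l(4)] \<phi>]
  have "(\<integral>x. (a * u x + b * v x) * partial_deriv i \<phi> x \<partial>lebesgue) = a * (\<integral>x. u x * partial_deriv i \<phi> x \<partial>lebesgue) + b * (\<integral>x. v x * partial_deriv i \<phi> x \<partial>lebesgue)"
    using i by (simp add: distrib_right mult.assoc)
  also have "\<dots> = - (a * (\<integral>x. g x $ i * \<phi> x \<partial>lebesgue) + b * (\<integral>x. h x $ i * \<phi> x \<partial>lebesgue))"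
    using u v \<phi> unfolding is_weak_gradient_lebesgue[OF assms(1)] by simp
  also have "\<dots> = - (\<integral>x. (a *\<^sub>R g x + b *\<^sub>R h x) $ i * \<phi> x \<partial>lebesgue)"
    using i by (simp add: distrib_right mult.assoc)
  finally show "(\<integral>x. (a * u x + b * v x) * partial_deriv i \<phi> x \<partial>lebesgue) = - (\<integral>x. (a *\<^sub>R g x + b *\<^sub>R h x) $ i * \<phi> x \<partial>lebesgue)" .
qed

section \<open>A Poincare inequality on convex sets\<close>

lemma nn_integral_indicator_affine_le:
  fixes Q :: "(real^'n) set"
  assumes [measurable]: "Q \<in> sets borel" and c: "\<bar>c\<bar> \<ge> 1 / 2"
  shows "(\<integral>\<^sup>+h. indicator Q (z + c *\<^sub>R h) \<partial>lborel) \<le> 2 ^ CARD('n) * emeasure lborel Q"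
proof -
  have c0: "c \<noteq> 0" using c by auto
  let ?X = "\<integral>\<^sup>+h. indicator Q (z + c *\<^sub>R h) \<partial>lborel"
  have "emeasure lborel Q = (\<integral>\<^sup>+x. indicator Q x \<partial>lborel)" by simp
  also have "\<dots> = (\<integral>\<^sup>+x. indicator Q x \<partial>(density (distr lborel borel (\<lambda>x. z + c *\<^sub>R x)) (\<lambda>_. ennreal (\<bar>c\<bar> ^ DIM(real^'n)))))"
    by (rule arg_cong[OF lborel_affine[OF c0, of z], of "\<lambda>M. \<integral>\<^sup>+x. indicator Q x \<partial>M"])
  also have "\<dots> = ennreal (\<bar>c\<bar> ^ CARD('n)) * ?X"
    by (simp add: nn_integral_density nn_integral_distr nn_integral_cmult del: nn_integral_indicator)
  finally have eq: "emeasure lborel Q = ennreal (\<bar>c\<bar> ^ CARD('n)) * ?X" .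
  have "1 \<le> (2 * \<bar>c\<bar>) ^ CARD('n)" using c by (intro one_le_power) auto
  then have "1 \<le> ennreal ((2 * \<bar>c\<bar>) ^ CARD('n))" by simp
  from mult_right_mono[OF this, of ?X]
  have "?X \<le> ennreal ((2 * \<bar>c\<bar>) ^ CARD('n)) * ?X" by simp
  also have "ennreal ((2 * \<bar>c\<bar>) ^ CARD('n)) = ennreal (2 ^ CARD('n)) * ennreal (\<bar>c\<bar> ^ CARD('n))"
    by (simp add: power_mult_distrib ennreal_mult)
  also have "\<dots> * ?X = 2 ^ CARD('n) * emeasure lborel Q"
    unfolding eq by (simp add: mult.assoc flip: ennreal_power)
  finally show ?thesis .
qed

text \<open>Integrate the segment formula over x and h = y - x, and shift x so that the gradient is
  evaluated at x; the endpoints become x - t h and x + (1 - t) h. Convexity puts x into Q. One of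
  the two coefficients has modulus at least 1/2, so the set of admissible h has measure at most 2^n
  |Q|. The double integral is kept because it can be restricted to any product subset of Q x
  Q.\<close>

theorem poincare_convex:
  fixes f :: "real^'n \<Rightarrow> real" and Q :: "(real^'n) set"
  assumes W: "W11 f g" and Q[measurable]: "Q \<in> sets borel" and "convex Q"
    and diam: "\<And>x y. x \<in> Q \<Longrightarrow> y \<in> Q \<Longrightarrow> norm (x - y) \<le> D" and "D \<ge> 0"
  shows "(\<integral>\<^sup>+x. \<integral>\<^sup>+y. indicator Q x * indicator Q y * ennreal \<bar>f y - f x\<bar> \<partial>lborel \<partial>lborel)
    \<le> 2 ^ CARD('n) * ennreal D * emeasure lborel Q * (\<integral>\<^sup>+x. indicator Q x * ennreal (norm (g x)) \<partial>lborel)"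
proof -
  have f: "integrable lborel f" and g: "integrable lborel g" using W by (auto simp: W11_def)
  have [measurable]: "f \<in> borel_measurable borel" "g \<in> borel_measurable borel" using f g by auto
  have "(\<integral>\<^sup>+x. \<integral>\<^sup>+y. indicator Q x * indicator Q y * ennreal \<bar>f y - f x\<bar> \<partial>lborel \<partial>lborel)
    = (\<integral>\<^sup>+x. \<integral>\<^sup>+h. indicator Q x * indicator Q (x + h) * ennreal \<bar>f (x + h) - f x\<bar> \<partial>lborel \<partial>lborel)"
  proof (rule nn_integral_cong)
    fix x
    show "(\<integral>\<^sup>+y. indicator Q x * indicator Q y * ennreal \<bar>f y - f x\<bar> \<partial>lborel)
      = (\<integral>\<^sup>+h. indicator Q x * indicator Q (x + h) * ennreal \<bar>f (x + h) - f x\<bar> \<partial>lborel)"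
      using nn_integral_lborel_translation[of "\<lambda>y. indicator Q x * indicator Q y * ennreal \<bar>f y - f x\<bar>" x]
      by (simp add: add.commute)
  qed
  also have "\<dots> = (\<integral>\<^sup>+h. \<integral>\<^sup>+x. indicator Q x * indicator Q (x + h) * ennreal \<bar>f (x + h) - f x\<bar> \<partial>lborel \<partial>lborel)"
    by (rule lborel_pair.Fubini'[symmetric]) measurable
  also have "\<dots> \<le> (\<integral>\<^sup>+h. \<integral>\<^sup>+x. \<integral>\<^sup>+t. indicator Q x * indicator Q (x + h) * (indicator {0..1} t * ennreal (D * norm (g (x + t *\<^sub>R h)))) \<partial>lborel \<partial>lborel \<partial>lborel)"
  proof (rule nn_integral_mono)
    fix h :: "real^'n"
    have "AE x in lborel. indicator Q x * indicator Q (x + h) * ennreal \<bar>f (x + h) - f x\<bar>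
       \<le> (\<integral>\<^sup>+t. indicator Q x * indicator Q (x + h) * (indicator {0..1} t * ennreal (D * norm (g (x + t *\<^sub>R h)))) \<partial>lborel)"
      using W11_segment(1)[OF W, of h]
    proof eventually_elim
      case (elim x)
      show ?case
      proof (cases "x \<in> Q \<and> x + h \<in> Q")
        case True
        then have h: "norm h \<le> D" using diam[of "x + h" x] by simp
        have "ennreal \<bar>f (x + h) - f x\<bar> \<le> (\<integral>\<^sup>+t. ennreal (norm (indicator {0..1} t * (g (x + t *\<^sub>R h) \<bullet> h))) \<partial>lborel)"
          unfolding elim using integral_norm_bound_ennreal[of lborel "\<lambda>t. indicator {0..1} t * (g (x + t *\<^sub>R h) \<bullet> h)"]
          by (cases "integrable lborel (\<lambda>t. indicator {0..1} t * (g (x + t *\<^sub>R h) \<bullet> h))") (auto simp: not_integrable_integral_eq)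
        also have "\<dots> \<le> (\<integral>\<^sup>+t. indicator {0..1} t * ennreal (D * norm (g (x + t *\<^sub>R h))) \<partial>lborel)"
        proof (intro nn_integral_mono)
          fix t :: real
          have "\<bar>g (x + t *\<^sub>R h) \<bullet> h\<bar> \<le> norm (g (x + t *\<^sub>R h)) * norm h" by (rule Cauchy_Schwarz_ineq2)
          also have "\<dots> \<le> D * norm (g (x + t *\<^sub>R h))" using mult_right_mono[OF h, of "norm (g (x + t *\<^sub>R h))"] by (simp add: mult.commute)
          finally show "ennreal (norm (indicator {0..1} t * (g (x + t *\<^sub>R h) \<bullet> h))) \<le> indicator {0..1} t * ennreal (D * norm (g (x + t *\<^sub>R h)))"
            by (auto simp: indicator_def intro: ennreal_leI)
        qed
        finally show ?thesis using True by simp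
      qed auto
    qed
    then show "(\<integral>\<^sup>+x. indicator Q x * indicator Q (x + h) * ennreal \<bar>f (x + h) - f x\<bar> \<partial>lborel)
       \<le> (\<integral>\<^sup>+x. \<integral>\<^sup>+t. indicator Q x * indicator Q (x + h) * (indicator {0..1} t * ennreal (D * norm (g (x + t *\<^sub>R h)))) \<partial>lborel \<partial>lborel)"
      by (rule nn_integral_mono_AE)
  qed
  also have "\<dots> = (\<integral>\<^sup>+h. \<integral>\<^sup>+t. \<integral>\<^sup>+x. indicator Q x * indicator Q (x + h) * (indicator {0..1} t * ennreal (D * norm (g (x + t *\<^sub>R h)))) \<partial>lborel \<partial>lborel \<partial>lborel)"
  proof (rule nn_integral_cong)
    fix h
    show "(\<integral>\<^sup>+x. \<integral>\<^sup>+t. indicator Q x * indicator Q (x + h) * (indicator {0..1} t * ennreal (D * norm (g (x + t *\<^sub>R h)))) \<partial>lborel \<partial>lborel)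
      = (\<integral>\<^sup>+t. \<integral>\<^sup>+x. indicator Q x * indicator Q (x + h) * (indicator {0..1::real} t * ennreal (D * norm (g (x + t *\<^sub>R h)))) \<partial>lborel \<partial>lborel)"
      by (rule lborel_pair.Fubini'[symmetric]) measurable
  qed
  also have "\<dots> = (\<integral>\<^sup>+t. \<integral>\<^sup>+h. \<integral>\<^sup>+x. indicator Q x * indicator Q (x + h) * (indicator {0..1} t * ennreal (D * norm (g (x + t *\<^sub>R h)))) \<partial>lborel \<partial>lborel \<partial>lborel)"
    by (rule lborel_pair.Fubini'[symmetric]) measurable
  also have "\<dots> \<le> (\<integral>\<^sup>+t. indicator {0..1::real} t * (ennreal D * (2 ^ CARD('n) * emeasure lborel Q * (\<integral>\<^sup>+x. indicator Q x * ennreal (norm (g x)) \<partial>lborel))) \<partial>lborel)"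
  proof (intro nn_integral_mono)
    fix t :: real
    show "(\<integral>\<^sup>+h. \<integral>\<^sup>+x. indicator Q x * indicator Q (x + h) * (indicator {0..1} t * ennreal (D * norm (g (x + t *\<^sub>R h)))) \<partial>lborel \<partial>lborel)
      \<le> indicator {0..1} t * (ennreal D * (2 ^ CARD('n) * emeasure lborel Q * (\<integral>\<^sup>+x. indicator Q x * ennreal (norm (g x)) \<partial>lborel)))"
    proof (cases "t \<in> {0..1}")
      case True
      have "(\<integral>\<^sup>+h. \<integral>\<^sup>+x. indicator Q x * indicator Q (x + h) * (indicator {0..1} t * ennreal (D * norm (g (x + t *\<^sub>R h)))) \<partial>lborel \<partial>lborel)
        = (\<integral>\<^sup>+h. \<integral>\<^sup>+x. indicator Q (x + (- t) *\<^sub>R h) * indicator Q (x + (1 - t) *\<^sub>R h) * ennreal (D * norm (g x)) \<partial>lborel \<partial>lborel)"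
      proof (rule nn_integral_cong)
        fix h
        let ?F = "\<lambda>x. indicator Q x * indicator Q (x + h) * (indicator {0..1} t * ennreal (D * norm (g (x + t *\<^sub>R h))))"
        have "(\<integral>\<^sup>+x. ?F x \<partial>lborel) = (\<integral>\<^sup>+x. ?F (x + (- t) *\<^sub>R h) \<partial>lborel)"
          by (rule nn_integral_lborel_translation[symmetric]) measurable
        also have "\<dots> = (\<integral>\<^sup>+x. indicator Q (x + (- t) *\<^sub>R h) * indicator Q (x + (1 - t) *\<^sub>R h) * ennreal (D * norm (g x)) \<partial>lborel)"
        proof (rule nn_integral_cong)
          fix x
          have "x + (- t) *\<^sub>R h + h = x + (1 - t) *\<^sub>R h" by (simp add: algebra_simps)
          then show "?F (x + (- t) *\<^sub>R h) = indicator Q (x + (- t) *\<^sub>R h) * indicator Q (x + (1 - t) *\<^sub>R h) * ennreal (D * norm (g x))"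
            using True by (simp only:) simp
        qed
        finally show "(\<integral>\<^sup>+x. ?F x \<partial>lborel)
          = (\<integral>\<^sup>+x. indicator Q (x + (- t) *\<^sub>R h) * indicator Q (x + (1 - t) *\<^sub>R h) * ennreal (D * norm (g x)) \<partial>lborel)" .
      qed
      also have "\<dots> \<le> (\<integral>\<^sup>+h. \<integral>\<^sup>+x. indicator Q x * indicator Q (x + (- t) *\<^sub>R h) * indicator Q (x + (1 - t) *\<^sub>R h) * ennreal (D * norm (g x)) \<partial>lborel \<partial>lborel)"
      proof (intro nn_integral_mono)
        fix h x :: "real^'n"
        have "x \<in> Q" if "x + (- t) *\<^sub>R h \<in> Q" "x + (1 - t) *\<^sub>R h \<in> Q"
        proof -
          have "(1 - t) *\<^sub>R (x + (- t) *\<^sub>R h) + t *\<^sub>R (x + (1 - t) *\<^sub>R h) \<in> Q"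
            using True by (intro convexD[OF \<open>convex Q\<close> that]) auto
          then show ?thesis by (simp add: algebra_simps)
        qed
        then show "indicator Q (x + (- t) *\<^sub>R h) * indicator Q (x + (1 - t) *\<^sub>R h) * ennreal (D * norm (g x))
          \<le> indicator Q x * indicator Q (x + (- t) *\<^sub>R h) * indicator Q (x + (1 - t) *\<^sub>R h) * ennreal (D * norm (g x))"
          by (auto simp: indicator_def)
      qed
      also have "\<dots> = (\<integral>\<^sup>+x. \<integral>\<^sup>+h. indicator Q x * indicator Q (x + (- t) *\<^sub>R h) * indicator Q (x + (1 - t) *\<^sub>R h) * ennreal (D * norm (g x)) \<partial>lborel \<partial>lborel)"
        by (rule lborel_pair.Fubini') measurable
      also have "\<dots> \<le> (\<integral>\<^sup>+x. indicator Q x * ennreal (D * norm (g x)) * (2 ^ CARD('n) * emeasure lborel Q) \<partial>lborel)"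
      proof (intro nn_integral_mono)
        fix x
        define c where "c = (if t \<le> 1/2 then 1 - t else - t)"
        have c: "\<bar>c\<bar> \<ge> 1 / 2" unfolding c_def using True by auto
        have "(\<integral>\<^sup>+h. indicator Q x * indicator Q (x + (- t) *\<^sub>R h) * indicator Q (x + (1 - t) *\<^sub>R h) * ennreal (D * norm (g x)) \<partial>lborel)
          \<le> (\<integral>\<^sup>+h. (indicator Q x * ennreal (D * norm (g x))) * indicator Q (x + c *\<^sub>R h) \<partial>lborel)"
          unfolding c_def by (intro nn_integral_mono) (auto simp: indicator_def)
        also have "\<dots> = (indicator Q x * ennreal (D * norm (g x))) * (\<integral>\<^sup>+h. indicator Q (x + c *\<^sub>R h) \<partial>lborel)"
          by (rule nn_integral_cmult) measurable
        also have "\<dots> \<le> indicator Q x * ennreal (D * norm (g x)) * (2 ^ CARD('n) * emeasure lborel Q)"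
          by (intro mult_left_mono nn_integral_indicator_affine_le Q c) auto
        finally show "(\<integral>\<^sup>+h. indicator Q x * indicator Q (x + (- t) *\<^sub>R h) * indicator Q (x + (1 - t) *\<^sub>R h) * ennreal (D * norm (g x)) \<partial>lborel)
          \<le> indicator Q x * ennreal (D * norm (g x)) * (2 ^ CARD('n) * emeasure lborel Q)" .
      qed
      also have "\<dots> = (\<integral>\<^sup>+x. ennreal D * (indicator Q x * ennreal (norm (g x))) \<partial>lborel) * (2 ^ CARD('n) * emeasure lborel Q)"
        using \<open>D \<ge> 0\<close> by (subst nn_integral_multc[symmetric]) (auto simp: ennreal_mult mult_ac)
      also have "(\<integral>\<^sup>+x. ennreal D * (indicator Q x * ennreal (norm (g x))) \<partial>lborel) = ennreal D * (\<integral>\<^sup>+x. indicator Q x * ennreal (norm (g x)) \<partial>lborel)"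
        by (rule nn_integral_cmult) measurable
      finally show ?thesis using True by (simp add: mult_ac)
    qed simp
  qed
  also have "\<dots> = 2 ^ CARD('n) * ennreal D * emeasure lborel Q * (\<integral>\<^sup>+x. indicator Q x * ennreal (norm (g x)) \<partial>lborel)"
    by (subst nn_integral_multc) (auto simp: mult_ac)
  finally show ?thesis .
qed

section \<open>A weighted Faber--Krahn inequality\<close>

definition cell_index :: "real \<Rightarrow> real^'n \<Rightarrow> int^'n"
  where "cell_index l x = (\<chi> i. \<lfloor>x $ i / l\<rfloor>)"

text \<open>Half-open cubes: they partition the space with no overlap on faces, and the cells of
  side l / 2 refine those of side l.\<close>

definition cell :: "real \<Rightarrow> int^'n \<Rightarrow> (real^'n) set"
  where "cell l z = {x. cell_index l x = z}"

lemma in_cell_iff: "x \<in> cell l z \<longleftrightarrow> (\<forall>i. \<lfloor>x $ i / l\<rfloor> = z $ i)"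
  by (simp add: cell_def cell_index_def vec_eq_iff)

lemma in_cell_iff':
  assumes "l > 0" shows "x \<in> cell l z \<longleftrightarrow> (\<forall>i. l * of_int (z $ i) \<le> x $ i \<and> x $ i < l * (of_int (z $ i) + 1))"
  using assms by (simp add: in_cell_iff floor_eq_iff field_simps)

lemma in_cell_index [simp]: "x \<in> cell l (cell_index l x)"
  by (simp add: cell_def)

lemma cell_measurable [measurable]: "cell l z \<in> sets borel"
proof -
  have "cell l z = {x \<in> space borel. \<forall>i\<in>UNIV. \<lfloor>x $ i / l\<rfloor> = z $ i}" by (auto simp: in_cell_iff)
  also have "\<dots> \<in> sets borel" by measurable
  finally show ?thesis .
qed

lemma cell_index_measurable [measurable]: "cell_index l \<in> (borel :: (real^'n) measure) \<rightarrow>\<^sub>M count_space UNIV"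
proof -
  have "cell_index l -` {z} = cell l z" for z :: "int^'n" by (auto simp: cell_def)
  then show ?thesis by (subst measurable_count_space_eq2_countable) auto
qed

lemma convex_cell:
  fixes z :: "int^'n"
  assumes "l > 0" shows "convex (cell l z)"
proof (rule convexI)
  fix x y :: "real^'n" and u v :: real assume xy: "x \<in> cell l z" "y \<in> cell l z" and uv: "0 \<le> u" "0 \<le> v" "u + v = 1"
  have "l * of_int (z $ i) \<le> u * x $ i + v * y $ i \<and> u * x $ i + v * y $ i < l * (of_int (z $ i) + 1)" for i
  proof
    have "u * (l * of_int (z $ i)) + v * (l * of_int (z $ i)) \<le> u * x $ i + v * y $ i"
      using xy uv in_cell_iff'[OF assms] by (intro add_mono mult_left_mono) auto
    then show "l * of_int (z $ i) \<le> u * x $ i + v * y $ i" using uv by (simp flip: distrib_right)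
    have "x $ i < l * (of_int (z $ i) + 1)" "y $ i < l * (of_int (z $ i) + 1)" using xy in_cell_iff'[OF assms] by auto
    then show "u * x $ i + v * y $ i < l * (of_int (z $ i) + 1)" using uv convex_bound_lt by blast
  qed
  then show "u *\<^sub>R x + v *\<^sub>R y \<in> cell l z" unfolding in_cell_iff'[OF assms] by simp
qed

lemma cell_diameter:
  fixes x y :: "real^'n" and l :: real
  assumes "l > 0" "x \<in> cell l z" "y \<in> cell l z" shows "norm (x - y) \<le> CARD('n) * l"
proof -
  have "\<bar>(x - y) $ i\<bar> \<le> l" for i
    using assms in_cell_iff'[OF assms(1), of x z] in_cell_iff'[OF assms(1), of y z]
    by (auto simp: abs_le_iff algebra_simps dest!: spec[of _ i])
  then have "(\<Sum>i\<in>UNIV. \<bar>(x - y) $ i\<bar>) \<le> (\<Sum>i\<in>(UNIV::'n set). l)" by (intro sum_mono)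
  then show ?thesis using norm_le_l1_cart[of "x - y"] by simp
qed

text \<open>The half-open cell lies between the open and the closed box with the same corners, which
  have equal measure.\<close>

lemma emeasure_cell:
  fixes z :: "int^'n"
  assumes "l > 0" shows "emeasure lborel (cell l z) = ennreal (l ^ CARD('n))"
proof -
  define a :: "real^'n" where "a = (\<chi> i. l * of_int (z $ i))"
  define b :: "real^'n" where "b = (\<chi> i. l * (of_int (z $ i) + 1))"
  have sub: "box a b \<subseteq> cell l z" "cell l z \<subseteq> cbox a b"
    using in_cell_iff'[OF assms, of _ z] by (auto simp: a_def b_def mem_box_cart less_imp_le)
  have "(b - a) \<bullet> i = l" if "i \<in> Basis" for i
    using that by (auto simp: Basis_vec_def inner_axis a_def b_def algebra_simps)
  then have p: "(\<Prod>i\<in>Basis. (b - a) \<bullet> i) = l ^ CARD('n)" by simp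
  have le: "a \<bullet> i \<le> b \<bullet> i" if "i \<in> Basis" for i
    using that assms by (auto simp: Basis_vec_def inner_axis a_def b_def)
  have "emeasure lborel (box a b) = ennreal (l ^ CARD('n))"
    using le p by (subst emeasure_lborel_box) auto
  moreover have "emeasure lborel (cbox a b) = ennreal (l ^ CARD('n))"
    using le p by (subst emeasure_lborel_cbox) auto
  ultimately show ?thesis
    using emeasure_mono[OF sub(1), of lborel] emeasure_mono[OF sub(2), of lborel] by auto
qed

lemma cell_half_subset:
  assumes "cell_index (l / 2) x = cell_index (l / 2) y"
  shows "cell_index l x = cell_index l y"
proof -
  have d: "\<lfloor>a / l\<rfloor> = \<lfloor>a / (l / 2)\<rfloor> div 2" for a
  proof -
    have "\<lfloor>a / l\<rfloor> = \<lfloor>(2 * (a / l)) / of_int 2\<rfloor>" by simp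
    also have "\<dots> = \<lfloor>2 * (a / l)\<rfloor> div 2" by (rule floor_divide_real_eq_div) simp
    finally show ?thesis by (simp add: mult.commute)
  qed
  have "\<lfloor>x $ i / l\<rfloor> = \<lfloor>y $ i / l\<rfloor>" for i
    using assms d[of "x $ i"] d[of "y $ i"] by (simp add: cell_index_def vec_eq_iff)
  then show ?thesis by (simp add: cell_index_def)
qed

lemma nn_integral_cells:
  fixes F :: "real^'n \<Rightarrow> ennreal"
  assumes [measurable]: "F \<in> borel_measurable borel"
  shows "(\<integral>\<^sup>+x. F x \<partial>lborel) = (\<Sum>j. \<integral>\<^sup>+x. indicator {x. to_nat (cell_index l x) = j} x * F x \<partial>lborel)"
proof -
  have [measurable]: "{x :: real^'n. to_nat (cell_index l x) = j} \<in> sets borel" for j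
  proof -
    have "{x \<in> space borel. to_nat (cell_index l x :: int^'n) = j} \<in> sets borel" by measurable
    then show ?thesis by simp
  qed
  have "F x = (\<Sum>j. indicator {x. to_nat (cell_index l x) = j} x * F x)" for x
    by (subst suminf_finite[of "{to_nat (cell_index l x)}"]) auto
  then have "(\<integral>\<^sup>+x. F x \<partial>lborel) = (\<integral>\<^sup>+x. (\<Sum>j. indicator {x. to_nat (cell_index l x) = j} x * F x) \<partial>lborel)"
    by (intro nn_integral_cong)
  also have "\<dots> = (\<Sum>j. \<integral>\<^sup>+x. indicator {x. to_nat (cell_index l x) = j} x * F x \<partial>lborel)"
    by (rule nn_integral_suminf) measurable
  finally show ?thesis .
qed

lemma nn_integral_cells_mono:
  fixes F G :: "real^'n \<Rightarrow> ennreal"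
  assumes "F \<in> borel_measurable borel" "G \<in> borel_measurable borel"
    and le: "\<And>z. (\<integral>\<^sup>+x. indicator (cell l z) x * F x \<partial>lborel) \<le> (\<integral>\<^sup>+x. indicator (cell l z) x * G x \<partial>lborel)"
  shows "(\<integral>\<^sup>+x. F x \<partial>lborel) \<le> (\<integral>\<^sup>+x. G x \<partial>lborel)"
  unfolding nn_integral_cells[OF assms(1), of l] nn_integral_cells[OF assms(2), of l]
proof (intro suminf_le allI)
  fix j
  show "(\<integral>\<^sup>+x. indicator {x. to_nat (cell_index l x) = j} x * F x \<partial>lborel)
    \<le> (\<integral>\<^sup>+x. indicator {x. to_nat (cell_index l x) = j} x * G x \<partial>lborel)"
  proof (cases "\<exists>z :: int^'n. to_nat z = j")
    case True
    then obtain z :: "int^'n" where "to_nat z = j" by blast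
    then have "{x. to_nat (cell_index l x) = j} = cell l z" by (auto simp: cell_def)
    then show ?thesis using le[of z] by simp
  next
    case False
    then have "{x. to_nat (cell_index l x :: int^'n) = j} = {}" by auto
    then show ?thesis by simp
  qed
qed auto

section \<open>Convexity of powers and averages over cells\<close>

lemma powr_le_self: "0 \<le> t \<Longrightarrow> t \<le> 1 \<Longrightarrow> 1 \<le> q \<Longrightarrow> t powr q \<le> (t::real)"
  using powr_mono'[of 1 q t] by (cases "t = 0") auto

text \<open>At a zero endpoint the claim reduces to t^q <= t on [0, 1]; the remaining case is
  convexity on the open half line.\<close>

lemma powr_convex_nonneg:
  fixes a b q t :: real
  assumes "0 \<le> a" "0 \<le> b" "0 \<le> t" "t \<le> 1" "1 \<le> q"
  shows "((1 - t) * a + t * b) powr q \<le> (1 - t) * a powr q + t * b powr q"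
proof -
  consider "a = 0" | "b = 0" | "a > 0" "b > 0" using assms by linarith
  then show ?thesis
  proof cases
    case 1
    have "(t * b) powr q = t powr q * b powr q" using assms by (simp add: powr_mult)
    also have "\<dots> \<le> t * b powr q" using assms by (intro mult_right_mono powr_le_self) auto
    finally show ?thesis using 1 assms by simp
  next
    case 2
    have "((1 - t) * a) powr q = (1 - t) powr q * a powr q" using assms by (simp add: powr_mult)
    also have "\<dots> \<le> (1 - t) * a powr q" using assms by (intro mult_right_mono powr_le_self) auto
    finally show ?thesis using 2 assms by simp
  next
    case 3
    then show ?thesis using convex_onD[OF powr_convex[OF assms(5)], of t a b] assms by simp
  qed
qed

text \<open>Jensen's inequality for the weights 2^(-(j+1)), whose sum is less than 1; the missing
  mass sits at 0. The first term has weight 1/2, and the remainder is half of an average of the same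
  kind.\<close>

lemma powr_geometric_average_le:
  fixes T :: "nat \<Rightarrow> real"
  assumes "\<And>j. T j \<ge> 0" "1 \<le> q"
  shows "(\<Sum>j<k. T j / 2 ^ (j + 1)) powr q \<le> (\<Sum>j<k. T j powr q / 2 ^ (j + 1))"
  using assms(1)
proof (induction k arbitrary: T)
  case 0
  then show ?case by simp
next
  case (Suc k)
  let ?V = "\<Sum>j<k. T (Suc j) / 2 ^ (j + 1)"
  have V: "?V \<ge> 0" using Suc.prems by (intro sum_nonneg) auto
  have "(\<Sum>j<Suc k. T j / 2 ^ (j + 1)) = (1 - 1/2) * T 0 + 1/2 * ?V"
    by (subst sum.lessThan_Suc_shift) (simp add: sum_divide_distrib)
  also have "\<dots> powr q \<le> (1 - 1/2) * T 0 powr q + 1/2 * ?V powr q"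
    using Suc.prems V assms(2) by (intro powr_convex_nonneg) auto
  also have "\<dots> \<le> (1 - 1/2) * T 0 powr q + 1/2 * (\<Sum>j<k. T (Suc j) powr q / 2 ^ (j + 1))"
    using Suc.IH[of "\<lambda>j. T (Suc j)"] Suc.prems by simp
  also have "\<dots> = (\<Sum>j<Suc k. T j powr q / 2 ^ (j + 1))"
    by (subst sum.lessThan_Suc_shift) (simp add: sum_divide_distrib)
  finally show ?case .
qed

definition cell_avg :: "real \<Rightarrow> (real^'n \<Rightarrow> real) \<Rightarrow> real^'n \<Rightarrow> real"
  where "cell_avg l h x = (\<integral>y. indicator (cell l (cell_index l x)) y * h y \<partial>lborel) / l ^ CARD('n)"

lemma cell_avg_measurable [measurable]:
  fixes h :: "real^'n \<Rightarrow> real"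
  shows "cell_avg l h \<in> borel_measurable borel"
proof -
  have "(\<lambda>z::int^'n. (\<integral>y. indicator (cell l z) y * h y \<partial>lborel) / l ^ CARD('n)) \<in> borel_measurable (count_space UNIV)" by simp
  from measurable_compose[OF cell_index_measurable this] show ?thesis by (simp add: cell_avg_def[abs_def])
qed

lemma cell_avg_nonneg: "(\<And>x. h x \<ge> 0) \<Longrightarrow> l > 0 \<Longrightarrow> cell_avg l h x \<ge> 0"
  unfolding cell_avg_def by (intro divide_nonneg_nonneg Bochner_Integration.integral_nonneg) auto

lemma nn_integral_cell_avg:
  fixes h :: "real^'n \<Rightarrow> real"
  assumes "integrable lborel h" "\<And>x. h x \<ge> 0" "l > 0"
  shows "(\<integral>\<^sup>+y. indicator (cell l (cell_index l x)) y * ennreal (h y) \<partial>lborel) = ennreal (l ^ CARD('n) * cell_avg l h x)"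
proof -
  have i: "integrable lborel (\<lambda>y. indicator (cell l (cell_index l x)) y * h y)"
    using integrable_mult_indicator[OF _ assms(1), of "cell l (cell_index l x)"] by simp
  have "(\<integral>\<^sup>+y. indicator (cell l (cell_index l x)) y * ennreal (h y) \<partial>lborel)
    = (\<integral>\<^sup>+y. ennreal (indicator (cell l (cell_index l x)) y * h y) \<partial>lborel)"
    using assms(2) by (intro nn_integral_cong) (auto simp: indicator_def)
  also have "\<dots> = ennreal (\<integral>y. indicator (cell l (cell_index l x)) y * h y \<partial>lborel)"
    using assms(2) by (intro nn_integral_eq_integral i) auto
  finally show ?thesis using assms(3) by (simp add: cell_avg_def)
qed

text \<open>The consequence of the A_q condition, on cells instead of balls, that the Faber--Krahn inequality needs.\<close>

definition cell_weight :: "real \<Rightarrow> ennreal \<Rightarrow> (real^'n \<Rightarrow> ennreal) \<Rightarrow> bool"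
  where "cell_weight q K w \<longleftrightarrow> w \<in> borel_measurable borel \<and>
    (\<forall>l>0. \<forall>x h. h \<in> borel_measurable borel \<and> (\<forall>y. h y \<ge> 0) \<and> integrable lborel h \<longrightarrow>
      (\<integral>\<^sup>+y. indicator (cell l (cell_index l x)) y * w y \<partial>lborel) * ennreal (cell_avg l h x powr q)
      \<le> K * (\<integral>\<^sup>+y. indicator (cell l (cell_index l x)) y * (w y * ennreal (h y powr q)) \<partial>lborel))"

text \<open>The average is constant on each cell, so the defining inequality of
  \<open>cell_weight\<close> can be summed over cells. The same K serves all l, which is what allows
  the scales to be summed.\<close>

lemma cell_weight_avg_le:
  fixes h :: "real^'n \<Rightarrow> real"
  assumes w: "cell_weight q K w" and "l > 0" and h: "\<And>x. h x \<ge> 0" "integrable lborel h"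
  shows "(\<integral>\<^sup>+x. w x * ennreal (cell_avg l h x powr q) \<partial>lborel) \<le> K * (\<integral>\<^sup>+x. w x * ennreal (h x powr q) \<partial>lborel)"
proof -
  have [measurable]: "w \<in> borel_measurable borel" "h \<in> borel_measurable borel" using w h by (auto simp: cell_weight_def)
  have "(\<integral>\<^sup>+x. w x * ennreal (cell_avg l h x powr q) \<partial>lborel) \<le> (\<integral>\<^sup>+x. K * (w x * ennreal (h x powr q)) \<partial>lborel)"
  proof (rule nn_integral_cells_mono[where l=l])
    fix z :: "int^'n"
    show "(\<integral>\<^sup>+x. indicator (cell l z) x * (w x * ennreal (cell_avg l h x powr q)) \<partial>lborel)
      \<le> (\<integral>\<^sup>+x. indicator (cell l z) x * (K * (w x * ennreal (h x powr q))) \<partial>lborel)"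
    proof (cases "cell l z = {}")
      case False
      then obtain x0 where "x0 \<in> cell l z" by auto
      then have z: "z = cell_index l x0" by (simp add: cell_def)
      have "(\<integral>\<^sup>+x. indicator (cell l z) x * (w x * ennreal (cell_avg l h x powr q)) \<partial>lborel)
        = (\<integral>\<^sup>+x. indicator (cell l z) x * w x * ennreal (cell_avg l h x0 powr q) \<partial>lborel)"
        unfolding z by (intro nn_integral_cong) (auto simp: indicator_def cell_def cell_avg_def mult.assoc)
      also have "\<dots> = (\<integral>\<^sup>+x. indicator (cell l z) x * w x \<partial>lborel) * ennreal (cell_avg l h x0 powr q)"
        by (rule nn_integral_multc) measurable
      also have "\<dots> \<le> K * (\<integral>\<^sup>+x. indicator (cell l z) x * (w x * ennreal (h x powr q)) \<partial>lborel)"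
        using w h \<open>l > 0\<close> unfolding cell_weight_def z by simp
      also have "\<dots> = (\<integral>\<^sup>+x. K * (indicator (cell l z) x * (w x * ennreal (h x powr q))) \<partial>lborel)"
        by (rule nn_integral_cmult[symmetric]) measurable
      finally show ?thesis by (simp add: mult.left_commute)
    qed simp
  qed measurable
  also have "\<dots> = K * (\<integral>\<^sup>+x. w x * ennreal (h x powr q) \<partial>lborel)"
    by (rule nn_integral_cmult) measurable
  finally show ?thesis .
qed

lemma cell_oscillation:
  fixes f :: "real^'n \<Rightarrow> real" and l :: real
  assumes W: "W11 f g" and l: "l > 0"
  shows "(\<integral>\<^sup>+x. \<integral>\<^sup>+y. indicator (cell l z) x * indicator (cell l z) y * ennreal \<bar>f y - f x\<bar> \<partial>lborel \<partial>lborel)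
    \<le> ennreal (2 ^ CARD('n) * (CARD('n) * l) * l ^ CARD('n)) * (\<integral>\<^sup>+x. indicator (cell l z) x * ennreal (norm (g x)) \<partial>lborel)"
proof -
  have "2 ^ CARD('n) * ennreal (real CARD('n) * l) * ennreal (l ^ CARD('n)) = ennreal (2 ^ CARD('n) * (CARD('n) * l) * l ^ CARD('n))"
    using l by (simp add: ennreal_mult flip: ennreal_power)
  then show ?thesis
    using poincare_convex[OF W cell_measurable convex_cell[OF l] cell_diameter[OF l], of z] l
    by (simp add: emeasure_cell)
qed

context
  fixes f :: "real^'n \<Rightarrow> real" and g and l :: real
  assumes W: "W11 f g" and l: "l > 0"
begin

private abbreviation "favg \<equiv> cell_avg l (\<lambda>y. \<bar>f y\<bar>)"
private abbreviation "gavg \<equiv> cell_avg l (\<lambda>y. norm (g y))"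

lemma fg_integrable: "integrable lborel (\<lambda>x. \<bar>f x\<bar>)" "integrable lborel (\<lambda>x. norm (g x))"
  using W by (auto simp: W11_def)

lemma fg_measurable [measurable]: "f \<in> borel_measurable borel" "g \<in> borel_measurable borel"
  using W by (auto simp: W11_def)

lemma cell_oscillation_avg:
  "(\<integral>\<^sup>+x. \<integral>\<^sup>+y. indicator (cell l (cell_index l x0)) x * indicator (cell l (cell_index l x0)) y * ennreal \<bar>f y - f x\<bar> \<partial>lborel \<partial>lborel)
    \<le> ennreal (2 ^ CARD('n) * (CARD('n) * l) * l ^ CARD('n) * (l ^ CARD('n) * gavg x0))"
  using cell_oscillation[OF W l, of "cell_index l x0"] l fg_integrable cell_avg_nonneg[of "\<lambda>y. norm (g y)" l x0]
  by (simp add: nn_integral_cell_avg flip: ennreal_mult)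

text \<open>Average |f y| <= |f z| + |f z - f y| over y in the half cell and z in the cell.
  Restricting y costs the measure ratio 2^n on top of the factor 2^n of the Poincare inequality,
  hence 4^n.\<close>

lemma cell_avg_half_le:
  "cell_avg (l / 2) (\<lambda>y. \<bar>f y\<bar>) x \<le> favg x + 4 ^ CARD('n) * CARD('n) * l * gavg x"
proof -
  let ?n = "CARD('n)"
  define Q where "Q = cell l (cell_index l x)"
  define Q' where "Q' = cell (l / 2) (cell_index (l / 2) x)"
  have [measurable]: "Q \<in> sets borel" "Q' \<in> sets borel" unfolding Q_def Q'_def by auto
  have sub: "Q' \<subseteq> Q" unfolding Q_def Q'_def cell_def using cell_half_subset[of l] by auto
  have eQ: "emeasure lborel Q = ennreal (l ^ ?n)" "emeasure lborel Q' = ennreal ((l / 2) ^ ?n)"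
    unfolding Q_def Q'_def using l by (auto simp: emeasure_cell)
  have iQ: "(\<integral>\<^sup>+y. indicator Q y * ennreal \<bar>f y\<bar> \<partial>lborel) = ennreal (l ^ ?n * favg x)"
    "(\<integral>\<^sup>+y. indicator Q' y * ennreal \<bar>f y\<bar> \<partial>lborel) = ennreal ((l / 2) ^ ?n * cell_avg (l / 2) (\<lambda>y. \<bar>f y\<bar>) x)"
    unfolding Q_def Q'_def using l fg_integrable by (auto simp: nn_integral_cell_avg)
  note pos = cell_avg_nonneg[of "\<lambda>y. norm (g y)" l x] cell_avg_nonneg[of "\<lambda>y. \<bar>f y\<bar>" l x] cell_avg_nonneg[of "\<lambda>y. \<bar>f y\<bar>" "l/2" x]
  have "ennreal ((l / 2) ^ ?n * cell_avg (l / 2) (\<lambda>y. \<bar>f y\<bar>) x * l ^ ?n)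
     = (\<integral>\<^sup>+y. indicator Q' y * ennreal \<bar>f y\<bar> * (\<integral>\<^sup>+z. indicator Q z \<partial>lborel) \<partial>lborel)"
    using l pos by (subst nn_integral_multc) (simp_all add: eQ iQ ennreal_mult)
  also have "\<dots> = (\<integral>\<^sup>+y. \<integral>\<^sup>+z. indicator Q' y * indicator Q z * ennreal \<bar>f y\<bar> \<partial>lborel \<partial>lborel)"
    by (intro nn_integral_cong, subst nn_integral_cmult[symmetric]) (auto intro!: nn_integral_cong simp: mult_ac)
  also have "\<dots> \<le> (\<integral>\<^sup>+y. \<integral>\<^sup>+z. indicator Q' y * (indicator Q z * ennreal \<bar>f z\<bar>) + indicator Q y * indicator Q z * ennreal \<bar>f z - f y\<bar> \<partial>lborel \<partial>lborel)"
  proof (intro nn_integral_mono)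
    fix y z
    have "ennreal \<bar>f y\<bar> \<le> ennreal \<bar>f z\<bar> + ennreal \<bar>f z - f y\<bar>" by (simp flip: ennreal_plus add: ennreal_leI)
    then show "indicator Q' y * indicator Q z * ennreal \<bar>f y\<bar>
      \<le> indicator Q' y * (indicator Q z * ennreal \<bar>f z\<bar>) + indicator Q y * indicator Q z * ennreal \<bar>f z - f y\<bar>"
      using sub by (auto simp: indicator_def)
  qed
  also have "\<dots> = (\<integral>\<^sup>+y. indicator Q' y * ennreal (l ^ ?n * favg x) + (\<integral>\<^sup>+z. indicator Q y * indicator Q z * ennreal \<bar>f z - f y\<bar> \<partial>lborel) \<partial>lborel)"
    by (intro nn_integral_cong, subst nn_integral_add) (auto simp: nn_integral_cmult iQ)
  also have "\<dots> = ennreal ((l / 2) ^ ?n) * ennreal (l ^ ?n * favg x) + (\<integral>\<^sup>+y. \<integral>\<^sup>+z. indicator Q y * indicator Q z * ennreal \<bar>f z - f y\<bar> \<partial>lborel \<partial>lborel)"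
    by (subst nn_integral_add) (auto simp: nn_integral_multc eQ)
  also have "\<dots> \<le> ennreal ((l / 2) ^ ?n) * ennreal (l ^ ?n * favg x) + ennreal (2 ^ ?n * (?n * l) * l ^ ?n * (l ^ ?n * gavg x))"
    unfolding Q_def by (intro add_left_mono cell_oscillation_avg)
  also have "\<dots> = ennreal ((l / 2) ^ ?n * (l ^ ?n * favg x) + 2 ^ ?n * (?n * l) * l ^ ?n * (l ^ ?n * gavg x))"
    using l pos by (simp flip: ennreal_mult ennreal_plus)
  finally have "(l / 2) ^ ?n * cell_avg (l / 2) (\<lambda>y. \<bar>f y\<bar>) x * l ^ ?n \<le> (l / 2) ^ ?n * (l ^ ?n * favg x) + 2 ^ ?n * (?n * l) * l ^ ?n * (l ^ ?n * gavg x)"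
    using l pos by (subst (asm) ennreal_le_iff) auto
  also have "\<dots> = (l / 2) ^ ?n * l ^ ?n * (favg x + 4 ^ ?n * ?n * l * gavg x)"
  proof -
    have "(4::real) ^ ?n = 2 ^ ?n * 2 ^ ?n" by (simp flip: power_mult_distrib)
    then show ?thesis by (simp add: power_divide field_simps)
  qed
  finally have "(l / 2) ^ ?n * l ^ ?n * cell_avg (l / 2) (\<lambda>y. \<bar>f y\<bar>) x \<le> (l / 2) ^ ?n * l ^ ?n * (favg x + 4 ^ ?n * ?n * l * gavg x)"
    by (simp add: mult_ac)
  then show ?thesis using l by (subst (asm) mult_le_cancel_left_pos) auto
qed

text \<open>f vanishes on a subset Z of at least half the cell, and |f y| = |f z - f y| for z in Z.
  The resulting factor 2 * 2^n is weakened to 4^n so that the start and the halving step share one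
  constant.\<close>

lemma cell_avg_initial_le:
  assumes S: "emeasure lborel {x. f x \<noteq> 0} \<le> ennreal (l ^ CARD('n) / 2)"
  shows "favg x \<le> 4 ^ CARD('n) * CARD('n) * l * gavg x"
proof -
  let ?n = "CARD('n)"
  define Q where "Q = cell l (cell_index l x)"
  define Z where "Z = Q \<inter> {x. f x = 0}"
  have "{x \<in> space borel. f x = 0} \<in> sets borel" "{x \<in> space borel. f x \<noteq> 0} \<in> sets borel" by measurable
  then have [measurable]: "Q \<in> sets borel" "{x. f x = 0} \<in> sets borel" "{x. f x \<noteq> 0} \<in> sets borel" unfolding Q_def by auto
  then have [measurable]: "Z \<in> sets borel" unfolding Z_def by auto
  have eQ: "emeasure lborel Q = ennreal (l ^ ?n)"
    unfolding Q_def using l by (auto simp: emeasure_cell)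
  have iQ: "(\<integral>\<^sup>+y. indicator Q y * ennreal \<bar>f y\<bar> \<partial>lborel) = ennreal (l ^ ?n * favg x)"
    unfolding Q_def using l fg_integrable by (auto simp: nn_integral_cell_avg)
  have n1: "?n \<ge> 1" using zero_less_card_finite[where 'a='n] by linarith
  note pos = cell_avg_nonneg[of "\<lambda>y. norm (g y)" l x] cell_avg_nonneg[of "\<lambda>y. \<bar>f y\<bar>" l x]
  have "ennreal (l ^ ?n) \<le> emeasure lborel (Z \<union> {x. f x \<noteq> 0})"
    unfolding eQ[symmetric] Z_def by (intro emeasure_mono) auto
  also have "\<dots> \<le> emeasure lborel Z + emeasure lborel {x. f x \<noteq> 0}" by (intro emeasure_subadditive) auto
  also have "\<dots> \<le> emeasure lborel Z + ennreal (l ^ ?n / 2)" using S by (intro add_left_mono)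
  finally have "ennreal (l ^ ?n) \<le> emeasure lborel Z + ennreal (l ^ ?n / 2)" .
  moreover have "emeasure lborel Z \<le> ennreal (l ^ ?n)"
    unfolding eQ[symmetric] Z_def by (intro emeasure_mono) auto
  then obtain s where "emeasure lborel Z = ennreal s" "s \<ge> 0" by (cases "emeasure lborel Z") (auto simp: top_unique)
  ultimately have eZ: "ennreal (l ^ ?n / 2) \<le> emeasure lborel Z"
    using l by (auto simp flip: ennreal_plus simp: ennreal_le_iff)
  have "ennreal (l ^ ?n * favg x * (l ^ ?n / 2)) = ennreal (l ^ ?n * favg x) * ennreal (l ^ ?n / 2)"
    using l pos by (subst ennreal_mult) auto
  also have "\<dots> \<le> ennreal (l ^ ?n * favg x) * emeasure lborel Z"
    using eZ by (intro mult_left_mono) auto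
  also have "\<dots> = (\<integral>\<^sup>+y. indicator Q y * ennreal \<bar>f y\<bar> * (\<integral>\<^sup>+z. indicator Z z \<partial>lborel) \<partial>lborel)"
    by (subst nn_integral_multc) (simp_all add: iQ)
  also have "\<dots> = (\<integral>\<^sup>+y. \<integral>\<^sup>+z. indicator Q y * indicator Z z * ennreal \<bar>f y\<bar> \<partial>lborel \<partial>lborel)"
    by (intro nn_integral_cong, subst nn_integral_cmult[symmetric]) (auto intro!: nn_integral_cong simp: mult_ac)
  also have "\<dots> \<le> (\<integral>\<^sup>+y. \<integral>\<^sup>+z. indicator Q y * indicator Q z * ennreal \<bar>f z - f y\<bar> \<partial>lborel \<partial>lborel)"
    by (intro nn_integral_mono) (auto simp: indicator_def Z_def)
  also have "\<dots> \<le> ennreal (2 ^ ?n * (?n * l) * l ^ ?n * (l ^ ?n * gavg x))"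
    unfolding Q_def by (rule cell_oscillation_avg)
  finally have "l ^ ?n * favg x * (l ^ ?n / 2) \<le> 2 ^ ?n * (?n * l) * l ^ ?n * (l ^ ?n * gavg x)"
    using l pos by (subst (asm) ennreal_le_iff) auto
  then have "l ^ ?n * l ^ ?n * favg x \<le> l ^ ?n * l ^ ?n * (2 * 2 ^ ?n * ?n * l * gavg x)" by (simp add: field_simps)
  then have "favg x \<le> 2 * 2 ^ ?n * ?n * l * gavg x" using l by (subst (asm) mult_le_cancel_left_pos) auto
  also have "\<dots> \<le> 4 ^ ?n * ?n * l * gavg x"
  proof -
    have "(2::real) \<le> 2 ^ ?n" using power_increasing[OF n1, of "2::real"] by simp
    then have "2 * 2 ^ ?n \<le> (2::real) ^ ?n * 2 ^ ?n" by (intro mult_right_mono) auto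
    also have "\<dots> = 4 ^ ?n" by (simp flip: power_mult_distrib)
    finally show ?thesis using l pos by (intro mult_right_mono) auto
  qed
  finally show ?thesis .
qed

lemma abs_le_cell_avg:
  "ennreal (l ^ CARD('n) * \<bar>f x\<bar>) \<le> ennreal (l ^ CARD('n) * favg x) + (\<integral>\<^sup>+y. indicator (cell l (cell_index l x)) y * ennreal \<bar>f y - f x\<bar> \<partial>lborel)"
proof -
  let ?Q = "cell l (cell_index l x)"
  have "ennreal (l ^ CARD('n) * \<bar>f x\<bar>) = (\<integral>\<^sup>+y. indicator ?Q y * ennreal \<bar>f x\<bar> \<partial>lborel)"
    using l by (simp add: nn_integral_multc emeasure_cell ennreal_mult)
  also have "\<dots> \<le> (\<integral>\<^sup>+y. indicator ?Q y * ennreal \<bar>f y\<bar> + indicator ?Q y * ennreal \<bar>f y - f x\<bar> \<partial>lborel)"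
    by (intro nn_integral_mono) (auto simp: indicator_def simp flip: ennreal_plus intro!: ennreal_leI)
  also have "\<dots> = (\<integral>\<^sup>+y. indicator ?Q y * ennreal \<bar>f y\<bar> \<partial>lborel) + (\<integral>\<^sup>+y. indicator ?Q y * ennreal \<bar>f y - f x\<bar> \<partial>lborel)"
    by (rule nn_integral_add) measurable
  finally show ?thesis using l fg_integrable by (simp add: nn_integral_cell_avg)
qed

text \<open>Divided by l^n, the mean deviation of f from its value at the centre of attention x is
  of order l in L^1. This rate does the work of Lebesgue differentiation in
  \<open>faber_krahn\<close>.\<close>

lemma nn_integral_cell_deviation_le:
  "(\<integral>\<^sup>+x. \<integral>\<^sup>+y. indicator (cell l (cell_index l x)) y * ennreal \<bar>f y - f x\<bar> \<partial>lborel \<partial>lborel)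
    \<le> ennreal (2 ^ CARD('n) * (CARD('n) * l) * l ^ CARD('n) * (\<integral>x. norm (g x) \<partial>lborel))"
proof -
  have "(\<integral>\<^sup>+x. \<integral>\<^sup>+y. indicator (cell l (cell_index l x)) y * ennreal \<bar>f y - f x\<bar> \<partial>lborel \<partial>lborel)
    \<le> (\<integral>\<^sup>+x. ennreal (2 ^ CARD('n) * (CARD('n) * l) * l ^ CARD('n)) * ennreal (norm (g x)) \<partial>lborel)"
  proof (rule nn_integral_cells_mono[where l=l])
    fix z :: "int^'n"
    have "(\<integral>\<^sup>+x. indicator (cell l z) x * (\<integral>\<^sup>+y. indicator (cell l (cell_index l x)) y * ennreal \<bar>f y - f x\<bar> \<partial>lborel) \<partial>lborel)
      = (\<integral>\<^sup>+x. \<integral>\<^sup>+y. indicator (cell l z) x * indicator (cell l z) y * ennreal \<bar>f y - f x\<bar> \<partial>lborel \<partial>lborel)"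
      by (intro nn_integral_cong, subst nn_integral_cmult[symmetric]) (auto intro!: nn_integral_cong simp: indicator_def cell_def)
    also have "\<dots> \<le> ennreal (2 ^ CARD('n) * (CARD('n) * l) * l ^ CARD('n)) * (\<integral>\<^sup>+x. indicator (cell l z) x * ennreal (norm (g x)) \<partial>lborel)"
      by (rule cell_oscillation[OF W l])
    also have "\<dots> = (\<integral>\<^sup>+x. ennreal (2 ^ CARD('n) * (CARD('n) * l) * l ^ CARD('n)) * (indicator (cell l z) x * ennreal (norm (g x))) \<partial>lborel)"
      by (rule nn_integral_cmult[symmetric]) measurable
    finally show "(\<integral>\<^sup>+x. indicator (cell l z) x * (\<integral>\<^sup>+y. indicator (cell l (cell_index l x)) y * ennreal \<bar>f y - f x\<bar> \<partial>lborel) \<partial>lborel)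
      \<le> (\<integral>\<^sup>+x. indicator (cell l z) x * (ennreal (2 ^ CARD('n) * (CARD('n) * l) * l ^ CARD('n)) * ennreal (norm (g x))) \<partial>lborel)"
      by (simp add: mult_ac)
  qed measurable
  also have "\<dots> = ennreal (2 ^ CARD('n) * (CARD('n) * l) * l ^ CARD('n)) * ennreal (\<integral>x. norm (g x) \<partial>lborel)"
    using fg_integrable by (subst nn_integral_cmult) (auto simp: nn_integral_eq_integral)
  finally show ?thesis using l by (simp flip: ennreal_mult)
qed

end

declare fg_measurable [measurable del]

theorem faber_krahn:
  fixes f :: "real^'n \<Rightarrow> real" and \<rho> :: real
  assumes W: "W11 f g" and w: "cell_weight q K w" and q: "1 \<le> q" and \<rho>: "\<rho> > 0"
    and S: "emeasure lborel {x. f x \<noteq> 0} \<le> ennreal (\<rho> ^ CARD('n) / 2)"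
  shows "(\<integral>\<^sup>+x. w x * ennreal (\<bar>f x\<bar> powr q) \<partial>lborel)
    \<le> ennreal ((4 ^ (CARD('n) + 1) * CARD('n) * \<rho>) powr q) * K * (\<integral>\<^sup>+x. w x * ennreal (norm (g x) powr q) \<partial>lborel)"
proof -
  let ?n = "CARD('n)"
  have [measurable]: "f \<in> borel_measurable borel" "g \<in> borel_measurable borel" "w \<in> borel_measurable borel"
    using W w by (auto simp: W11_def cell_weight_def)
  have gi: "integrable lborel (\<lambda>x. norm (g x))" using W by (auto simp: W11_def)
  define l where "l j = \<rho> / 2 ^ j" for j :: nat
  have l: "l j > 0" for j using \<rho> by (simp add: l_def)
  define C where "C = 4 ^ ?n * real ?n"
  have C: "C \<ge> 0" by (simp add: C_def)
  define T where "T j = cell_avg (l j) (\<lambda>y. norm (g y))" for j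
  define M where "M j = cell_avg (l j) (\<lambda>y. \<bar>f y\<bar>)" for j
  have T0: "T j x \<ge> 0" for j x unfolding T_def using l by (intro cell_avg_nonneg) auto
  have M0: "M j x \<ge> 0" for j x unfolding M_def using l by (intro cell_avg_nonneg) auto
  have [measurable]: "T j \<in> borel_measurable borel" for j unfolding T_def by measurable
  \<comment> \<open>The side lengths \<rho> / 2^j of the telescoping sum supply geometric weights;
    normalised to 2^(-(j+1)) they have total mass below 1, so the power q passes inside.\<close>
  define V where "V k x = (\<Sum>j<k. T j x / 2 ^ (j + 1))" for k x
  have [measurable]: "V k \<in> borel_measurable borel" for k unfolding V_def by measurable
  have V0: "V k x \<ge> 0" for k x unfolding V_def using T0 by (intro sum_nonneg) auto
  \<comment> \<open>The 4 is a factor 2 for passing from weights 2^(-j) to 2^(-(j+1)), and a factor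
    2 because T 0 occurs twice, in the initial bound and in the first difference.\<close>
  define X where "X = 4 * C * \<rho>"
  have X: "X \<ge> 0" unfolding X_def using C \<rho> by simp
  have le0: "M k x \<le> C * \<rho> * (T 0 x + (\<Sum>j<k. T j x / 2 ^ j))" for k x
  proof (induction k)
    case 0
    have "l 0 = \<rho>" by (simp add: l_def)
    then show ?case using cell_avg_initial_le[OF W \<rho> S, of x] by (simp add: M_def T_def C_def mult_ac)
  next
    case (Suc k)
    have half: "l (Suc k) = l k / 2" by (simp add: l_def)
    have "M (Suc k) x \<le> M k x + C * l k * T k x"
      unfolding M_def T_def C_def half using cell_avg_half_le[OF W l[of k], of x] by (simp add: mult_ac)
    then show ?case using Suc by (simp add: l_def algebra_simps)
  qed
  \<comment> \<open>\<open>V (Suc k)\<close> rather than \<open>V k\<close>, so that the term T 0 of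
    the initial bound is covered also for k = 0.\<close>
  have le: "T 0 x + (\<Sum>j<k. T j x / 2 ^ j) \<le> 4 * V (Suc k) x" for k x
  proof -
    have "T 0 x / 2 ^ 0 \<le> (\<Sum>j<Suc k. T j x / 2 ^ j)"
      using T0 by (intro member_le_sum) auto
    moreover have "(\<Sum>j<k. T j x / 2 ^ j) \<le> (\<Sum>j<Suc k. T j x / 2 ^ j)" using T0 by simp
    moreover have "V (Suc k) x = (\<Sum>j<Suc k. T j x / 2 ^ j) / 2"
      unfolding V_def sum_divide_distrib by (intro sum.cong) auto
    ultimately show ?thesis by simp
  qed
  have MV: "M k x \<le> X * V (Suc k) x" for k x
  proof -
    have "C * \<rho> * (T 0 x + (\<Sum>j<k. T j x / 2 ^ j)) \<le> C * \<rho> * (4 * V (Suc k) x)"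
      using C \<rho> by (intro mult_left_mono le) auto
    then show ?thesis using le0[where k=k and x=x] unfolding X_def by (simp add: mult_ac)
  qed
  \<comment> \<open>The mean deviation of f from f x over the cell of x at scale j: the error made
    by replacing |f x| by the average M j x.\<close>
  define a where "a j x = ennreal (1 / l j ^ ?n) * (\<integral>\<^sup>+y. indicator (cell (l j) (cell_index (l j) x)) y * ennreal \<bar>f y - f x\<bar> \<partial>lborel)" for j x
  have [measurable]: "a j \<in> borel_measurable borel" for j unfolding a_def by measurable
  have fa: "ennreal \<bar>f x\<bar> \<le> ennreal (M j x) + a j x" for j x
  proof -
    have "ennreal (1 / l j ^ ?n) * ennreal (l j ^ ?n * \<bar>f x\<bar>) \<le> ennreal (1 / l j ^ ?n) * (ennreal (l j ^ ?n * M j x) +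
        (\<integral>\<^sup>+y. indicator (cell (l j) (cell_index (l j) x)) y * ennreal \<bar>f y - f x\<bar> \<partial>lborel))"
      unfolding M_def by (intro mult_left_mono abs_le_cell_avg[OF W l]) auto
    then show ?thesis unfolding a_def using l[of j] M0[of j x] by (simp add: distrib_left flip: ennreal_mult)
  qed
  \<comment> \<open>Each a k has integral of order 2^(-k), so the infimum vanishes a.e. An infimum
    is enough, because the bounds on the averages M j x enter through a supremum over all
    scales.\<close>
  have "(\<integral>\<^sup>+x. (INF j. a j x) \<partial>lborel) \<le> ennreal (2 ^ ?n * (?n * \<rho>) * (\<integral>x. norm (g x) \<partial>lborel) / 2 ^ k)" for k
  proof -
    have "(\<integral>\<^sup>+x. (INF j. a j x) \<partial>lborel) \<le> (\<integral>\<^sup>+x. a k x \<partial>lborel)" by (intro nn_integral_mono INF_lower) auto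
    also have "\<dots> \<le> ennreal (1 / l k ^ ?n) * ennreal (2 ^ ?n * (?n * l k) * l k ^ ?n * (\<integral>x. norm (g x) \<partial>lborel))"
      unfolding a_def by (subst nn_integral_cmult, measurable, intro mult_left_mono nn_integral_cell_deviation_le[OF W l]) auto
    also have "\<dots> = ennreal (2 ^ ?n * (?n * \<rho>) * (\<integral>x. norm (g x) \<partial>lborel) / 2 ^ k)"
    proof -
      have "l k ^ ?n \<noteq> 0" using l[of k] by simp
      then have "1 / l k ^ ?n * (2 ^ ?n * (?n * l k) * l k ^ ?n * (\<integral>x. norm (g x) \<partial>lborel)) = 2 ^ ?n * (?n * l k) * (\<integral>x. norm (g x) \<partial>lborel)"
        by simp
      also have "\<dots> = 2 ^ ?n * (?n * \<rho>) * (\<integral>x. norm (g x) \<partial>lborel) / 2 ^ k" by (simp add: l_def)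
      finally show ?thesis using l[of k] by (subst ennreal_mult[symmetric]) (auto simp: less_imp_le)
    qed
    finally show ?thesis .
  qed
  moreover have "(\<lambda>k. ennreal (2 ^ ?n * (?n * \<rho>) * (\<integral>x. norm (g x) \<partial>lborel) / 2 ^ k)) \<longlonglongrightarrow> ennreal 0"
    by (intro tendsto_ennrealI LIMSEQ_divide_realpow_zero) auto
  ultimately have "(\<integral>\<^sup>+x. (INF j. a j x) \<partial>lborel) \<le> ennreal 0"
    by (intro LIMSEQ_le_const) auto
  then have "(\<integral>\<^sup>+x. (INF j. a j x) \<partial>lborel) = 0" by simp
  then have ae: "AE x in lborel. (INF j. a j x) = 0" by (subst (asm) nn_integral_0_iff_AE) auto
  \<comment> \<open>V k x may diverge, so the comparison is made in [0, \<infinity>]. Where the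
    supremum is infinite nothing is claimed; elsewhere all averages M j x are bounded by the same
    number.\<close>
  have pw: "AE x in lborel. ennreal (\<bar>f x\<bar> powr q) \<le> (SUP k. ennreal ((X * V k x) powr q))"
    using ae
  proof eventually_elim
    case (elim x)
    show ?case
    proof (cases "(SUP k. ennreal ((X * V k x) powr q)) = \<infinity>")
      case False
      then obtain s where s: "(SUP k. ennreal ((X * V k x) powr q)) = ennreal s" "s \<ge> 0"
        by (cases "(SUP k. ennreal ((X * V k x) powr q))") auto
      have XV: "X * V k x \<le> s powr (1 / q)" for k
      proof -
        have "ennreal ((X * V k x) powr q) \<le> ennreal s" unfolding s(1)[symmetric] by (rule SUP_upper) simp
        then have "(X * V k x) powr q \<le> s" using s(2) by simp
        then have "((X * V k x) powr q) powr (1 / q) \<le> s powr (1 / q)" using q by (intro powr_mono2) auto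
        then show ?thesis using q X V0[of k x] by (simp add: powr_powr)
      qed
      have "ennreal \<bar>f x\<bar> \<le> ennreal (s powr (1 / q))"
      proof (rule ennreal_le_epsilon)
        fix e :: real assume "e > 0"
        then have "(INF j. a j x) < ennreal e" using elim by simp
        then obtain j where j: "a j x < ennreal e" by (auto simp: INF_less_iff)
        have "ennreal \<bar>f x\<bar> \<le> ennreal (M j x) + a j x" by (rule fa)
        also have "\<dots> \<le> ennreal (s powr (1 / q)) + ennreal e"
          using j MV[of j x] XV[of "Suc j"] by (intro add_mono ennreal_leI) auto
        finally show "ennreal \<bar>f x\<bar> \<le> ennreal (s powr (1 / q)) + ennreal e" .
      qed
      then have "\<bar>f x\<bar> \<le> s powr (1 / q)" by simp
      then have "\<bar>f x\<bar> powr q \<le> (s powr (1 / q)) powr q" using q by (intro powr_mono2) auto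
      also have "\<dots> = s" using q s(2) by (simp add: powr_powr)
      finally show ?thesis using s by (simp add: ennreal_leI)
    next
      case True
      show ?thesis unfolding True by simp
    qed
  qed
  define I where "I = (\<integral>\<^sup>+x. w x * ennreal (norm (g x) powr q) \<partial>lborel)"
  \<comment> \<open>The bound does not depend on the number k of scales, so monotone convergence
    finishes the proof.\<close>
  have k: "(\<integral>\<^sup>+x. w x * ennreal ((X * V k x) powr q) \<partial>lborel) \<le> ennreal (X powr q) * (K * I)" for k
  proof -
    define e where "e j = X powr q / 2 ^ (j + 1)" for j :: nat
    have e: "e j \<ge> 0" for j unfolding e_def by simp
    have "(\<integral>\<^sup>+x. w x * ennreal ((X * V k x) powr q) \<partial>lborel) \<le> (\<integral>\<^sup>+x. (\<Sum>j<k. ennreal (e j) * (w x * ennreal (T j x powr q))) \<partial>lborel)"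
    proof (rule nn_integral_mono)
      fix x
      have "(X * V k x) powr q = X powr q * V k x powr q" using X V0 by (simp add: powr_mult)
      also have "\<dots> \<le> X powr q * (\<Sum>j<k. T j x powr q / 2 ^ (j + 1))"
        unfolding V_def using T0 q by (intro mult_left_mono powr_geometric_average_le) auto
      also have "\<dots> = (\<Sum>j<k. e j * T j x powr q)" by (simp add: e_def sum_distrib_left)
      finally have "ennreal ((X * V k x) powr q) \<le> (\<Sum>j<k. ennreal (e j) * ennreal (T j x powr q))"
        using e by (simp add: ennreal_leI flip: ennreal_mult)
      from mult_left_mono[OF this, of "w x"]
      show "w x * ennreal ((X * V k x) powr q) \<le> (\<Sum>j<k. ennreal (e j) * (w x * ennreal (T j x powr q)))"
        by (simp add: sum_distrib_left mult.left_commute)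
    qed
    also have "\<dots> = (\<Sum>j<k. ennreal (e j) * (\<integral>\<^sup>+x. w x * ennreal (T j x powr q) \<partial>lborel))"
      by (subst nn_integral_sum) (auto simp: nn_integral_cmult)
    also have "\<dots> \<le> (\<Sum>j<k. ennreal (e j) * (K * I))"
      unfolding I_def T_def using l gi by (intro sum_mono mult_left_mono cell_weight_avg_le[OF w]) auto
    also have "\<dots> = ennreal (\<Sum>j<k. e j) * (K * I)" using e by (simp add: sum_distrib_right[symmetric] sum_ennreal)
    also have "\<dots> \<le> ennreal (X powr q) * (K * I)"
    proof -
      have "(\<Sum>j<k. (1 / 2) ^ j) \<le> (2::real)" by (subst geometric_sum) (auto simp: field_simps)
      then have "(\<Sum>j<k. 1 / 2 ^ (j + 1)) \<le> (1::real)"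
      proof -
        assume le: "(\<Sum>j<k. (1 / 2) ^ j) \<le> (2::real)"
        have "(\<Sum>j<k. 1 / 2 ^ (j + 1)) = (\<Sum>j<k. (1 / 2) ^ j) / (2::real)"
          unfolding sum_divide_distrib by (intro sum.cong) (auto simp: power_one_over)
        then show ?thesis using le by simp
      qed
      then have "X powr q * (\<Sum>j<k. 1 / 2 ^ (j + 1)) \<le> X powr q * 1" by (intro mult_left_mono) auto
      then have "(\<Sum>j<k. e j) \<le> X powr q" by (simp add: e_def sum_distrib_left)
      then show ?thesis by (intro mult_right_mono ennreal_leI) auto
    qed
    finally show ?thesis .
  qed
  have "(\<integral>\<^sup>+x. w x * ennreal (\<bar>f x\<bar> powr q) \<partial>lborel) \<le> (\<integral>\<^sup>+x. (SUP k. w x * ennreal ((X * V k x) powr q)) \<partial>lborel)"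
  proof (rule nn_integral_mono_AE)
    show "AE x in lborel. w x * ennreal (\<bar>f x\<bar> powr q) \<le> (SUP k. w x * ennreal ((X * V k x) powr q))"
      using pw by eventually_elim (simp add: mult_left_mono flip: SUP_mult_left_ennreal)
  qed
  also have "\<dots> = (SUP k. \<integral>\<^sup>+x. w x * ennreal ((X * V k x) powr q) \<partial>lborel)"
  proof (rule nn_integral_monotone_convergence_SUP)
    show "incseq (\<lambda>k x. w x * ennreal ((X * V k x) powr q))"
    proof (intro incseq_SucI le_funI mult_left_mono ennreal_leI powr_mono2)
      fix k x show "V k x \<le> V (Suc k) x" using T0[of k x] by (simp add: V_def)
    qed (use X V0 q in auto)
  qed measurable
  also have "\<dots> \<le> ennreal (X powr q) * (K * I)" by (intro SUP_least k)
  finally show ?thesis unfolding I_def X_def C_def by (simp add: mult.assoc)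
qed

section \<open>From the Muckenhoupt condition on balls to the condition on cells\<close>

text \<open>Optimising over \<mu> turns integrated pointwise Young inequalities into the Hoelder inequality.\<close>

lemma young_all_scales_imp_hoelder:
  fixes H I S \<gamma> :: real
  assumes \<gamma>: "\<gamma> > 1" and I: "I > 0" and S: "S > 0" and H: "H \<ge> 0"
    and young: "\<And>\<mu>. \<mu> > 0 \<Longrightarrow> H \<le> \<mu> powr \<gamma> / \<gamma> * I + \<mu> powr (- (\<gamma> / (\<gamma> - 1))) / (\<gamma> / (\<gamma> - 1)) * S"
  shows "H powr \<gamma> \<le> I * S powr (\<gamma> - 1)"
proof -
  \<comment> \<open>The value that balances the two terms: both \<mu>^\<gamma> I and
    \<mu>^(-\<gamma>/(\<gamma> - 1)) S become X, and the coefficients 1/\<gamma> and (\<gamma> -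
    1)/\<gamma> add up to 1.\<close>
  define \<mu> where "\<mu> = (S / I) powr ((\<gamma> - 1) / \<gamma>\<^sup>2)"
  define X where "X = S powr ((\<gamma> - 1) / \<gamma>) * I powr (1 / \<gamma>)"
  have e1: "(\<gamma> - 1) / \<gamma>\<^sup>2 * \<gamma> = (\<gamma> - 1) / \<gamma>" "(\<gamma> - 1) / \<gamma>\<^sup>2 * - (\<gamma> / (\<gamma> - 1)) = - (1 / \<gamma>)"
    using \<gamma> by (auto simp: power2_eq_square field_simps)
  have "\<mu> powr \<gamma> * I = (S / I) powr ((\<gamma> - 1) / \<gamma>) * I" unfolding \<mu>_def powr_powr e1 ..
  also have "\<dots> = S powr ((\<gamma> - 1) / \<gamma>) * (I powr 1 / I powr ((\<gamma> - 1) / \<gamma>))"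
    using S I by (simp add: powr_divide)
  also have "I powr 1 / I powr ((\<gamma> - 1) / \<gamma>) = I powr (1 / \<gamma>)"
    unfolding powr_diff[symmetric] using \<gamma> by (simp add: diff_divide_distrib)
  finally have 1: "\<mu> powr \<gamma> * I = X" unfolding X_def .
  have "\<mu> powr (- (\<gamma> / (\<gamma> - 1))) * S = (S / I) powr (- (1 / \<gamma>)) * S" unfolding \<mu>_def powr_powr e1 ..
  also have "\<dots> = (S powr 1 / S powr (1 / \<gamma>)) * I powr (1 / \<gamma>)"
  proof -
    have "(S / I) powr (- (1 / \<gamma>)) = S powr (- (1 / \<gamma>)) / I powr (- (1 / \<gamma>))" using S I by (intro powr_divide)
    then show ?thesis using S I by (simp only: powr_minus) (simp add: field_simps)
  qed
  also have "S powr 1 / S powr (1 / \<gamma>) = S powr ((\<gamma> - 1) / \<gamma>)"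
    unfolding powr_diff[symmetric] using \<gamma> by (simp add: diff_divide_distrib)
  finally have 2: "\<mu> powr (- (\<gamma> / (\<gamma> - 1))) * S = X" unfolding X_def .
  have "\<mu> > 0" unfolding \<mu>_def using S I by simp
  from young[OF this] have "H \<le> (\<mu> powr \<gamma> * I) / \<gamma> + (\<mu> powr (- (\<gamma> / (\<gamma> - 1))) * S) / (\<gamma> / (\<gamma> - 1))"
    by (simp add: mult_ac)
  also have "\<dots> = X" unfolding 1 2 using \<gamma> by (simp add: field_simps)
  finally have "H powr \<gamma> \<le> X powr \<gamma>" using H \<gamma> by (intro powr_mono2) auto
  also have "\<dots> = I * S powr (\<gamma> - 1)"
    unfolding X_def using S I \<gamma> by (simp add: powr_mult powr_powr)
  finally show ?thesis .
qed

text \<open>For I = 0 no optimal \<mu> exists. Enlarging I to I + d preserves the assumption, and d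
  is chosen so that the conclusion changes by exactly e.\<close>

lemma young_all_scales_imp_hoelder_nonneg:
  fixes H I S \<gamma> :: real
  assumes \<gamma>: "\<gamma> > 1" and I: "I \<ge> 0" and S: "S > 0" and H: "H \<ge> 0"
    and young: "\<And>\<mu>. \<mu> > 0 \<Longrightarrow> H \<le> \<mu> powr \<gamma> / \<gamma> * I + \<mu> powr (- (\<gamma> / (\<gamma> - 1))) / (\<gamma> / (\<gamma> - 1)) * S"
  shows "H powr \<gamma> \<le> I * S powr (\<gamma> - 1)"
proof (rule field_le_epsilon)
  fix e :: real assume e: "e > 0"
  define d where "d = e / S powr (\<gamma> - 1)"
  have d: "d > 0" unfolding d_def using e S by simp
  have "H powr \<gamma> \<le> (I + d) * S powr (\<gamma> - 1)"
  proof (rule young_all_scales_imp_hoelder[OF \<gamma> _ S H])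
    fix \<mu> :: real assume "\<mu> > 0"
    have "\<mu> powr \<gamma> / \<gamma> * I \<le> \<mu> powr \<gamma> / \<gamma> * (I + d)" using d \<gamma> by (intro mult_left_mono) auto
    then show "H \<le> \<mu> powr \<gamma> / \<gamma> * (I + d) + \<mu> powr (- (\<gamma> / (\<gamma> - 1))) / (\<gamma> / (\<gamma> - 1)) * S"
      using young[OF \<open>\<mu> > 0\<close>] by linarith
  qed (use I d in auto)
  then show "H powr \<gamma> \<le> I * S powr (\<gamma> - 1) + e" using S by (simp add: d_def distrib_right)
qed

text \<open>Young's inequality for the splitting of h into \<mu> h w^(1/\<gamma>) and \<mu>^(-1)
  w^(-1/\<gamma>), with conjugate exponents \<gamma> and \<gamma> / (\<gamma> - 1).\<close>

lemma young_weighted: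
  fixes h w \<mu> \<gamma> :: real
  assumes \<gamma>: "\<gamma> > 1" and w: "w > 0" and h: "h \<ge> 0" and \<mu>: "\<mu> > 0"
  shows "h \<le> \<mu> powr \<gamma> / \<gamma> * (w * h powr \<gamma>) + \<mu> powr (- (\<gamma> / (\<gamma> - 1))) / (\<gamma> / (\<gamma> - 1)) * (1 / w) powr (1 / (\<gamma> - 1))"
proof -
  define a where "a = \<mu> * h * w powr (1 / \<gamma>)"
  define b where "b = inverse \<mu> * (1 / w) powr (1 / \<gamma>)"
  have "h = a * b" unfolding a_def b_def using \<mu> w by (simp add: powr_divide)
  also have "\<dots> \<le> a powr \<gamma> / \<gamma> + b powr (\<gamma> / (\<gamma> - 1)) / (\<gamma> / (\<gamma> - 1))"
    by (rule Youngs_inequality) (use \<gamma> h \<mu> in \<open>auto simp: a_def b_def field_simps\<close>)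
  also have "a powr \<gamma> = \<mu> powr \<gamma> * (w * h powr \<gamma>)"
    unfolding a_def using \<mu> h w \<gamma> by (simp add: powr_mult powr_powr)
  also have "b powr (\<gamma> / (\<gamma> - 1)) = \<mu> powr (- (\<gamma> / (\<gamma> - 1))) * (1 / w) powr (1 / (\<gamma> - 1))"
    unfolding b_def using \<mu> w \<gamma> by (simp add: powr_mult powr_powr powr_minus inverse_powr)
  finally show ?thesis by (simp add: mult.commute mult.left_commute)
qed

lemma nn_integral_lebesgue_on_borel:
  fixes f :: "real^'n \<Rightarrow> ennreal"
  assumes [measurable]: "B \<in> sets borel" "f' \<in> borel_measurable borel" and ae: "AE x in lebesgue. f x = f' x"
  shows "(\<integral>\<^sup>+x. f x \<partial>lebesgue_on B) = (\<integral>\<^sup>+x. indicator B x * f' x \<partial>lborel)"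
proof -
  have "(\<integral>\<^sup>+x. f x \<partial>lebesgue_on B) = (\<integral>\<^sup>+x. f x * indicator B x \<partial>lebesgue)"
    by (rule nn_integral_restrict_space) simp
  also have "\<dots> = (\<integral>\<^sup>+x. indicator B x * f' x \<partial>lebesgue)"
    using ae by (intro nn_integral_cong_AE) (auto simp: mult.commute)
  finally show ?thesis by (simp add: nn_integral_completion)
qed

lemma ennreal_powr_ennreal: "x \<ge> 0 \<Longrightarrow> ennreal_powr (ennreal x) s = ennreal (x powr s)"
  by (simp add: ennreal_powr_def)

lemma ennreal_powr_measurable [measurable]: "(\<lambda>t. ennreal_powr t s) \<in> borel_measurable borel"
  unfolding ennreal_powr_def by measurable

text \<open>The cell of x lies in the ball of radius 2 n l around x, since its diameter is at most n
  l. Hoelder's inequality on the cell and the A_\<gamma> bound on the ball combine; the measure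
  ratio of ball and cell is independent of l and enters with power \<gamma>. With the summand 1 the
  factor stays nonzero even for the zero weight, so an infinite integral on the right settles the
  claim.\<close>

theorem muckenhoupt_cell_weight:
  fixes \<omega> :: "real^'n \<Rightarrow> real" and \<gamma> :: real
  assumes \<gamma>: "\<gamma> > 1" and \<omega>: "\<omega> \<in> muckenhoupt_class \<gamma>"
  obtains w where "cell_weight \<gamma> (ennreal ((unit_ball_vol CARD('n) * (2 * CARD('n)) ^ CARD('n)) powr \<gamma>) * (muckenhoupt_const \<gamma> \<omega> + 1)) w"
    "AE x in lebesgue. ennreal (\<omega> x) = w x"
proof -
  let ?n = "CARD('n)"
  define \<beta> where "\<beta> = unit_ball_vol ?n * (2 * ?n) ^ ?n"
  define A where "A = muckenhoupt_const \<gamma> \<omega>"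
  have \<beta>: "\<beta> > 0" unfolding \<beta>_def by simp
  have \<omega>0: "\<And>x. \<omega> x \<ge> 0" and Afin: "A < \<infinity>" and loc: "locally_integrable UNIV \<omega>"
    using \<omega> by (auto simp: muckenhoupt_class_def A_def)
  have \<omega>m: "\<omega> \<in> borel_measurable lebesgue"
  proof (rule borel_measurable_LIMSEQ_real)
    show "(\<lambda>x. indicator (cball 0 (real i)) x *\<^sub>R \<omega> x) \<in> borel_measurable lebesgue" for i
      by (rule borel_measurable_integrable[OF locally_integrable_imp_integrable_indicator[OF loc]]) auto
    fix x :: "real^'n"
    obtain i0 where i0: "norm x \<le> real i0" using real_arch_simple by blast
    have "\<forall>\<^sub>F i in sequentially. indicator (cball 0 (real i)) x *\<^sub>R \<omega> x = \<omega> x"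
      using eventually_ge_at_top[of i0]
    proof eventually_elim
      case (elim i)
      then have "norm x \<le> real i" using i0 by linarith
      then show ?case by simp
    qed
    then show "(\<lambda>i. indicator (cball 0 (real i)) x *\<^sub>R \<omega> x) \<longlonglongrightarrow> \<omega> x" by (rule tendsto_eventually)
  qed
  then obtain w' where w'[measurable]: "w' \<in> borel_measurable lborel" and "AE x in lborel. \<omega> x = w' x"
    using completion_ex_borel_measurable_real by blast
  then have ae: "AE x in lebesgue. \<omega> x = w' x" by (simp add: AE_completion)
  have [measurable]: "w' \<in> borel_measurable borel" using w' by simp
  define w where "w x = ennreal (w' x)" for x
  have [measurable]: "w \<in> borel_measurable borel" unfolding w_def by measurable
  have aew: "AE x in lebesgue. ennreal (\<omega> x) = w x" using ae by eventually_elim (simp add: w_def)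
  define \<sigma> where "\<sigma> x = ennreal_powr (inverse (w x)) (1 / (\<gamma> - 1))" for x
  have [measurable]: "\<sigma> \<in> borel_measurable borel" unfolding \<sigma>_def by measurable
  have ae\<sigma>: "AE x in lebesgue. ennreal_powr (inverse (ennreal (\<omega> x))) (1 / (\<gamma> - 1)) = \<sigma> x"
    using ae by eventually_elim (simp add: w_def \<sigma>_def)
  have \<sigma>_top: "\<sigma> x = \<infinity> \<longleftrightarrow> w' x \<le> 0" for x
  proof (cases "w' x \<le> 0")
    case True
    then show ?thesis by (simp add: \<sigma>_def w_def ennreal_powr_def ennreal_neg)
  next
    case False
    then show ?thesis by (simp add: \<sigma>_def w_def ennreal_powr_def inverse_ennreal)
  qed
  have \<sigma>_eq: "\<sigma> x = ennreal ((1 / w' x) powr (1 / (\<gamma> - 1)))" if "w' x > 0" for x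
    using that by (simp add: \<sigma>_def w_def inverse_ennreal ennreal_powr_ennreal inverse_eq_divide)
  have main: "(\<integral>\<^sup>+y. indicator (cell l (cell_index l x)) y * w y \<partial>lborel) * ennreal (cell_avg l h x powr \<gamma>)
      \<le> ennreal (\<beta> powr \<gamma>) * (A + 1) * (\<integral>\<^sup>+y. indicator (cell l (cell_index l x)) y * (w y * ennreal (h y powr \<gamma>)) \<partial>lborel)"
    if l: "l > 0" and [measurable]: "h \<in> borel_measurable borel" and h: "\<And>y. h y \<ge> 0" and hi: "integrable lborel h" for l x and h :: "real^'n \<Rightarrow> real"
  proof -
    define Q where "Q = cell l (cell_index l x)"
    define R where "R = 2 * ?n * l"
    define B where "B = ball x R"
    have [measurable]: "Q \<in> sets borel" "B \<in> sets borel" unfolding Q_def B_def by auto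
    have n1: "?n \<ge> 1" using zero_less_card_finite[where 'a='n] by linarith
    then have R: "R > ?n * l" "R > 0" unfolding R_def using l by auto
    have QB: "Q \<subseteq> B"
    proof
      fix y assume "y \<in> Q"
      then have "norm (x - y) \<le> ?n * l" unfolding Q_def by (intro cell_diameter[OF l]) auto
      then show "y \<in> B" using R unfolding B_def by (simp add: dist_norm)
    qed
    define b where "b = \<beta> * l ^ ?n"
    have b: "b > 0" unfolding b_def using \<beta> l by simp
    have "measure lborel B = b"
      unfolding B_def b_def \<beta>_def R_def using l by (subst content_ball) (auto simp: power_mult_distrib)
    moreover have "emeasure lebesgue B = ennreal (measure lebesgue B)"
      using lmeasurable_ball[of x R] unfolding B_def by (intro emeasure_eq_measure2) auto
    moreover have "measure lebesgue B = measure lborel B" by (rule measure_completion) simp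
    ultimately have eB: "emeasure lebesgue B = ennreal b" by simp
    define a where "a = (\<integral>\<^sup>+y. indicator B y * w y \<partial>lborel)"
    define s where "s = (\<integral>\<^sup>+y. indicator B y * \<sigma> y \<partial>lborel)"
    define I where "I = (\<integral>\<^sup>+y. indicator Q y * (w y * ennreal (h y powr \<gamma>)) \<partial>lborel)"
    have n1: "nn_avg B (\<lambda>x. ennreal (\<omega> x)) = a / ennreal b"
      unfolding nn_avg_def a_def eB by (subst nn_integral_lebesgue_on_borel[OF _ _ aew]) auto
    have n2: "nn_avg B (\<lambda>x. ennreal_powr (inverse (ennreal (\<omega> x))) (1 / (\<gamma> - 1))) = s / ennreal b"
      unfolding nn_avg_def s_def eB by (subst nn_integral_lebesgue_on_borel[OF _ _ ae\<sigma>]) auto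
    have muck: "a / ennreal b * ennreal_powr (s / ennreal b) (\<gamma> - 1) \<le> A"
      unfolding n1[symmetric] n2[symmetric] A_def muckenhoupt_const_def B_def
      using R by (intro SUP_upper2[of "(x, R)"]) auto
    have Qa: "(\<integral>\<^sup>+y. indicator Q y * w y \<partial>lborel) \<le> a"
      unfolding a_def using QB by (intro nn_integral_mono) (auto simp: indicator_def)
    show ?thesis
    proof (cases "a = 0 \<or> I = \<infinity>")
      case True
      then show ?thesis
      proof
        assume "a = 0"
        then show ?thesis using Qa unfolding Q_def by simp
      next
        assume "I = \<infinity>"
        then have "ennreal (\<beta> powr \<gamma>) * (A + 1) * I = \<infinity>"
          using \<beta> by (simp add: ennreal_mult_eq_top_iff)
        then show ?thesis unfolding I_def Q_def by simp
      qed
    next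
      case False
      have "a < \<infinity>"
      proof -
        have "integrable lebesgue (\<lambda>y. indicator (cball x R) y *\<^sub>R \<omega> y)" by (rule locally_integrable_imp_integrable_indicator[OF loc]) auto
        then have fin: "(\<integral>\<^sup>+y. ennreal (norm (indicator (cball x R) y *\<^sub>R \<omega> y)) \<partial>lebesgue) < \<infinity>"
          by (simp add: integrable_iff_bounded)
        have "a = (\<integral>\<^sup>+x. ennreal (\<omega> x) \<partial>lebesgue_on B)"
          unfolding a_def by (subst nn_integral_lebesgue_on_borel[OF _ _ aew]) auto
        also have "\<dots> = (\<integral>\<^sup>+x. ennreal (\<omega> x) * indicator B x \<partial>lebesgue)" by (rule nn_integral_restrict_space) simp
        also have "\<dots> \<le> (\<integral>\<^sup>+y. ennreal (norm (indicator (cball x R) y *\<^sub>R \<omega> y)) \<partial>lebesgue)"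
          using \<omega>0 by (intro nn_integral_mono) (auto simp: indicator_def B_def)
        finally show ?thesis using fin by (rule le_less_trans)
      qed
      then obtain a' where a': "a = ennreal a'" "a' \<ge> 0" by (cases a) auto
      have a'0: "a' > 0" using False a' by (cases "a' = 0") auto
      \<comment> \<open>The first average is positive and the product of the two is at most A, so
        the second average cannot be infinite.\<close>
      have "s < \<infinity>"
      proof (rule ccontr)
        assume "\<not> s < \<infinity>"
        then have "s = \<infinity>" by (simp add: not_less top_unique)
        then have "s / ennreal b = \<infinity>" using b by (simp add: ennreal_top_divide)
        then have "a / ennreal b * ennreal_powr (s / ennreal b) (\<gamma> - 1) = \<infinity>"
          using a'0 b by (simp add: ennreal_powr_def a' divide_ennreal ennreal_mult_eq_top_iff)
        then show False using muck Afin by (simp add: top_unique)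
      qed
      then obtain s' where s': "s = ennreal s'" "s' \<ge> 0" by (cases s) auto
      \<comment> \<open>\<sigma> is \<infinity> exactly where the weight vanishes, so finiteness of
        s makes the weight positive a.e. on the cell. This permits the division by w in Young's
        inequality.\<close>
      have wpos: "AE y in lborel. y \<in> Q \<longrightarrow> w' y > 0"
      proof -
        have "AE y in lborel. indicator B y * \<sigma> y \<noteq> \<infinity>"
          using \<open>s < \<infinity>\<close> unfolding s_def by (intro nn_integral_PInf_AE) auto
        then show ?thesis
        proof eventually_elim
          case (elim y)
          then show ?case using QB \<sigma>_top[of y] by (auto simp: indicator_def split: if_splits)
        qed
      qed
      have s'0: "s' > 0"
      proof (rule ccontr)
        assume "\<not> s' > 0"
        then have "(\<integral>\<^sup>+y. indicator B y * \<sigma> y \<partial>lborel) = 0" using s' unfolding s_def by simp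
        then have "AE y in lborel. indicator B y * \<sigma> y = 0" by (subst (asm) nn_integral_0_iff_AE) auto
        then have "AE y in lborel. y \<notin> Q"
          using wpos
        proof eventually_elim
          case (elim y)
          then show ?case using QB \<sigma>_eq[of y] by (auto simp: indicator_def)
        qed
        then have "emeasure lborel Q = 0" by (subst (asm) AE_iff_measurable[OF _ refl]) auto
        then show False unfolding Q_def using l by (simp add: emeasure_cell)
      qed
      obtain I' where I': "I = ennreal I'" "I' \<ge> 0" using False by (cases I) auto
      obtain A' where A': "A = ennreal A'" "A' \<ge> 0" using Afin by (cases A) auto
      define H where "H = l ^ ?n * cell_avg l h x"
      have H0: "H \<ge> 0" unfolding H_def using l h by (simp add: cell_avg_nonneg)
      have Hn: "(\<integral>\<^sup>+y. indicator Q y * ennreal (h y) \<partial>lborel) = ennreal H"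
        unfolding Q_def H_def by (rule nn_integral_cell_avg[OF hi h l])
      have "H powr \<gamma> \<le> I' * s' powr (\<gamma> - 1)"
      proof (rule young_all_scales_imp_hoelder_nonneg[OF \<gamma> I'(2) s'0 H0])
        fix \<mu> :: real assume \<mu>: "\<mu> > 0"
        define c where "c = \<mu> powr \<gamma> / \<gamma>"
        define d where "d = \<mu> powr (- (\<gamma> / (\<gamma> - 1))) / (\<gamma> / (\<gamma> - 1))"
        have cd: "c \<ge> 0" "d \<ge> 0" using \<gamma> by (auto simp: c_def d_def)
        have "ennreal H \<le> (\<integral>\<^sup>+y. ennreal c * (indicator Q y * (w y * ennreal (h y powr \<gamma>))) + ennreal d * (indicator B y * \<sigma> y) \<partial>lborel)"
          unfolding Hn[symmetric]
        proof (rule nn_integral_mono_AE)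
          show "AE y in lborel. indicator Q y * ennreal (h y) \<le> ennreal c * (indicator Q y * (w y * ennreal (h y powr \<gamma>))) + ennreal d * (indicator B y * \<sigma> y)"
            using wpos
          proof eventually_elim
            case (elim y)
            show ?case
            proof (cases "y \<in> Q")
              case True
              then have wy: "w' y > 0" and "y \<in> B" using elim QB by auto
              have "ennreal (h y) \<le> ennreal (c * (w' y * h y powr \<gamma>) + d * (1 / w' y) powr (1 / (\<gamma> - 1)))"
                unfolding c_def d_def by (intro ennreal_leI young_weighted \<gamma> wy h \<mu>)
              also have "\<dots> = ennreal c * (w y * ennreal (h y powr \<gamma>)) + ennreal d * \<sigma> y"
                using cd wy \<sigma>_eq[OF wy] by (simp add: w_def ennreal_mult)
              finally show ?thesis using True \<open>y \<in> B\<close> by simp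
            qed simp
          qed
        qed
        also have "\<dots> = ennreal c * I + ennreal d * s"
          unfolding I_def s_def by (subst nn_integral_add) (auto simp: nn_integral_cmult)
        also have "\<dots> = ennreal (c * I' + d * s')" using cd I' s' by (simp add: ennreal_mult)
        finally show "H \<le> \<mu> powr \<gamma> / \<gamma> * I' + \<mu> powr (- (\<gamma> / (\<gamma> - 1))) / (\<gamma> / (\<gamma> - 1)) * s'"
          unfolding c_def[symmetric] d_def[symmetric] using cd I' s' by (subst (asm) ennreal_le_iff) auto
      qed
      have "ennreal (a' / b * (s' / b) powr (\<gamma> - 1)) = a / ennreal b * ennreal_powr (s / ennreal b) (\<gamma> - 1)"
        using a' s' b by (subst ennreal_mult) (simp_all add: divide_ennreal ennreal_powr_ennreal)
      also have "\<dots> \<le> ennreal A'" using muck A' by simp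
      finally have "a' / b * (s' / b) powr (\<gamma> - 1) \<le> A'" using ennreal_le_iff[OF A'(2)] by blast
      then have "a' * s' powr (\<gamma> - 1) \<le> A' * (b * b powr (\<gamma> - 1))"
        using b s' by (simp add: powr_divide field_simps)
      also have "b * b powr (\<gamma> - 1) = b powr \<gamma>" using b by (simp add: powr_diff)
      finally have as: "a' * s' powr (\<gamma> - 1) \<le> A' * b powr \<gamma>" .
      have "a' * H powr \<gamma> \<le> a' * (I' * s' powr (\<gamma> - 1))" using \<open>H powr \<gamma> \<le> _\<close> a' by (intro mult_left_mono) auto
      also have "\<dots> \<le> (A' * b powr \<gamma>) * I'" using mult_right_mono[OF as I'(2)] by (simp add: mult_ac)
      finally have "a' * (H powr \<gamma> / (l ^ ?n) powr \<gamma>) \<le> A' * (b powr \<gamma> / (l ^ ?n) powr \<gamma>) * I'"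
        using l by (simp add: field_simps)
      moreover have "b powr \<gamma> / (l ^ ?n) powr \<gamma> = \<beta> powr \<gamma>" unfolding b_def using \<beta> l by (simp add: powr_mult)
      moreover have "H powr \<gamma> / (l ^ ?n) powr \<gamma> = cell_avg l h x powr \<gamma>"
        unfolding H_def using l h by (simp add: powr_mult cell_avg_nonneg)
      ultimately have fin: "a' * cell_avg l h x powr \<gamma> \<le> A' * \<beta> powr \<gamma> * I'" by simp
      have "(\<integral>\<^sup>+y. indicator Q y * w y \<partial>lborel) * ennreal (cell_avg l h x powr \<gamma>) \<le> a * ennreal (cell_avg l h x powr \<gamma>)"
        using Qa by (intro mult_right_mono) auto
      also have "\<dots> = ennreal (a' * cell_avg l h x powr \<gamma>)" using a' by (simp add: ennreal_mult)
      also have "\<dots> \<le> ennreal (A' * \<beta> powr \<gamma> * I')" by (rule ennreal_leI[OF fin])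
      also have "\<dots> = ennreal (\<beta> powr \<gamma>) * A * I" using A' I' by (simp add: ennreal_mult mult_ac)
      also have "\<dots> \<le> ennreal (\<beta> powr \<gamma>) * (A + 1) * I" by (intro mult_right_mono mult_left_mono) auto
      finally show ?thesis unfolding Q_def I_def .
    qed
  qed
  then have "cell_weight \<gamma> (ennreal (\<beta> powr \<gamma>) * (A + 1)) w" unfolding cell_weight_def by auto
  then show ?thesis using that aew unfolding \<beta>_def A_def by blast
qed

section \<open>The multi-phase integrand\<close>

text \<open>Only the range of exponents between p and Q enters the structural estimates; Q is
  instantiated with \<open>q N\<close>. Of the Muckenhoupt condition, the locale keeps sign and
  local integrability.\<close>

locale multiphase_integrand =
  fixes N :: nat and p Q :: real and q :: "nat \<Rightarrow> real" and a :: "nat \<Rightarrow> real^'n \<Rightarrow> real"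
  assumes p: "1 < p" and pQ: "p \<le> Q" and q: "\<And>i. i \<in> {1..N} \<Longrightarrow> p \<le> q i \<and> q i \<le> Q"
    and a_nonneg: "\<And>i x. i \<in> {1..N} \<Longrightarrow> a i x \<ge> 0"
    and a_loc: "\<And>i. i \<in> {1..N} \<Longrightarrow> locally_integrable UNIV (a i)"
begin

abbreviation H :: "real^'n \<Rightarrow> real \<Rightarrow> real" where "H \<equiv> multiphase N p q a"

text \<open>\<open>H x\<close> is a combination of powers t^e, p <= e <= Q, with nonnegative
  coefficients 1 and a_i(x). A linear inequality that holds for each such power therefore holds for
  \<open>H x\<close>. All growth properties below are instances.\<close>

lemma H_transfer:
  assumes "\<And>e. p \<le> e \<Longrightarrow> e \<le> Q \<Longrightarrow> \<alpha> * s powr e \<le> \<beta> * t powr e + \<delta> * r powr e"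
  shows "\<alpha> * H x s \<le> \<beta> * H x t + \<delta> * H x r"
proof -
  have "(\<Sum>i=1..N. a i x * (\<alpha> * s powr q i)) \<le> (\<Sum>i=1..N. a i x * (\<beta> * t powr q i + \<delta> * r powr q i))"
    using assms q a_nonneg by (intro sum_mono mult_left_mono) auto
  then have "\<alpha> * (\<Sum>i=1..N. a i x * s powr q i) \<le> \<beta> * (\<Sum>i=1..N. a i x * t powr q i) + \<delta> * (\<Sum>i=1..N. a i x * r powr q i)"
    by (simp add: sum_distrib_left sum.distrib algebra_simps)
  moreover have "\<alpha> * s powr p \<le> \<beta> * t powr p + \<delta> * r powr p" using assms[of p] pQ by simp
  ultimately show ?thesis unfolding multiphase_def by (simp add: algebra_simps)
qed

lemma H_mono: "0 \<le> s \<Longrightarrow> s \<le> t \<Longrightarrow> H x s \<le> H x t"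
  using H_transfer[of 1 s 1 t 0 0 x] p by (simp add: powr_mono2)

lemma H_0 [simp]: "H x 0 = 0"
  by (simp add: multiphase_def)

lemma H_nonneg [simp]: "0 \<le> H x t"
  unfolding multiphase_def using a_nonneg by (intro add_nonneg_nonneg sum_nonneg mult_nonneg_nonneg) auto

lemma H_ge_powr: "t powr p \<le> H x t"
  unfolding multiphase_def using a_nonneg by (auto intro!: sum_nonneg mult_nonneg_nonneg)

lemma H_scale: "1 \<le> c \<Longrightarrow> 0 \<le> t \<Longrightarrow> H x (c * t) \<le> c powr Q * H x t"
  using H_transfer[of 1 "c * t" "c powr Q" t 0 0 x] p by (simp add: powr_mult mult_right_mono powr_mono)

text \<open>For c <= 1 the largest exponent Q makes c^e smallest. This is the bound that fixes the
  exponent 1 - 1/Q in the condition on cutoffs.\<close>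

lemma H_shrink:
  assumes "0 \<le> c" "c \<le> 1" "0 \<le> t" shows "c powr Q * H x t \<le> H x (c * t)"
proof -
  have "c powr Q * t powr e \<le> (c * t) powr e" if "p \<le> e" "e \<le> Q" for e
    using assms that p powr_mono'[of e Q c] by (cases "c = 0") (auto simp: powr_mult intro!: mult_right_mono)
  then show ?thesis using H_transfer[of "c powr Q" t 1 "c * t" 0 0 x] by simp
qed

lemma H_convex:
  "0 \<le> s \<Longrightarrow> 0 \<le> t \<Longrightarrow> 0 \<le> c \<Longrightarrow> c \<le> 1 \<Longrightarrow> H x ((1 - c) * s + c * t) \<le> (1 - c) * H x s + c * H x t"
  using H_transfer[of 1 "(1 - c) * s + c * t" "1 - c" s c t x] p powr_convex_nonneg[of s t c] by simp

lemma H_le_linear: "0 \<le> t \<Longrightarrow> 0 \<le> c \<Longrightarrow> c \<le> 1 \<Longrightarrow> H x (c * t) \<le> c * H x t"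
  using H_convex[of 0 t c x] by simp

lemma H_add:
  assumes "0 \<le> s" "0 \<le> t" shows "H x (s + t) \<le> 2 powr Q * (H x s + H x t)"
proof -
  have "H x (s + t) \<le> H x (2 * max s t)" using assms by (intro H_mono) auto
  also have "\<dots> \<le> 2 powr Q * H x (max s t)" using assms by (intro H_scale) auto
  also have "\<dots> \<le> 2 powr Q * (H x s + H x t)" by (intro mult_left_mono) (auto simp: max_def)
  finally show ?thesis .
qed

lemma a_measurable: "i \<in> {1..N} \<Longrightarrow> a i \<in> borel_measurable lebesgue"
proof (rule borel_measurable_LIMSEQ_real)
  assume i: "i \<in> {1..N}"
  show "(\<lambda>x. indicator (cball 0 (real j)) x *\<^sub>R a i x) \<in> borel_measurable lebesgue" for j
    by (rule borel_measurable_integrable[OF locally_integrable_imp_integrable_indicator[OF a_loc[OF i]]]) auto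
  fix x :: "real^'n"
  obtain j0 where j0: "norm x \<le> real j0" using real_arch_simple by blast
  have "\<forall>\<^sub>F j in sequentially. indicator (cball 0 (real j)) x *\<^sub>R a i x = a i x"
    using eventually_ge_at_top[of j0]
  proof eventually_elim
    case (elim j)
    then have "norm x \<le> real j" using j0 by linarith
    then show ?case by simp
  qed
  then show "(\<lambda>j. indicator (cball 0 (real j)) x *\<^sub>R a i x) \<longlonglongrightarrow> a i x" by (rule tendsto_eventually)
qed

lemma H_measurable:
  assumes "f \<in> borel_measurable (lebesgue_on S)"
  shows "(\<lambda>x. H x (f x)) \<in> borel_measurable (lebesgue_on S)"
proof -
  have "a i \<in> borel_measurable (lebesgue_on S)" if "i \<in> {1..N}" for i
    using a_measurable[OF that] by (rule measurable_restrict_space1)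
  moreover have "(\<lambda>x. f x powr e) \<in> borel_measurable (lebesgue_on S)" for e
    using assms by measurable
  ultimately show ?thesis unfolding multiphase_def
    by (intro borel_measurable_add borel_measurable_sum borel_measurable_times)
qed

text \<open>The doubling properties \<open>H_scale\<close> and \<open>H_add\<close> turn a pointwise
  linear bound into a bound of modulars.\<close>

lemma modular_class_bound:
  assumes f: "f \<in> modular_class H S" and g: "g \<in> modular_class H S"
    and h: "h \<in> borel_measurable (lebesgue_on S)" and S: "S \<in> sets lebesgue"
    and le: "\<And>x. x \<in> S \<Longrightarrow> \<bar>h x\<bar> \<le> c * (\<bar>f x\<bar> + \<bar>g x\<bar>)" and c: "1 \<le> c"
  shows "h \<in> modular_class H S"
proof -
  have [measurable]: "f \<in> borel_measurable (lebesgue_on S)" "g \<in> borel_measurable (lebesgue_on S)"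
    using f g by (auto simp: modular_class_def)
  let ?C = "c powr Q * 2 powr Q"
  have "(\<integral>\<^sup>+x. ennreal (H x \<bar>h x\<bar>) \<partial>lebesgue_on S) \<le> (\<integral>\<^sup>+x. ennreal ?C * (ennreal (H x \<bar>f x\<bar>) + ennreal (H x \<bar>g x\<bar>)) \<partial>lebesgue_on S)"
  proof (rule nn_integral_mono)
    fix x assume "x \<in> space (lebesgue_on S)"
    then have x: "x \<in> S" by simp
    have "H x \<bar>h x\<bar> \<le> H x (c * (\<bar>f x\<bar> + \<bar>g x\<bar>))" using le[OF x] by (intro H_mono) auto
    also have "\<dots> \<le> c powr Q * H x (\<bar>f x\<bar> + \<bar>g x\<bar>)" using c by (intro H_scale) auto
    also have "\<dots> \<le> c powr Q * (2 powr Q * (H x \<bar>f x\<bar> + H x \<bar>g x\<bar>))" by (intro mult_left_mono H_add) auto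
    finally have "ennreal (H x \<bar>h x\<bar>) \<le> ennreal (?C * (H x \<bar>f x\<bar> + H x \<bar>g x\<bar>))" by (simp add: ennreal_leI mult.assoc)
    then show "ennreal (H x \<bar>h x\<bar>) \<le> ennreal ?C * (ennreal (H x \<bar>f x\<bar>) + ennreal (H x \<bar>g x\<bar>))"
      by (simp add: ennreal_mult)
  qed
  also have "\<dots> = ennreal ?C * ((\<integral>\<^sup>+x. ennreal (H x \<bar>f x\<bar>) \<partial>lebesgue_on S) + (\<integral>\<^sup>+x. ennreal (H x \<bar>g x\<bar>) \<partial>lebesgue_on S))"
    using H_measurable[of "\<lambda>x. \<bar>f x\<bar>" S] H_measurable[of "\<lambda>x. \<bar>g x\<bar>" S]
    by (subst nn_integral_cmult) (auto simp: nn_integral_add)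
  also have "\<dots> < \<infinity>" using f g by (auto simp: modular_class_def ennreal_mult_less_top)
  finally show ?thesis using h by (simp add: modular_class_def)
qed

text \<open>Boundedness of S gives a compact closure, on which the coefficients are integrable.
  Constants enter through the mean m and through the levels of truncation.\<close>

lemma modular_class_const:
  assumes "bounded S" and S: "S \<in> sets lebesgue"
  shows "(\<lambda>x. k) \<in> modular_class H S"
proof -
  have cS: "compact (closure S)" using assms by simp
  have fin: "(\<integral>\<^sup>+x. ennreal c \<partial>lebesgue_on S) < \<infinity>" for c
  proof -
    have "emeasure lebesgue S < \<infinity>" using bounded_set_imp_lmeasurable[OF assms] unfolding fmeasurable_def by blast
    moreover have "(\<integral>\<^sup>+x. ennreal c \<partial>lebesgue_on S) = ennreal c * emeasure lebesgue S"
      using S by (subst nn_integral_const, subst emeasure_restrict_space) simp_all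
    ultimately show ?thesis by (simp add: ennreal_mult_less_top del: emeasure_completion)
  qed
  have fa: "(\<integral>\<^sup>+x. ennreal (a i x * c) \<partial>lebesgue_on S) < \<infinity>" if i: "i \<in> {1..N}" and "c \<ge> 0" for i c
  proof -
    have int: "integrable lebesgue (\<lambda>x. indicator (closure S) x *\<^sub>R a i x)"
      by (rule locally_integrable_imp_integrable_indicator[OF a_loc[OF i] cS]) simp
    have "(\<integral>\<^sup>+x. ennreal (a i x * c) \<partial>lebesgue_on S) = (\<integral>\<^sup>+x. ennreal (a i x * c) * indicator S x \<partial>lebesgue)"
      using S by (intro nn_integral_restrict_space) simp
    also have "\<dots> \<le> (\<integral>\<^sup>+x. ennreal (norm (c * (indicator (closure S) x *\<^sub>R a i x))) \<partial>lebesgue)"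
      using closure_subset[of S] that a_nonneg[OF i] by (intro nn_integral_mono) (auto simp: indicator_def abs_mult mult.commute)
    also have "\<dots> < \<infinity>" using integrable_mult_right[OF int, of c] by (simp only: integrable_iff_bounded)
    finally show ?thesis .
  qed
  have am: "a i \<in> borel_measurable (lebesgue_on S)" if "i \<in> {1..N}" for i
    using a_measurable[OF that] by (rule measurable_restrict_space1)
  have "(\<integral>\<^sup>+x. ennreal (H x \<bar>k\<bar>) \<partial>lebesgue_on S) = (\<integral>\<^sup>+x. ennreal (\<bar>k\<bar> powr p) + (\<Sum>i=1..N. ennreal (a i x * \<bar>k\<bar> powr q i)) \<partial>lebesgue_on S)"
  proof (rule nn_integral_cong)
    fix x
    have "(\<Sum>i=1..N. a i x * \<bar>k\<bar> powr q i) \<ge> 0" using a_nonneg by (intro sum_nonneg) auto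
    then show "ennreal (H x \<bar>k\<bar>) = ennreal (\<bar>k\<bar> powr p) + (\<Sum>i=1..N. ennreal (a i x * \<bar>k\<bar> powr q i))"
      unfolding multiphase_def using a_nonneg by (subst sum_ennreal) auto
  qed
  also have "\<dots> = (\<integral>\<^sup>+x. ennreal (\<bar>k\<bar> powr p) \<partial>lebesgue_on S) + (\<Sum>i=1..N. \<integral>\<^sup>+x. ennreal (a i x * \<bar>k\<bar> powr q i) \<partial>lebesgue_on S)"
  proof -
    have m: "(\<lambda>x. ennreal (a i x * \<bar>k\<bar> powr q i)) \<in> borel_measurable (lebesgue_on S)" if "i \<in> {1..N}" for i
      using am[OF that] by measurable
    show ?thesis
      by (subst nn_integral_add[OF borel_measurable_const borel_measurable_sum[OF m]]) (simp_all only: nn_integral_sum[OF m])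
  qed
  also have "\<dots> < \<infinity>" using fin[of "\<bar>k\<bar> powr p"] fa by (auto simp del: nn_integral_const)
  finally show ?thesis by (simp add: modular_class_def)
qed

lemma modular_class_0: "(\<lambda>x. 0) \<in> modular_class H S"
  by (simp add: modular_class_def)

lemma modular_class_cong:
  assumes "f \<in> modular_class H S" "\<And>x. x \<in> S \<Longrightarrow> f x = g x"
  shows "g \<in> modular_class H S"
proof -
  have "g \<in> borel_measurable (lebesgue_on S)"
    using assms measurable_cong[of "lebesgue_on S" f g] by (auto simp: modular_class_def)
  moreover have "(\<integral>\<^sup>+x. ennreal (H x \<bar>f x\<bar>) \<partial>lebesgue_on S) = (\<integral>\<^sup>+x. ennreal (H x \<bar>g x\<bar>) \<partial>lebesgue_on S)"
    using assms by (intro nn_integral_cong) auto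
  ultimately show ?thesis using assms(1) by (simp add: modular_class_def)
qed

text \<open>By doubling, the modular class is already closed under linear combinations, so the
  linear hull adds nothing.\<close>

lemma L_space_eq_modular_class:
  assumes S: "S \<in> sets lebesgue" shows "L_space H S = modular_class H S"
proof
  show "L_space H S \<subseteq> modular_class H S"
  proof
    fix f assume "f \<in> L_space H S"
    then obtain k :: nat and c g where g: "\<forall>j<k. g j \<in> modular_class H S" and f: "\<forall>x\<in>S. f x = (\<Sum>j<k. c j * g j x)"
      unfolding L_space_def by blast
    have "(\<lambda>x. \<Sum>j<k. c j * g j x) \<in> modular_class H S"
      using g
    proof (induction k)
      case 0
      then show ?case by (simp add: modular_class_0)
    next
      case (Suc k)
      then have f: "(\<lambda>x. \<Sum>j<k. c j * g j x) \<in> modular_class H S" and g: "g k \<in> modular_class H S" by auto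
      show ?case
      proof (rule modular_class_bound[OF f g _ S, where c="max 1 \<bar>c k\<bar>"])
        show "(\<lambda>x. \<Sum>j<Suc k. c j * g j x) \<in> borel_measurable (lebesgue_on S)"
          using f g by (auto simp: modular_class_def)
        fix x
        have "\<bar>\<Sum>j<Suc k. c j * g j x\<bar> \<le> \<bar>\<Sum>j<k. c j * g j x\<bar> + \<bar>c k\<bar> * \<bar>g k x\<bar>"
          using abs_triangle_ineq[of "\<Sum>j<k. c j * g j x" "c k * g k x"] by (simp add: abs_mult)
        also have "\<dots> \<le> max 1 \<bar>c k\<bar> * \<bar>\<Sum>j<k. c j * g j x\<bar> + max 1 \<bar>c k\<bar> * \<bar>g k x\<bar>"
          using mult_right_mono[of 1 "max 1 \<bar>c k\<bar>" "\<bar>\<Sum>j<k. c j * g j x\<bar>"] by (intro add_mono mult_right_mono) auto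
        finally show "\<bar>\<Sum>j<Suc k. c j * g j x\<bar> \<le> max 1 \<bar>c k\<bar> * (\<bar>\<Sum>j<k. c j * g j x\<bar> + \<bar>g k x\<bar>)"
          by (simp add: distrib_left)
      qed auto
    qed
    then show "f \<in> modular_class H S" by (rule modular_class_cong) (use f in auto)
  qed
  show "modular_class H S \<subseteq> L_space H S"
  proof
    fix f assume "f \<in> modular_class H S"
    then show "f \<in> L_space H S" unfolding L_space_def
      by (auto intro!: exI[of _ "Suc 0"] exI[of _ "\<lambda>_. 1"] exI[of _ "\<lambda>_. f"])
  qed
qed

lemma modular_class_subset:
  assumes "f \<in> modular_class H S" "S \<in> sets lebesgue" "U \<in> sets lebesgue" "U \<subseteq> S"
  shows "f \<in> modular_class H U"
proof -
  have "f \<in> borel_measurable (lebesgue_on U)"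
    using assms by (auto simp: modular_class_def intro: measurable_restrict_mono)
  moreover have "(\<integral>\<^sup>+x. ennreal (H x \<bar>f x\<bar>) \<partial>lebesgue_on U) \<le> (\<integral>\<^sup>+x. ennreal (H x \<bar>f x\<bar>) \<partial>lebesgue_on S)"
    using assms by (auto simp: nn_integral_restrict_space indicator_def intro!: nn_integral_mono)
  ultimately show ?thesis using assms(1) by (auto simp: modular_class_def)
qed

end

section \<open>The Caccioppoli inequality\<close>

lemma ess_supp_complement_open:
  assumes "open \<Omega>" shows "open (\<Omega> - ess_supp \<Omega> f)"
proof -
  have "\<Omega> - ess_supp \<Omega> f = \<Union>{U. open U \<and> U \<subseteq> \<Omega> \<and> (AE y in lebesgue_on U. f y = 0)}"
    by (auto simp: ess_supp_def)
  then show ?thesis by (auto intro: open_Union)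
qed

lemma ess_supp_sets:
  assumes "open \<Omega>" shows "ess_supp \<Omega> f \<in> sets lebesgue"
proof -
  have "ess_supp \<Omega> f = \<Omega> - (\<Omega> - ess_supp \<Omega> f)" by (auto simp: ess_supp_def)
  also have "\<dots> \<in> sets lebesgue" using assms ess_supp_complement_open[OF assms, of f] by (intro sets.Diff[of \<Omega> _ "\<Omega> - ess_supp \<Omega> f"]) (simp_all only: borel_open sets_completionI_sets sets_lborel)
  finally show ?thesis .
qed

text \<open>The complement of the essential support is a union of arbitrarily many open sets, each
  with its own null set; Lindelof's theorem leaves countably many of them.\<close>

lemma AE_ess_supp_zero:
  fixes f :: "real^'n \<Rightarrow> real"
  assumes "open \<Omega>"
  shows "AE x in lebesgue. x \<in> \<Omega> \<and> x \<notin> ess_supp \<Omega> f \<longrightarrow> f x = 0"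
proof -
  define \<U> where "\<U> = {U. open U \<and> U \<subseteq> \<Omega> \<and> (AE y in lebesgue_on U. f y = 0)}"
  have eq: "\<Omega> - ess_supp \<Omega> f = \<Union>\<U>"
    by (auto simp: ess_supp_def \<U>_def)
  obtain \<U>' where \<U>': "\<U>' \<subseteq> \<U>" "countable \<U>'" "\<Union>\<U>' = \<Union>\<U>"
    by (rule Lindelof[of \<U>]) (auto simp: \<U>_def)
  have "AE x in lebesgue. \<forall>U\<in>\<U>'. x \<in> U \<longrightarrow> f x = 0"
  proof (subst AE_ball_countable[OF \<U>'(2)], rule ballI)
    fix U assume "U \<in> \<U>'"
    then have "open U" "AE y in lebesgue_on U. f y = 0" using \<U>'(1) by (auto simp: \<U>_def)
    then show "AE x in lebesgue. x \<in> U \<longrightarrow> f x = 0" by (simp add: AE_restrict_space_iff)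
  qed
  then show ?thesis
  proof eventually_elim
    case (elim x)
    then show ?case using eq \<U>'(3) by blast
  qed
qed

lemma ess_supp_subset:
  assumes "open \<Omega>" "closed C" "\<And>x. x \<in> \<Omega> \<Longrightarrow> x \<notin> C \<Longrightarrow> f x = 0"
  shows "ess_supp \<Omega> f \<subseteq> C"
proof
  fix x assume x: "x \<in> ess_supp \<Omega> f"
  show "x \<in> C"
  proof (rule ccontr)
    assume "x \<notin> C"
    moreover have "open (\<Omega> - C)" using assms by auto
    moreover have "AE y in lebesgue_on (\<Omega> - C). f y = 0" using assms(3) by (intro AE_I2) auto
    ultimately show False using x by (auto simp: ess_supp_def)
  qed
qed

lemma weak_gradient_is_weak_gradient: "is_weak_gradient \<Omega> f g \<Longrightarrow> is_weak_gradient \<Omega> f (weak_gradient \<Omega> f)"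
  unfolding weak_gradient_def using someI[of "is_weak_gradient \<Omega> f" g] by simp

lemma locally_integrable_measurable:
  fixes f :: "real^'n \<Rightarrow> 'b::{banach, second_countable_topology}"
  assumes "open \<Omega>" and f: "locally_integrable \<Omega> f"
  shows "f \<in> borel_measurable (lebesgue_on \<Omega>)"
proof (cases "\<Omega> = {}")
  case False
  have Om: "\<Omega> \<inter> space lebesgue \<in> sets lebesgue" using assms(1) by simp
  obtain \<D> :: "(real^'n) set set" where \<D>: "countable \<D>" "\<D> \<subseteq> Pow \<Omega>" "\<And>X. X \<in> \<D> \<Longrightarrow> \<exists>a b. X = cbox a b" "\<Union>\<D> = \<Omega>"
    by (rule open_countable_Union_open_cbox[OF \<open>open \<Omega>\<close>]) (rule that)
  have ne: "\<D> \<noteq> {}" using False \<D>(4) by auto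
  define K where "K n = (\<Union>j\<le>n. from_nat_into \<D> j)" for n :: nat
  have in\<D>: "from_nat_into \<D> j \<in> \<D>" for j by (rule from_nat_into[OF ne])
  have cK: "compact (K n)" for n
    unfolding K_def using \<D>(3)[OF in\<D>] by (intro compact_UN) (auto, metis compact_cbox)
  have sub: "K n \<subseteq> \<Omega>" for n unfolding K_def using in\<D> \<D>(2) by blast
  have "(\<lambda>x. indicator \<Omega> x *\<^sub>R f x) \<in> borel_measurable lebesgue"
  proof (rule borel_measurable_LIMSEQ_metric)
    show "(\<lambda>x. indicator (K n) x *\<^sub>R f x) \<in> borel_measurable lebesgue" for n
      by (rule borel_measurable_integrable[OF locally_integrable_imp_integrable_indicator[OF f cK sub]])
    fix x
    have "\<forall>\<^sub>F n in sequentially. indicator (K n) x *\<^sub>R f x = indicator \<Omega> x *\<^sub>R f x"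
    proof (cases "x \<in> \<Omega>")
      case True
      then obtain X where X: "X \<in> \<D>" "x \<in> X" using \<D>(4) by auto
      then obtain j where j: "from_nat_into \<D> j = X" using from_nat_into_surj[OF \<D>(1)] by metis
      show ?thesis using eventually_ge_at_top[of j]
      proof eventually_elim
        case (elim n)
        then have "x \<in> K n" unfolding K_def using j X(2) by auto
        then show ?case using True by simp
      qed
    next
      case False
      then have "x \<notin> K n" for n using sub by blast
      then show ?thesis using False by simp
    qed
    then show "(\<lambda>n. indicator (K n) x *\<^sub>R f x) \<longlonglongrightarrow> indicator \<Omega> x *\<^sub>R f x" by (rule tendsto_eventually)
  qed
  then show ?thesis using borel_measurable_restrict_space_iff[OF Om] by blast
qed (auto simp: measurable_def)

definition excess :: "(real^'n \<Rightarrow> real) \<Rightarrow> real \<Rightarrow> real \<Rightarrow> real \<Rightarrow> real^'n \<Rightarrow> real"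
  where "excess u \<sigma> m k x = max (\<sigma> * (u x - m) - k) 0"

definition excess_grad :: "(real^'n \<Rightarrow> real) \<Rightarrow> (real^'n \<Rightarrow> real^'n) \<Rightarrow> real \<Rightarrow> real \<Rightarrow> real \<Rightarrow> (real^'n \<Rightarrow> real) \<Rightarrow> real^'n \<Rightarrow> real^'n"
  where "excess_grad u g \<sigma> m k \<eta> x =
    \<eta> x *\<^sub>R (if excess u \<sigma> m k x > 0 then \<sigma> *\<^sub>R g x else 0) + excess u \<sigma> m k x *\<^sub>R grad \<eta> x"

lemma excess_nonneg [simp]: "0 \<le> excess u \<sigma> m k x"
  by (simp add: excess_def)

lemma excess_weak_gradient:
  fixes u :: "real^'n \<Rightarrow> real"
  assumes "open \<Omega>" and u: "is_weak_gradient \<Omega> u g" and \<eta>: "\<eta> \<in> test_functions \<Omega>"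
  shows "integrable lebesgue (\<lambda>x. \<eta> x * excess u \<sigma> m k x)"
    and "integrable lebesgue (excess_grad u g \<sigma> m k \<eta>)"
    and "\<And>\<phi> i. \<phi> \<in> test_functions UNIV \<Longrightarrow>
      (\<integral>x. (\<eta> x * excess u \<sigma> m k x) * partial_deriv i \<phi> x \<partial>lebesgue)
      = - (\<integral>x. excess_grad u g \<sigma> m k \<eta> x $ i * \<phi> x \<partial>lebesgue)"
    and "is_weak_gradient \<Omega> (\<lambda>x. \<eta> x * excess u \<sigma> m k x) (excess_grad u g \<sigma> m k \<eta>)"
proof -
  have "is_weak_gradient \<Omega> (\<lambda>x. \<sigma> * u x) (\<lambda>x. \<sigma> *\<^sub>R g x)"
    using is_weak_gradient_linear[OF assms(1) u u, of \<sigma> 0] by simp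
  from is_weak_gradient_truncation[OF assms(1) this, of "k + \<sigma> * m"]
  have "is_weak_gradient \<Omega> (excess u \<sigma> m k) (\<lambda>x. if excess u \<sigma> m k x > 0 then \<sigma> *\<^sub>R g x else 0)"
    by (simp add: excess_def[abs_def] algebra_simps less_max_iff_disj)
  note w = is_weak_gradient_mult_test[OF assms(1) this \<eta>]
  show i: "integrable lebesgue (\<lambda>x. \<eta> x * excess u \<sigma> m k x)"
    "integrable lebesgue (excess_grad u g \<sigma> m k \<eta>)"
    using w(1,2) by (simp_all add: excess_grad_def[abs_def])
  show weak: "(\<integral>x. (\<eta> x * excess u \<sigma> m k x) * partial_deriv i \<phi> x \<partial>lebesgue)
      = - (\<integral>x. excess_grad u g \<sigma> m k \<eta> x $ i * \<phi> x \<partial>lebesgue)" if "\<phi> \<in> test_functions UNIV" for \<phi> i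
    using w(3)[OF that, of i] by (simp only: excess_grad_def)
  show "is_weak_gradient \<Omega> (\<lambda>x. \<eta> x * excess u \<sigma> m k x) (excess_grad u g \<sigma> m k \<eta>)"
    unfolding is_weak_gradient_lebesgue[OF assms(1)]
    using i weak test_functions_mono[of \<Omega> UNIV] by (blast intro: integrable_lebesgue_imp_locally_integrable)
qed

context multiphase_integrand
begin

lemma minimizer_gradient:
  assumes "open \<Omega>" "local_minimizer H \<Omega> u"
  obtains g where "is_weak_gradient \<Omega> u g" "u \<in> modular_class H \<Omega>" "(\<lambda>x. norm (g x)) \<in> modular_class H \<Omega>"
proof -
  have [simp]: "\<Omega> \<in> sets lebesgue" using assms(1) by simp
  show ?thesis using assms(2) that by (auto simp: local_minimizer_def W_space_def L_space_eq_modular_class)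
qed

context
  fixes \<Omega> :: "(real^'n) set" and u :: "real^'n \<Rightarrow> real" and g :: "real^'n \<Rightarrow> real^'n"
    and \<eta> :: "real^'n \<Rightarrow> real" and \<sigma> m k M :: real
  assumes \<Omega>: "open \<Omega>" "bounded \<Omega>" and min: "local_minimizer H \<Omega> u"
    and wg: "is_weak_gradient \<Omega> u g" and u: "u \<in> modular_class H \<Omega>"
    and g: "(\<lambda>x. norm (g x)) \<in> modular_class H \<Omega>"
    and \<sigma>: "\<sigma> = 1 \<or> \<sigma> = -1"
    and \<eta>: "\<eta> \<in> test_functions \<Omega>" "\<And>x. 0 \<le> \<eta> x" "\<And>x. \<eta> x \<le> 1"
    and M: "0 \<le> M" and grad_\<eta>: "\<And>x. norm (grad \<eta> x) \<le> M * \<eta> x powr (1 - 1 / Q)"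
begin

private abbreviation "e \<equiv> excess u \<sigma> m k"
private abbreviation "h \<equiv> \<lambda>x. \<eta> x * e x"
private abbreviation "Gh \<equiv> excess_grad u g \<sigma> m k \<eta>"
private abbreviation "D \<equiv> {x \<in> \<Omega>. h x \<noteq> 0}"

lemma excess_facts:
  shows Om_sets: "\<Omega> \<in> sets lebesgue"
    and u_meas: "u \<in> borel_measurable (lebesgue_on \<Omega>)"
    and g_meas: "g \<in> borel_measurable (lebesgue_on \<Omega>)"
    and e_meas: "e \<in> borel_measurable (lebesgue_on \<Omega>)"
    and \<eta>_meas: "\<eta> \<in> borel_measurable (lebesgue_on \<Omega>)"
    and Gh_meas: "Gh \<in> borel_measurable (lebesgue_on \<Omega>)"
    and D_sets: "D \<in> sets lebesgue"
proof -
  show S: "\<Omega> \<in> sets lebesgue" using \<Omega> by simp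
  show um[measurable]: "u \<in> borel_measurable (lebesgue_on \<Omega>)" using u by (simp add: modular_class_def)
  show "g \<in> borel_measurable (lebesgue_on \<Omega>)"
    using wg by (intro locally_integrable_measurable \<Omega>) (simp add: is_weak_gradient_def)
  show em[measurable]: "e \<in> borel_measurable (lebesgue_on \<Omega>)" unfolding excess_def[abs_def] by measurable
  show \<eta>m[measurable]: "\<eta> \<in> borel_measurable (lebesgue_on \<Omega>)"
    using \<eta>(1) by (intro measurable_restrict_space1 smooth_measurable) (simp add: test_functions_iff)
  show "Gh \<in> borel_measurable (lebesgue_on \<Omega>)"
    using excess_weak_gradient(2)[OF \<Omega>(1) wg \<eta>(1)] by (intro measurable_restrict_space1 borel_measurable_integrable)
  have "{x \<in> space (lebesgue_on \<Omega>). h x \<noteq> 0} \<in> sets (lebesgue_on \<Omega>)" by measurable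
  then show "D \<in> sets lebesgue" using S by (simp add: sets_restrict_space_iff)
qed

text \<open>For the third bound, |grad \<eta>| <= M \<eta> / c with c = \<eta>^(1/Q) makes the
  gradient of the competitor at most a convex combination of |g| and M e / c with weights 1 - \<eta>
  and \<eta>. By convexity the second part contributes \<eta> H(M e / c); since \<eta> = c^Q, this
  is at most H(M e) by \<open>H_shrink\<close>. No negative power of \<eta> survives.\<close>

lemma excess_gradient_bound:
  shows "x \<notin> D \<Longrightarrow> x \<in> \<Omega> \<Longrightarrow> Gh x = 0"
    and "norm (Gh x) \<le> \<eta> x * norm (g x) + M * e x"
    and "x \<in> D \<Longrightarrow> H x (norm (g x - \<sigma> *\<^sub>R Gh x)) \<le> (1 - \<eta> x) * H x (norm (g x)) + H x (M * e x)"
proof -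
  have Q1: "1 < Q" using p pQ by simp
  have \<sigma>1: "\<bar>\<sigma>\<bar> = 1" "\<sigma> * \<sigma> = 1" using \<sigma> by auto
  have M_\<eta>: "norm (grad \<eta> x) \<le> M" for x
  proof -
    have "\<eta> x powr (1 - 1 / Q) \<le> 1" using \<eta> Q1 by (intro powr_le1) auto
    then show ?thesis using grad_\<eta>[of x] mult_left_le[of "\<eta> x powr (1 - 1 / Q)" M] M by linarith
  qed
  show "Gh x = 0" if "x \<notin> D" "x \<in> \<Omega>"
  proof -
    have "\<eta> x = 0 \<or> e x = 0" using that by auto
    \<comment> \<open>Where \<eta> x = 0 the gradient bound gives grad \<eta> x = 0, because
      \<open>0 powr (1 - 1 / Q) = 0\<close>.\<close>
    then show ?thesis using grad_\<eta>[of x] by (auto simp: excess_grad_def)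
  qed
  show "norm (Gh x) \<le> \<eta> x * norm (g x) + M * e x"
  proof -
    have "norm (Gh x) \<le> norm (\<eta> x *\<^sub>R (if e x > 0 then \<sigma> *\<^sub>R g x else 0)) + norm (e x *\<^sub>R grad \<eta> x)"
      unfolding excess_grad_def by (rule norm_triangle_ineq)
    also have "norm (\<eta> x *\<^sub>R (if e x > 0 then \<sigma> *\<^sub>R g x else 0)) \<le> \<eta> x * norm (g x)" using \<eta>(2)[of x] \<sigma>1 by simp
    also have "norm (e x *\<^sub>R grad \<eta> x) \<le> M * e x" using mult_right_mono[OF M_\<eta>[of x], of "e x"] by (simp add: mult.commute)
    finally show ?thesis by simp
  qed
  show "H x (norm (g x - \<sigma> *\<^sub>R Gh x)) \<le> (1 - \<eta> x) * H x (norm (g x)) + H x (M * e x)" if "x \<in> D"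
  proof -
    have "\<eta> x \<noteq> 0" "e x \<noteq> 0" using that by auto
    then have pos: "\<eta> x > 0" "e x > 0" using \<eta>(2)[of x] excess_nonneg[of u \<sigma> m k x] by linarith+
    define c where "c = \<eta> x powr (1 / Q)"
    have c: "0 < c" "c \<le> 1" unfolding c_def using pos \<eta>(3)[of x] Q1 by (auto intro: powr_le1)
    have cQ: "c powr Q = \<eta> x" unfolding c_def using pos Q1 by (simp add: powr_powr)
    have \<eta>c: "\<eta> x powr (1 - 1 / Q) = \<eta> x / c" unfolding c_def using pos by (simp add: powr_diff)
    have "g x - \<sigma> *\<^sub>R Gh x = (1 - \<eta> x) *\<^sub>R g x - (\<sigma> * e x) *\<^sub>R grad \<eta> x"
    proof -
      have "\<sigma> *\<^sub>R (\<eta> x *\<^sub>R \<sigma> *\<^sub>R g x) = \<eta> x *\<^sub>R g x" using \<sigma> by auto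
      then show ?thesis using pos by (simp add: excess_grad_def algebra_simps)
    qed
    also have "norm \<dots> \<le> norm ((1 - \<eta> x) *\<^sub>R g x) + norm ((\<sigma> * e x) *\<^sub>R grad \<eta> x)" by (rule norm_triangle_ineq4)
    also have "\<dots> \<le> (1 - \<eta> x) * norm (g x) + e x * (M * (\<eta> x / c))"
    proof -
      have "norm (grad \<eta> x) \<le> M * (\<eta> x / c)" using grad_\<eta>[of x] unfolding \<eta>c .
      then have "e x * norm (grad \<eta> x) \<le> e x * (M * (\<eta> x / c))" using pos by (intro mult_left_mono) auto
      then show ?thesis using \<eta>(3)[of x] \<sigma>1 pos by (simp add: abs_mult)
    qed
    also have "\<dots> = (1 - \<eta> x) * norm (g x) + \<eta> x * (M * e x / c)" by simp
    finally have "H x (norm (g x - \<sigma> *\<^sub>R Gh x)) \<le> H x ((1 - \<eta> x) * norm (g x) + \<eta> x * (M * e x / c))"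
      by (intro H_mono) auto
    also have "\<dots> \<le> (1 - \<eta> x) * H x (norm (g x)) + \<eta> x * H x (M * e x / c)"
      using \<eta> M c by (intro H_convex) auto
    also have "\<eta> x * H x (M * e x / c) \<le> H x (M * e x)"
      using H_shrink[of c "M * e x / c" x] c M unfolding cQ by simp
    finally show ?thesis by simp
  qed
qed

text \<open>The competitor and its gradient are bounded pointwise by multiples of |u|, |g| and the
  excess, which have finite modular. Finiteness of the modular of \<open>gw\<close> is used again
  when energies are cancelled.\<close>

lemma competitor_admissible:
  defines "w \<equiv> \<lambda>x. 1 * u x + (- \<sigma>) * h x" and "gw \<equiv> \<lambda>x. 1 *\<^sub>R g x + (- \<sigma>) *\<^sub>R Gh x"
  shows "is_weak_gradient \<Omega> w gw" and "(\<lambda>x. norm (gw x)) \<in> modular_class H \<Omega>" and "w \<in> W_loc_space H \<Omega>"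
proof -
  have \<sigma>1: "\<bar>\<sigma>\<bar> = 1" using \<sigma> by auto
  show wgw: "is_weak_gradient \<Omega> w gw"
    unfolding w_def gw_def by (rule is_weak_gradient_linear[OF \<Omega>(1) wg excess_weak_gradient(4)[OF \<Omega>(1) wg \<eta>(1)]])
  have [measurable]: "u \<in> borel_measurable (lebesgue_on \<Omega>)" "g \<in> borel_measurable (lebesgue_on \<Omega>)"
    "e \<in> borel_measurable (lebesgue_on \<Omega>)" "\<eta> \<in> borel_measurable (lebesgue_on \<Omega>)" "Gh \<in> borel_measurable (lebesgue_on \<Omega>)"
    by (rule excess_facts)+
  have const: "(\<lambda>x. c) \<in> modular_class H \<Omega>" for c :: real by (rule modular_class_const[OF \<Omega>(2) Om_sets])
  have e_le: "e x \<le> \<bar>u x\<bar> + \<bar>\<bar>m\<bar> + \<bar>k\<bar>\<bar>" for x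
    using \<sigma> unfolding excess_def by auto
  have em: "e \<in> modular_class H \<Omega>"
    using e_le by (intro modular_class_bound[OF u const[of "\<bar>m\<bar> + \<bar>k\<bar>"] _ Om_sets, where c=1]) auto
  have wm: "w \<in> modular_class H \<Omega>"
  proof (rule modular_class_bound[OF u em _ Om_sets, where c=1])
    show "w \<in> borel_measurable (lebesgue_on \<Omega>)" unfolding w_def by measurable
    fix x
    have "\<bar>\<eta> x * e x\<bar> \<le> \<bar>e x\<bar>" using \<eta>(2,3)[of x] by (simp add: abs_mult mult_left_le_one_le)
    then show "\<bar>w x\<bar> \<le> 1 * (\<bar>u x\<bar> + \<bar>e x\<bar>)" using \<sigma> unfolding w_def by auto
  qed simp
  show gwm: "(\<lambda>x. norm (gw x)) \<in> modular_class H \<Omega>"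
  proof (rule modular_class_bound[OF g em _ Om_sets, where c="M + 2"])
    show "(\<lambda>x. norm (gw x)) \<in> borel_measurable (lebesgue_on \<Omega>)" unfolding gw_def by measurable
    fix x
    have "norm (gw x) \<le> norm (g x) + norm (Gh x)"
      unfolding gw_def using norm_triangle_ineq[of "g x" "- \<sigma> *\<^sub>R Gh x"] \<sigma>1 by simp
    also have "\<dots> \<le> norm (g x) + (\<eta> x * norm (g x) + M * e x)" using excess_gradient_bound(2) by simp
    also have "\<dots> \<le> norm (g x) + (norm (g x) + M * e x)" using \<eta>(2,3)[of x] by (simp add: mult_left_le_one_le)
    also have "\<dots> \<le> (M + 2) * (\<bar>norm (g x)\<bar> + \<bar>e x\<bar>)" using M by (simp add: algebra_simps)
    finally show "\<bar>norm (gw x)\<bar> \<le> (M + 2) * (\<bar>norm (g x)\<bar> + \<bar>e x\<bar>)" by simp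
  qed (use M in auto)
  show "w \<in> W_loc_space H \<Omega>"
    unfolding W_loc_space_def
  proof (intro CollectI allI impI)
    fix U assume U: "open U \<and> compactly_contained U \<Omega>"
    then have sub: "U \<subseteq> \<Omega>" using closure_subset by (auto simp: compactly_contained_def)
    have Us: "U \<in> sets lebesgue" using U by auto
    show "w \<in> W_space H U"
      unfolding W_space_def L_space_eq_modular_class[OF Us]
      using modular_class_subset[OF wm Om_sets Us sub] modular_class_subset[OF gwm Om_sets Us sub]
        is_weak_gradient_subset[OF \<Omega>(1) _ sub wgw] U by blast
  qed
qed

text \<open>With P and R the densities of the competitor and of u, the pointwise bound reads P + X
  <= R + Y. Minimality bounds the integral of R over the support by that of P, which is finite and
  can be cancelled; X <= Y remains in integrated form.\<close>

theorem caccioppoli: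
  "(\<integral>\<^sup>+x. indicator D x * ennreal (\<eta> x * H x (norm (g x))) \<partial>lebesgue)
    \<le> (\<integral>\<^sup>+x. indicator D x * ennreal (H x (M * e x)) \<partial>lebesgue)"
proof -
  define w where "w = (\<lambda>x. 1 * u x + (- \<sigma>) * h x)"
  define gw where "gw = (\<lambda>x. 1 *\<^sub>R g x + (- \<sigma>) *\<^sub>R Gh x)"
  note comp = competitor_admissible[folded w_def gw_def]
  have [measurable]: "u \<in> borel_measurable (lebesgue_on \<Omega>)" "g \<in> borel_measurable (lebesgue_on \<Omega>)"
    "e \<in> borel_measurable (lebesgue_on \<Omega>)" "\<eta> \<in> borel_measurable (lebesgue_on \<Omega>)" "Gh \<in> borel_measurable (lebesgue_on \<Omega>)"
    by (rule excess_facts)+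
  define S where "S = ess_supp \<Omega> (\<lambda>x. u x - w x)"
  have diff: "u x - w x = \<sigma> * h x" for x by (simp add: w_def)
  have S\<Omega>: "S \<subseteq> \<Omega>" by (auto simp: S_def ess_supp_def)
  have Ss: "S \<in> sets lebesgue" unfolding S_def by (rule ess_supp_sets[OF \<Omega>(1)])
  have sub: "S \<subseteq> closure {x. \<eta> x \<noteq> 0}"
    unfolding S_def using closure_subset[of "{x. \<eta> x \<noteq> 0}"] by (intro ess_supp_subset \<Omega>) (auto simp: diff)
  have "compactly_contained (closure {x. \<eta> x \<noteq> 0}) \<Omega>"
    using \<eta>(1) unfolding test_functions_iff compactly_contained_def by simp
  then have "compactly_contained S \<Omega>"
    by (rule compactly_contained_subset[OF _ sub order_refl])
  then have en: "energy H \<Omega> u S \<le> energy H \<Omega> w S"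
    using min comp(3) unfolding local_minimizer_def Let_def S_def by blast
  have energy_eq: "energy H \<Omega> v S = (\<integral>\<^sup>+x. indicator S x * ennreal (H x (norm (gv x))) \<partial>lebesgue)" if v: "is_weak_gradient \<Omega> v gv" for v gv
  proof -
    have "energy H \<Omega> v S = (\<integral>\<^sup>+x. ennreal (H x (norm (weak_gradient \<Omega> v x))) * indicator S x \<partial>lebesgue)"
      unfolding energy_def using Ss by (intro nn_integral_restrict_space) simp
    also have "\<dots> = (\<integral>\<^sup>+x. indicator S x * ennreal (H x (norm (gv x))) \<partial>lebesgue)"
    proof (rule nn_integral_cong_AE)
      show "AE x in lebesgue. ennreal (H x (norm (weak_gradient \<Omega> v x))) * indicator S x = indicator S x * ennreal (H x (norm (gv x)))"
        using weak_gradient_unique[OF \<Omega>(1) weak_gradient_is_weak_gradient[OF v] v]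
        by eventually_elim (use S\<Omega> in \<open>auto simp: indicator_def\<close>)
    qed
    finally show ?thesis .
  qed
  have meas: "(\<lambda>x. indicator S x * F x) \<in> borel_measurable lebesgue" if "F \<in> borel_measurable (lebesgue_on \<Omega>)" for F :: "real^'n \<Rightarrow> ennreal"
  proof -
    have F: "(\<lambda>x. F x * indicator \<Omega> x) \<in> borel_measurable lebesgue"
      using that borel_measurable_restrict_space_iff_ennreal[of \<Omega> lebesgue F] Om_sets by simp
    have "(\<lambda>x. indicator S x * (F x * indicator \<Omega> x)) \<in> borel_measurable lebesgue"
      by (rule borel_measurable_times_ennreal[OF borel_measurable_indicator[OF Ss] F])
    moreover have "indicator S x * (F x * indicator \<Omega> x) = indicator S x * F x" for x using S\<Omega> by (auto simp: indicator_def)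
    ultimately show ?thesis by simp
  qed
  have iD: "(\<lambda>x. indicator D x :: ennreal) \<in> borel_measurable (lebesgue_on \<Omega>)"
    by (rule measurable_restrict_space1[OF borel_measurable_indicator[OF D_sets]])
  define P where "P x = ennreal (H x (norm (gw x)))" for x
  define R where "R x = ennreal (H x (norm (g x)))" for x
  define X where "X x = indicator D x * ennreal (\<eta> x * H x (norm (g x)))" for x
  define Y where "Y x = indicator D x * ennreal (H x (M * e x))" for x
  have [measurable]: "gw \<in> borel_measurable (lebesgue_on \<Omega>)" unfolding gw_def by measurable
  have m: "P \<in> borel_measurable (lebesgue_on \<Omega>)" "R \<in> borel_measurable (lebesgue_on \<Omega>)"
    "X \<in> borel_measurable (lebesgue_on \<Omega>)" "Y \<in> borel_measurable (lebesgue_on \<Omega>)"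
    unfolding P_def[abs_def] R_def[abs_def] X_def[abs_def] Y_def[abs_def]
    by (intro borel_measurable_times_ennreal iD measurable_compose[OF _ measurable_ennreal] H_measurable; measurable)+
  have pw: "P x + X x \<le> R x + Y x" if "x \<in> \<Omega>" for x
  proof (cases "x \<in> D")
    case True
    have gwx: "gw x = g x - \<sigma> *\<^sub>R Gh x" by (simp add: gw_def)
    have "H x (norm (gw x)) + \<eta> x * H x (norm (g x)) \<le> H x (norm (g x)) + H x (M * e x)"
      unfolding gwx using excess_gradient_bound(3)[OF True] by (simp add: left_diff_distrib)
    then have "ennreal (H x (norm (gw x)) + \<eta> x * H x (norm (g x))) \<le> ennreal (H x (norm (g x)) + H x (M * e x))"
      by (rule ennreal_leI)
    then show ?thesis using True \<eta>(2) unfolding P_def R_def X_def Y_def by simp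
  next
    case False
    then have "gw x = g x" using excess_gradient_bound(1)[OF False that] by (simp add: gw_def)
    then show ?thesis using False by (simp add: P_def R_def X_def Y_def)
  qed
  have "(\<integral>\<^sup>+x. indicator S x * P x \<partial>lebesgue) + (\<integral>\<^sup>+x. indicator S x * X x \<partial>lebesgue)
     = (\<integral>\<^sup>+x. indicator S x * P x + indicator S x * X x \<partial>lebesgue)"
    by (rule nn_integral_add[symmetric, OF meas[OF m(1)] meas[OF m(3)]])
  also have "\<dots> \<le> (\<integral>\<^sup>+x. indicator S x * R x + indicator S x * Y x \<partial>lebesgue)"
    using pw S\<Omega> by (intro nn_integral_mono) (auto simp: indicator_def)
  also have "\<dots> = (\<integral>\<^sup>+x. indicator S x * R x \<partial>lebesgue) + (\<integral>\<^sup>+x. indicator S x * Y x \<partial>lebesgue)"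
    by (rule nn_integral_add[OF meas[OF m(2)] meas[OF m(4)]])
  also have "(\<integral>\<^sup>+x. indicator S x * R x \<partial>lebesgue) \<le> (\<integral>\<^sup>+x. indicator S x * P x \<partial>lebesgue)"
    using en unfolding energy_eq[OF wg] energy_eq[OF comp(1)] P_def R_def .
  finally have "(\<integral>\<^sup>+x. indicator S x * P x \<partial>lebesgue) + (\<integral>\<^sup>+x. indicator S x * X x \<partial>lebesgue)
    \<le> (\<integral>\<^sup>+x. indicator S x * P x \<partial>lebesgue) + (\<integral>\<^sup>+x. indicator S x * Y x \<partial>lebesgue)"
    by (simp add: add_right_mono)
  moreover have "(\<integral>\<^sup>+x. indicator S x * P x \<partial>lebesgue) < \<infinity>"
  proof -
    have "(\<integral>\<^sup>+x. indicator S x * P x \<partial>lebesgue) \<le> (\<integral>\<^sup>+x. ennreal (H x \<bar>norm (gw x)\<bar>) * indicator \<Omega> x \<partial>lebesgue)"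
      using S\<Omega> unfolding P_def by (intro nn_integral_mono) (auto simp: indicator_def)
    also have "\<dots> = (\<integral>\<^sup>+x. ennreal (H x \<bar>norm (gw x)\<bar>) \<partial>lebesgue_on \<Omega>)"
      using Om_sets by (intro nn_integral_restrict_space[symmetric]) simp
    also have "\<dots> < \<infinity>" using comp(2) by (simp add: modular_class_def gw_def)
    finally show ?thesis .
  qed
  ultimately have "(\<integral>\<^sup>+x. indicator S x * X x \<partial>lebesgue) \<le> (\<integral>\<^sup>+x. indicator S x * Y x \<partial>lebesgue)"
    by (auto simp: ennreal_add_left_cancel_le)
  also have "\<dots> \<le> (\<integral>\<^sup>+x. Y x \<partial>lebesgue)" by (intro nn_integral_mono) (auto simp: indicator_def)
  \<comment> \<open>D may leave the essential support S, but only by a null set, because u - w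
    vanishes a.e. outside S.\<close>
  also have "(\<integral>\<^sup>+x. indicator S x * X x \<partial>lebesgue) = (\<integral>\<^sup>+x. X x \<partial>lebesgue)"
  proof (rule nn_integral_cong_AE)
    show "AE x in lebesgue. indicator S x * X x = X x"
      using AE_ess_supp_zero[OF \<Omega>(1), of "\<lambda>x. u x - w x", folded S_def]
    proof eventually_elim
      case (elim x)
      show ?case
      proof (cases "x \<in> S \<or> x \<notin> D")
        case False
        then have "\<sigma> * h x = 0" using elim diff by auto
        then show ?thesis using False \<sigma> by auto
      qed (auto simp: X_def)
    qed
  qed
  finally show ?thesis unfolding X_def Y_def .
qed

text \<open>The gradient is at most \<eta> |g| + M e, and H(\<eta> |g|) <= \<eta> H(|g|) produces
  exactly the weight \<eta> of \<open>caccioppoli\<close>. The constant is 2^Q from doubling, times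
  2 for two equal integrals.\<close>

lemma excess_gradient_energy:
  "(\<integral>\<^sup>+x. ennreal (H x (norm (Gh x))) \<partial>lebesgue) \<le> ennreal (2 * 2 powr Q) * (\<integral>\<^sup>+x. indicator D x * ennreal (H x (M * e x)) \<partial>lebesgue)"
proof -
  have Gh0: "Gh x = 0" if "x \<notin> D" for x
  proof (cases "x \<in> \<Omega>")
    case False
    then have "\<eta> x = 0" using \<eta>(1) test_function_outside by blast
    then show ?thesis using grad_\<eta>[of x] by (simp add: excess_grad_def)
  qed (use that excess_gradient_bound(1) in auto)
  have mlift: "(\<lambda>x. indicator D x * F x) \<in> borel_measurable lebesgue" if "F \<in> borel_measurable (lebesgue_on \<Omega>)" for F :: "real^'n \<Rightarrow> ennreal"
  proof -
    have F: "(\<lambda>x. F x * indicator \<Omega> x) \<in> borel_measurable lebesgue"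
      using that borel_measurable_restrict_space_iff_ennreal[of \<Omega> lebesgue F] Om_sets by simp
    have "(\<lambda>x. indicator D x * (F x * indicator \<Omega> x)) \<in> borel_measurable lebesgue"
      by (rule borel_measurable_times_ennreal[OF borel_measurable_indicator[OF D_sets] F])
    moreover have "indicator D x * (F x * indicator \<Omega> x) = indicator D x * F x" for x by (auto simp: indicator_def)
    ultimately show ?thesis by simp
  qed
  have [measurable]: "u \<in> borel_measurable (lebesgue_on \<Omega>)" "g \<in> borel_measurable (lebesgue_on \<Omega>)"
    "e \<in> borel_measurable (lebesgue_on \<Omega>)" "\<eta> \<in> borel_measurable (lebesgue_on \<Omega>)" "Gh \<in> borel_measurable (lebesgue_on \<Omega>)"
    by (rule excess_facts)+
  have [measurable]: "(\<lambda>x. H x (norm (g x))) \<in> borel_measurable (lebesgue_on \<Omega>)" "(\<lambda>x. H x (M * e x)) \<in> borel_measurable (lebesgue_on \<Omega>)"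
    by (intro H_measurable; measurable)+
  have m: "(\<lambda>x. indicator D x * ennreal (\<eta> x * H x (norm (g x)))) \<in> borel_measurable lebesgue"
    "(\<lambda>x. indicator D x * ennreal (H x (M * e x))) \<in> borel_measurable lebesgue"
    by (intro mlift; measurable)+
  have "(\<integral>\<^sup>+x. ennreal (H x (norm (Gh x))) \<partial>lebesgue)
    \<le> (\<integral>\<^sup>+x. ennreal (2 powr Q) * (indicator D x * ennreal (\<eta> x * H x (norm (g x))) + indicator D x * ennreal (H x (M * e x))) \<partial>lebesgue)"
  proof (rule nn_integral_mono)
    fix x
    show "ennreal (H x (norm (Gh x))) \<le> ennreal (2 powr Q) * (indicator D x * ennreal (\<eta> x * H x (norm (g x))) + indicator D x * ennreal (H x (M * e x)))"
    proof (cases "x \<in> D")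
      case True
      have "H x (norm (Gh x)) \<le> H x (\<eta> x * norm (g x) + M * e x)" by (intro H_mono excess_gradient_bound(2)) auto
      also have "\<dots> \<le> 2 powr Q * (H x (\<eta> x * norm (g x)) + H x (M * e x))" using \<eta> M by (intro H_add) auto
      also have "\<dots> \<le> 2 powr Q * (\<eta> x * H x (norm (g x)) + H x (M * e x))" using \<eta> by (intro mult_left_mono add_right_mono H_le_linear) auto
      finally have "ennreal (H x (norm (Gh x))) \<le> ennreal (2 powr Q * (\<eta> x * H x (norm (g x)) + H x (M * e x)))" by (rule ennreal_leI)
      also have "\<dots> = ennreal (2 powr Q) * (ennreal (\<eta> x * H x (norm (g x))) + ennreal (H x (M * e x)))"
        using \<eta>(2)[of x] by (simp add: ennreal_mult)
      finally show ?thesis using True by simp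
    qed (use Gh0 in auto)
  qed
  also have "\<dots> = ennreal (2 powr Q) * ((\<integral>\<^sup>+x. indicator D x * ennreal (\<eta> x * H x (norm (g x))) \<partial>lebesgue) + (\<integral>\<^sup>+x. indicator D x * ennreal (H x (M * e x)) \<partial>lebesgue))"
    by (subst nn_integral_cmult[OF borel_measurable_add[OF m]], subst nn_integral_add[OF m]) (rule refl)
  also have "\<dots> \<le> ennreal (2 powr Q) * ((\<integral>\<^sup>+x. indicator D x * ennreal (H x (M * e x)) \<partial>lebesgue) + (\<integral>\<^sup>+x. indicator D x * ennreal (H x (M * e x)) \<partial>lebesgue))"
    by (intro mult_left_mono add_right_mono caccioppoli) auto
  also have "\<dots> = ennreal (2 * 2 powr Q) * (\<integral>\<^sup>+x. indicator D x * ennreal (H x (M * e x)) \<partial>lebesgue)"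
    by (simp add: ennreal_mult mult_ac flip: mult_2)
  finally show ?thesis .
qed

end

end

section \<open>De Giorgi iteration\<close>

text \<open>Normalised by r, the inequality gains (\<rho> / r)^e. As \<rho> <= r and e >= 1, this is
  at most \<rho> / r, a gain that is the same for all phases.\<close>

lemma faber_krahn_lebesgue:
  fixes b h :: "real^'n \<Rightarrow> real" and G :: "real^'n \<Rightarrow> real^'n" and e r \<rho> K L :: real
  assumes W: "W11 f' g'" and h: "AE x in lebesgue. h x = f' x" and G: "AE x in lebesgue. G x = g' x"
    and w: "cell_weight e (ennreal K) w" and b: "AE x in lebesgue. ennreal (b x) = w x" "\<And>x. 0 \<le> b x"
    and e: "1 \<le> e" and \<rho>: "0 < \<rho>" "\<rho> \<le> r" and K: "0 \<le> K" and L: "(4 ^ (CARD('n) + 1) * CARD('n)) powr e * K \<le> L"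
    and small: "emeasure lborel {x. f' x \<noteq> 0} \<le> ennreal (\<rho> ^ CARD('n) / 2)"
  shows "(\<integral>\<^sup>+x. ennreal (b x * (\<bar>h x\<bar> / r) powr e) \<partial>lebesgue) \<le> ennreal (L * (\<rho> / r)) * (\<integral>\<^sup>+x. ennreal (b x * norm (G x) powr e) \<partial>lebesgue)"
proof -
  let ?c = "4 ^ (CARD('n) + 1) * real CARD('n)"
  have r: "r > 0" using \<rho> by linarith
  have [measurable]: "w \<in> borel_measurable borel" "f' \<in> borel_measurable borel" "g' \<in> borel_measurable borel"
    using w W by (auto simp: cell_weight_def W11_def)
  have "(\<integral>\<^sup>+x. ennreal (b x * (\<bar>h x\<bar> / r) powr e) \<partial>lebesgue) = (\<integral>\<^sup>+x. ennreal (1 / r powr e) * (w x * ennreal (\<bar>f' x\<bar> powr e)) \<partial>lebesgue)"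
  proof (rule nn_integral_cong_AE)
    show "AE x in lebesgue. ennreal (b x * (\<bar>h x\<bar> / r) powr e) = ennreal (1 / r powr e) * (w x * ennreal (\<bar>f' x\<bar> powr e))"
      using h b(1)
    proof eventually_elim
      case (elim x)
      have "b x * (\<bar>h x\<bar> / r) powr e = (1 / r powr e) * (b x * \<bar>h x\<bar> powr e)" using r by (simp add: powr_divide)
      then have "ennreal (b x * (\<bar>h x\<bar> / r) powr e) = ennreal (1 / r powr e) * (ennreal (b x) * ennreal (\<bar>h x\<bar> powr e))"
        using b(2)[of x] by (simp only: ennreal_mult' ennreal_mult divide_nonneg_nonneg powr_ge_zero zero_le_one)
      then show ?case using elim by simp
    qed
  qed
  also have "\<dots> = ennreal (1 / r powr e) * (\<integral>\<^sup>+x. w x * ennreal (\<bar>f' x\<bar> powr e) \<partial>lborel)"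
    by (subst nn_integral_completion, rule nn_integral_cmult) measurable
  also have "\<dots> \<le> ennreal (1 / r powr e) * (ennreal ((?c * \<rho>) powr e) * ennreal K * (\<integral>\<^sup>+x. w x * ennreal (norm (g' x) powr e) \<partial>lborel))"
    using faber_krahn[OF W w e \<rho>(1) small] by (intro mult_left_mono) simp_all
  also have "(\<integral>\<^sup>+x. w x * ennreal (norm (g' x) powr e) \<partial>lborel) = (\<integral>\<^sup>+x. w x * ennreal (norm (g' x) powr e) \<partial>lebesgue)"
    by (rule nn_integral_completion[symmetric])
  also have "\<dots> = (\<integral>\<^sup>+x. ennreal (b x * norm (G x) powr e) \<partial>lebesgue)"
  proof (rule nn_integral_cong_AE)
    show "AE x in lebesgue. w x * ennreal (norm (g' x) powr e) = ennreal (b x * norm (G x) powr e)"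
      using G b(1)
    proof eventually_elim
      case (elim x)
      then show ?case using b(2)[of x] by (simp add: ennreal_mult)
    qed
  qed
  also have "ennreal (1 / r powr e) * (ennreal ((?c * \<rho>) powr e) * ennreal K * (\<integral>\<^sup>+x. ennreal (b x * norm (G x) powr e) \<partial>lebesgue))
     = ennreal (1 / r powr e * (?c * \<rho>) powr e * K) * (\<integral>\<^sup>+x. ennreal (b x * norm (G x) powr e) \<partial>lebesgue)"
  proof -
    have "ennreal (1 / r powr e * (?c * \<rho>) powr e * K) = ennreal (1 / r powr e) * ennreal ((?c * \<rho>) powr e) * ennreal K"
      using K by (simp only: ennreal_mult mult_nonneg_nonneg powr_ge_zero divide_nonneg_nonneg zero_le_one)
    then show ?thesis by (simp only: mult.assoc)
  qed
  also have "\<dots> \<le> ennreal (L * (\<rho> / r)) * (\<integral>\<^sup>+x. ennreal (b x * norm (G x) powr e) \<partial>lebesgue)"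
  proof (intro mult_right_mono ennreal_leI)
    have "1 / r powr e * (?c * \<rho>) powr e * K = ?c powr e * K * (\<rho> / r) powr e"
      using r \<rho> by (simp add: powr_mult powr_divide)
    also have "\<dots> \<le> L * (\<rho> / r)"
      using r \<rho> e K L by (intro mult_mono powr_le_self) (auto intro: order_trans[OF _ L])
    finally show "1 / r powr e * (?c * \<rho>) powr e * K \<le> L * (\<rho> / r)" .
  qed simp
  finally show ?thesis .
qed

context multiphase_integrand
begin

text \<open>One L dominates the constants of all phases. The term t^p enters with the constant
  weight 1.\<close>

definition faber_krahn_const :: "real \<Rightarrow> bool"
  where "faber_krahn_const L \<longleftrightarrow>
    (\<exists>K\<ge>0. cell_weight p (ennreal K) (\<lambda>_ :: real^'n. 1) \<and> (4 ^ (CARD('n) + 1) * CARD('n)) powr p * K \<le> L) \<and>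
    (\<forall>i\<in>{1..N}. \<exists>K\<ge>0. \<exists>w. cell_weight (q i) (ennreal K) w \<and> (AE x in lebesgue. ennreal (a i x) = w x) \<and>
      (4 ^ (CARD('n) + 1) * CARD('n)) powr q i * K \<le> L)"

text \<open>The factor 1 gives the first term the shape of the others, so that
  \<open>faber_krahn_lebesgue\<close> applies to it with the coefficient 1.\<close>

lemma nn_integral_H:
  assumes [measurable]: "t \<in> borel_measurable lebesgue"
  shows "(\<integral>\<^sup>+x. ennreal (H x (t x)) \<partial>lebesgue)
    = (\<integral>\<^sup>+x. ennreal (1 * t x powr p) \<partial>lebesgue) + (\<Sum>i=1..N. \<integral>\<^sup>+x. ennreal (a i x * t x powr q i) \<partial>lebesgue)"
proof -
  have m: "(\<lambda>x. ennreal (a i x * t x powr q i)) \<in> borel_measurable lebesgue" if "i \<in> {1..N}" for i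
    using a_measurable[OF that] by measurable
  have m0: "(\<lambda>x. ennreal (1 * t x powr p)) \<in> borel_measurable lebesgue" by measurable
  have "(\<integral>\<^sup>+x. ennreal (H x (t x)) \<partial>lebesgue) = (\<integral>\<^sup>+x. ennreal (1 * t x powr p) + (\<Sum>i=1..N. ennreal (a i x * t x powr q i)) \<partial>lebesgue)"
  proof (rule nn_integral_cong)
    fix x
    have "(\<Sum>i=1..N. a i x * t x powr q i) \<ge> 0" using a_nonneg by (intro sum_nonneg) auto
    then show "ennreal (H x (t x)) = ennreal (1 * t x powr p) + (\<Sum>i=1..N. ennreal (a i x * t x powr q i))"
      unfolding multiphase_def using a_nonneg by (subst sum_ennreal) auto
  qed
  then show ?thesis
    by (simp only: nn_integral_add[OF m0 borel_measurable_sum[OF m]] nn_integral_sum[OF m])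
qed

lemma faber_krahn_H:
  assumes \<Omega>: "open \<Omega>" and wg: "is_weak_gradient \<Omega> u g" and \<eta>: "\<eta> \<in> test_functions \<Omega>"
    and L: "faber_krahn_const L" and \<rho>: "0 < \<rho>" "\<rho> \<le> r"
    and small: "emeasure lebesgue {x \<in> \<Omega>. \<eta> x * excess u \<sigma> m k x \<noteq> 0} \<le> ennreal (\<rho> ^ CARD('n) / 2)"
  shows "(\<integral>\<^sup>+x. ennreal (H x (\<bar>\<eta> x * excess u \<sigma> m k x\<bar> / r)) \<partial>lebesgue)
    \<le> ennreal (L * (\<rho> / r)) * (\<integral>\<^sup>+x. ennreal (H x (norm (excess_grad u g \<sigma> m k \<eta> x))) \<partial>lebesgue)"
proof -
  let ?h = "\<lambda>x. \<eta> x * excess u \<sigma> m k x" and ?G = "excess_grad u g \<sigma> m k \<eta>"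
  note e = excess_weak_gradient[OF \<Omega> wg \<eta>, where \<sigma>=\<sigma> and m=m and k=k]
  obtain f' g' where W: "W11 f' g'" and f': "AE x in lebesgue. ?h x = f' x" and g': "AE x in lebesgue. ?G x = g' x"
    by (rule W11_representative[OF e(1-3)], assumption, rule that)
  have fm: "f' \<in> borel_measurable borel" using W by (auto simp: W11_def)
  have [measurable]: "?h \<in> borel_measurable lebesgue" by (rule borel_measurable_integrable[OF e(1)])
  have [measurable]: "?G \<in> borel_measurable lebesgue" by (rule borel_measurable_integrable[OF e(2)])
  have sf: "{x. f' x \<noteq> 0} \<in> sets borel" using fm by measurable
  have D: "{x \<in> \<Omega>. ?h x \<noteq> 0} = {x \<in> space lebesgue. ?h x \<noteq> 0}" using test_function_outside[OF \<eta>] by auto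
  have sD: "{x \<in> \<Omega>. ?h x \<noteq> 0} \<in> sets lebesgue" unfolding D by measurable
  have "emeasure lborel {x. f' x \<noteq> 0} = emeasure lebesgue {x. f' x \<noteq> 0}" using sf by simp
  also have "\<dots> = emeasure lebesgue {x \<in> \<Omega>. ?h x \<noteq> 0}"
  proof (rule emeasure_eq_AE)
    show "AE x in lebesgue. (x \<in> {x. f' x \<noteq> 0}) = (x \<in> {x \<in> \<Omega>. ?h x \<noteq> 0})"
      using f' unfolding D by eventually_elim auto
  qed (use sf sD in auto)
  finally have small': "emeasure lborel {x. f' x \<noteq> 0} \<le> ennreal (\<rho> ^ CARD('n) / 2)" using small by simp
  have p1: "(\<integral>\<^sup>+x. ennreal (1 * (\<bar>?h x\<bar> / r) powr p) \<partial>lebesgue) \<le> ennreal (L * (\<rho> / r)) * (\<integral>\<^sup>+x. ennreal (1 * norm (?G x) powr p) \<partial>lebesgue)"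
  proof -
    obtain K where K: "K \<ge> 0" "cell_weight p (ennreal K) (\<lambda>_ :: real^'n. 1)" "(4 ^ (CARD('n) + 1) * CARD('n)) powr p * K \<le> L"
      using L unfolding faber_krahn_const_def by blast
    show ?thesis
      by (rule faber_krahn_lebesgue[OF W f' g' K(2) _ _ _ \<rho> K(1,3) small']) (use p in auto)
  qed
  have p2: "(\<integral>\<^sup>+x. ennreal (a i x * (\<bar>?h x\<bar> / r) powr q i) \<partial>lebesgue) \<le> ennreal (L * (\<rho> / r)) * (\<integral>\<^sup>+x. ennreal (a i x * norm (?G x) powr q i) \<partial>lebesgue)"
    if i: "i \<in> {1..N}" for i
  proof -
    obtain K w where K: "K \<ge> 0" "cell_weight (q i) (ennreal K) w" "AE x in lebesgue. ennreal (a i x) = w x"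
      "(4 ^ (CARD('n) + 1) * CARD('n)) powr q i * K \<le> L"
      using L i unfolding faber_krahn_const_def by blast
    show ?thesis
      by (rule faber_krahn_lebesgue[OF W f' g' K(2,3) a_nonneg[OF i] _ \<rho> K(1,4) small']) (use p q[OF i] in auto)
  qed
  have m1: "(\<lambda>x. \<bar>?h x\<bar> / r) \<in> borel_measurable lebesgue" and m2: "(\<lambda>x. norm (?G x)) \<in> borel_measurable lebesgue"
    by measurable
  have "(\<integral>\<^sup>+x. ennreal (H x (\<bar>?h x\<bar> / r)) \<partial>lebesgue)
    \<le> ennreal (L * (\<rho> / r)) * (\<integral>\<^sup>+x. ennreal (1 * norm (?G x) powr p) \<partial>lebesgue)
      + (\<Sum>i=1..N. ennreal (L * (\<rho> / r)) * (\<integral>\<^sup>+x. ennreal (a i x * norm (?G x) powr q i) \<partial>lebesgue))"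
    unfolding nn_integral_H[OF m1] by (intro add_mono sum_mono p1 p2)
  also have "\<dots> = ennreal (L * (\<rho> / r)) * (\<integral>\<^sup>+x. ennreal (H x (norm (?G x))) \<partial>lebesgue)"
    unfolding nn_integral_H[OF m2] distrib_left sum_distrib_left ..
  finally show ?thesis .
qed

end

section \<open>Cutoffs whose gradient is controlled by a power of the cutoff\<close>

text \<open>Its gradient is bounded by a power 1 - 1 / Q < 1 of the function itself, since
y^(-2) exp (- 1 / y) \<le> C exp (- (1 - 1 / Q) / y).\<close>

definition cutoff :: "real \<Rightarrow> real^'n \<Rightarrow> real \<Rightarrow> real \<Rightarrow> real^'n \<Rightarrow> real"
  where "cutoff Q c s \<tau> x = bump ((s\<^sup>2 - norm (x - c) ^ 2) * (1 / (\<tau> * Q)))"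

lemma cutoff_nonneg [simp]: "0 \<le> cutoff Q c s \<tau> x" and cutoff_le_1 [simp]: "cutoff Q c s \<tau> x \<le> 1"
  by (simp_all add: cutoff_def)

lemma cutoff_pos_iff:
  assumes "Q > 0" "\<tau> > 0" "s > 0"
  shows "0 < cutoff Q c s \<tau> x \<longleftrightarrow> x \<in> ball c s"
proof -
  have "0 < cutoff Q c s \<tau> x \<longleftrightarrow> norm (x - c) ^ 2 < s\<^sup>2" using assms by (simp add: cutoff_def zero_less_mult_iff zero_less_divide_iff mult_less_0_iff)
  also have "\<dots> \<longleftrightarrow> norm (x - c) < s" using assms by (metis abs_norm_cancel abs_of_pos power2_less_imp_less power_strict_mono norm_ge_zero zero_less_numeral less_imp_le)
  finally show ?thesis by (simp add: dist_norm norm_minus_commute)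
qed

lemma smooth_cutoff: "smooth (cutoff Q c s \<tau>)"
  unfolding cutoff_def by (intro smooth_bump smooth_mult smooth_diff smooth_const smooth_norm_power2)

lemma cutoff_test_function:
  assumes "Q > 0" "\<tau> > 0" "s > 0" "compactly_contained (ball c s) \<Omega>"
  shows "cutoff Q c s \<tau> \<in> test_functions \<Omega>"
proof -
  have "cutoff Q c s \<tau> x \<noteq> 0 \<longleftrightarrow> 0 < cutoff Q c s \<tau> x" for x
    by (rule iffI; use cutoff_nonneg[of Q c s \<tau> x] in linarith)
  then have "{x. cutoff Q c s \<tau> x \<noteq> 0} = ball c s"
    unfolding cutoff_pos_iff[OF assms(1-3)] by (simp only: set_eq_iff mem_Collect_eq) simp
  then show ?thesis using assms(4) by (simp add: test_functions_iff smooth_cutoff)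
qed

text \<open>The argument of the bump is at least 1 / Q here, so the lower bound does not depend on
  \<tau>, that is, on the width of the transition layer.\<close>

lemma cutoff_ge:
  assumes "Q > 0" "\<tau> > 0" "s\<^sup>2 - norm (x - c) ^ 2 \<ge> \<tau>"
  shows "cutoff Q c s \<tau> x \<ge> exp (- Q)"
proof -
  define y where "y = (s\<^sup>2 - norm (x - c) ^ 2) * (1 / (\<tau> * Q))"
  have "y \<ge> \<tau> * (1 / (\<tau> * Q))" unfolding y_def using assms by (intro mult_right_mono) auto
  then have y: "y \<ge> 1 / Q" using assms by simp
  have Q: "1 / Q > 0" using assms by simp
  have y0: "y > 0" using y Q by linarith
  have "1 \<le> Q * y" using y assms(1) by (simp add: pos_divide_le_eq mult.commute)
  then have "1 / y \<le> Q" using y0 by (simp add: pos_divide_le_eq)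
  then show ?thesis unfolding cutoff_def y_def[symmetric] using y0 by (simp add: bump_eq)
qed

text \<open>Let y be the argument of the bump and z = 1 / (y Q). The gradient is a multiple of z^2
  exp(-1/y), while the cutoff to the power 1 - 1/Q is exp(-1/y) exp z. Hence z^2 <= 4 exp z
  suffices; the other factor 2 of the 8 comes from differentiating the square of the norm.\<close>

lemma norm_grad_cutoff_le:
  fixes c :: "real^'n"
  assumes Q: "Q \<ge> 1" and \<tau>: "\<tau> > 0" and s: "s > 0"
  shows "norm (grad (cutoff Q c s \<tau>) x) \<le> 8 * Q * s / \<tau> * cutoff Q c s \<tau> x powr (1 - 1 / Q)"
proof -
  define \<kappa> where "\<kappa> = 1 / (\<tau> * Q)"
  have \<kappa>: "\<kappa> > 0" unfolding \<kappa>_def using Q \<tau> by simp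
  define y where "y = (s\<^sup>2 - norm (x - c) ^ 2) * \<kappa>"
  define b' where "b' = flat_fun (monom 1 2 * ([:1:] - pderiv [:1:])) y"
  have d: "((\<lambda>x. (s\<^sup>2 - norm (x - c) ^ 2) * \<kappa>) has_derivative (\<lambda>v. - 2 * ((x - c) \<bullet> v) * \<kappa>)) (at x)"
    unfolding power2_norm_eq_inner by (auto intro!: derivative_eq_intros simp: inner_commute algebra_simps)
  have "((\<lambda>x. bump ((s\<^sup>2 - norm (x - c) ^ 2) * \<kappa>)) has_derivative (\<lambda>v. b' * (- 2 * ((x - c) \<bullet> v) * \<kappa>))) (at x)"
    using diff_chain_at[OF d flat_fun_has_derivative[of "[:1:]", unfolded has_field_derivative_def]]
    unfolding bump_def b'_def y_def o_def by simp
  then have "(cutoff Q c s \<tau> has_derivative (\<lambda>v. b' * (- 2 * ((x - c) \<bullet> v) * \<kappa>))) (at x)"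
    unfolding cutoff_def[abs_def] \<kappa>_def by simp
  from partial_deriv_eq[OF this] have "grad (cutoff Q c s \<tau>) x = (b' * - 2 * \<kappa>) *\<^sub>R (x - c)"
    by (simp add: vec_eq_iff inner_axis algebra_simps)
  then have ng: "norm (grad (cutoff Q c s \<tau>) x) = \<bar>b'\<bar> * 2 * \<kappa> * norm (x - c)" using \<kappa> by (simp add: abs_mult)
  show ?thesis
  proof (cases "y > 0")
    case False
    then have "b' = 0" by (simp add: b'_def flat_fun_def)
    then show ?thesis using ng Q \<tau> s by simp
  next
    case True
    have xs2: "norm (x - c) ^ 2 < s\<^sup>2"
    proof (rule ccontr)
      assume "\<not> ?thesis"
      then have "y \<le> 0" unfolding y_def using \<kappa> by (intro mult_nonpos_nonneg) auto
      then show False using True by linarith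
    qed
    have xs: "norm (x - c) \<le> s" by (rule power2_le_imp_le[OF less_imp_le[OF xs2] less_imp_le[OF s]])
    define z where "z = 1 / (y * Q)"
    have z: "z > 0" unfolding z_def using True Q by simp
    have b': "b' = (Q * z)\<^sup>2 * exp (- (1 / y))"
      unfolding b'_def flat_fun_def z_def using True Q by (simp add: poly_monom pderiv_pCons power_divide power2_eq_square)
    have cut: "cutoff Q c s \<tau> x powr (1 - 1 / Q) = exp (- (1 / y)) * exp z"
    proof -
      have "cutoff Q c s \<tau> x = exp (- (1 / y))" using True unfolding cutoff_def y_def \<kappa>_def by (simp add: bump_eq)
      then have "cutoff Q c s \<tau> x powr (1 - 1 / Q) = exp ((1 - 1 / Q) * - (1 / y))" by (simp add: powr_def)
      also have "(1 - 1 / Q) * - (1 / y) = - (1 / y) + z" unfolding z_def using Q True by (simp add: field_simps)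
      finally show ?thesis by (simp only: exp_add)
    qed
    have "z\<^sup>2 \<le> 4 * exp z"
    proof -
      have "z / 2 \<le> exp (z / 2)" using exp_ge_add_one_self[of "z / 2"] by linarith
      then have "(z / 2)\<^sup>2 \<le> (exp (z / 2))\<^sup>2" using z by (intro power_mono) auto
      also have "(exp (z / 2))\<^sup>2 = exp z" by (simp add: power2_eq_square flip: exp_add)
      finally show ?thesis by (simp add: power_divide)
    qed
    have "norm (grad (cutoff Q c s \<tau>) x) = (Q\<^sup>2 * z\<^sup>2 * 2 * \<kappa> * norm (x - c)) * exp (- (1 / y))"
      unfolding ng b' by (simp add: abs_mult power_mult_distrib)
    also have "\<dots> \<le> (Q\<^sup>2 * (4 * exp z) * 2 * \<kappa> * s) * exp (- (1 / y))"
      using \<open>z\<^sup>2 \<le> 4 * exp z\<close> xs \<kappa> s by (intro mult_right_mono mult_mono mult_left_mono) auto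
    also have "\<dots> = (Q\<^sup>2 * \<kappa>) * (8 * s) * (exp (- (1 / y)) * exp z)" by (simp only: mult_ac)
    also have "Q\<^sup>2 * \<kappa> = Q / \<tau>" unfolding \<kappa>_def using Q \<tau> by (simp add: power2_eq_square)
    also have "Q / \<tau> * (8 * s) * (exp (- (1 / y)) * exp z) = 8 * Q * s / \<tau> * (exp (- (1 / y)) * exp z)" by simp
    finally show ?thesis unfolding cut .
  qed
qed

section \<open>Decay of the energies on shrinking balls and rising levels\<close>

context multiphase_integrand
begin

lemma H_measurable_lebesgue:
  assumes "f \<in> borel_measurable lebesgue"
  shows "(\<lambda>x. H x (f x)) \<in> borel_measurable lebesgue"
proof -
  have "(\<lambda>x. f x powr e) \<in> borel_measurable lebesgue" for e
    using assms by measurable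
  then show ?thesis unfolding multiphase_def
    by (intro borel_measurable_add borel_measurable_sum borel_measurable_times a_measurable)
qed

text \<open>The losses of one step: exp(Q Q) for inserting the cutoff, L from Faber--Krahn, 2 * 2^Q
  from the gradient energy, and (16 Q)^Q from the gradient of the cutoff up to its growth 2^(j
  Q).\<close>

definition de_giorgi_const :: "real \<Rightarrow> real"
  where "de_giorgi_const L = exp (Q * Q) * L * (2 * 2 powr Q) * (16 * Q) powr Q"

text \<open>The rate at which the Chebyshev threshold times the allowed measure decays: 2^(-p) per
  step from the level gap and 2^(-Q n) from \<rho>^n.\<close>

definition de_giorgi_ratio :: real
  where "de_giorgi_ratio = 2 powr (- (Q * CARD('n) + p))"

text \<open>The quotient makes one step contract by \<open>de_giorgi_ratio\<close>; the minimum with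
  1 keeps \<rho> <= r.\<close>

definition de_giorgi_delta :: "real \<Rightarrow> real"
  where "de_giorgi_delta L = min 1 (de_giorgi_ratio / de_giorgi_const L)"

theorem de_giorgi:
  fixes \<Omega> :: "(real^'n) set"
  assumes \<Omega>: "open \<Omega>" "bounded \<Omega>" and min: "local_minimizer H \<Omega> u"
    and wg: "is_weak_gradient \<Omega> u g" and u: "u \<in> modular_class H \<Omega>" and g: "(\<lambda>x. norm (g x)) \<in> modular_class H \<Omega>"
    and \<sigma>: "\<sigma> = 1 \<or> \<sigma> = -1" and L: "0 < L" "faber_krahn_const L"
    and r: "0 < r" and B: "compactly_contained (ball c (2 * r)) \<Omega>" and Y: "0 < Y"
    and initial: "(\<integral>\<^sup>+x. indicator (ball c (2 * r)) x * ennreal (H x (excess u \<sigma> m 0 x / r)) \<partial>lebesgue) \<le> ennreal (Y * r ^ CARD('n))"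
  defines "d \<equiv> r * (2 powr (p + 1) * Y / de_giorgi_delta L ^ CARD('n)) powr (1 / p)"
  shows "AE x in lebesgue. x \<in> ball c r \<longrightarrow> excess u \<sigma> m d x = 0"
proof -
  let ?n = "CARD('n)"
  define \<kappa> where "\<kappa> = de_giorgi_ratio"
  define C where "C = de_giorgi_const L"
  define \<delta> where "\<delta> = de_giorgi_delta L"
  have Q1: "1 < Q" using p pQ by simp
  have \<kappa>: "0 < \<kappa>" "\<kappa> < 1"
  proof -
    have "0 < Q * CARD('n) + p" using p Q1 by (intro add_nonneg_pos mult_nonneg_nonneg) auto
    then show "0 < \<kappa>" "\<kappa> < 1" unfolding \<kappa>_def de_giorgi_ratio_def by (auto intro: powr_less_one)
  qed
  have C: "0 < C" unfolding C_def de_giorgi_const_def using L Q1 by simp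
  have \<delta>: "0 < \<delta>" "\<delta> \<le> 1" "C * \<delta> \<le> \<kappa>"
  proof -
    show "0 < \<delta>" "\<delta> \<le> 1" unfolding \<delta>_def de_giorgi_delta_def using \<kappa> C by (auto simp: \<kappa>_def C_def)
    have "\<delta> \<le> \<kappa> / C" unfolding \<delta>_def de_giorgi_delta_def \<kappa>_def C_def by simp
    then show "C * \<delta> \<le> \<kappa>" using C by (simp add: field_simps)
  qed
  have d: "d > 0" unfolding d_def using r Y \<delta> by (simp add: \<delta>_def)
  have dp: "(d / r) powr p = 2 powr (p + 1) * Y / \<delta> ^ ?n"
    unfolding d_def \<delta>_def[symmetric] using r Y \<delta> p by (simp add: powr_powr)
  define rad where "rad j = r * (1 + 1 / 2 ^ j)" for j :: nat
  define lev where "lev j = d * (1 - 1 / 2 ^ j)" for j :: nat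
  define e where "e j = excess u \<sigma> m (lev j)" for j
  have e0: "0 \<le> e j x" for j x unfolding e_def by simp
  have rad: "r < rad j" "rad j \<le> 2 * r" for j unfolding rad_def using r by (auto simp: field_simps)
  have rad_diff: "(rad j)\<^sup>2 - (rad (Suc j))\<^sup>2 \<ge> r\<^sup>2 / 2 ^ j" for j
  proof -
    have "rad j - rad (Suc j) = r / 2 ^ Suc j" unfolding rad_def by (simp add: field_simps)
    then have "(rad j)\<^sup>2 - (rad (Suc j))\<^sup>2 = r / 2 ^ Suc j * (rad j + rad (Suc j))"
      by (simp add: power2_eq_square square_diff_square_factored mult.commute)
    also have "\<dots> \<ge> r / 2 ^ Suc j * (2 * r)" using rad(1)[of j] rad(1)[of "Suc j"] r by (intro mult_left_mono) auto
    finally show ?thesis by (simp add: power2_eq_square)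
  qed
  have e_mono: "e (Suc j) x \<le> e j x" for j x
  proof -
    have "lev j \<le> lev (Suc j)" unfolding lev_def using d by (intro mult_left_mono) (auto simp: field_simps)
    then show ?thesis unfolding e_def excess_def by auto
  qed
  \<comment> \<open>Where the excess over the next level is positive, the present excess is at least
    the difference of the two levels. This is the threshold for Chebyshev's inequality.\<close>
  have e_gap: "e j x \<ge> d / 2 ^ Suc j" if "e (Suc j) x > 0" for j x
  proof -
    have "lev (Suc j) = lev j + d / 2 ^ Suc j" unfolding lev_def by (simp add: field_simps)
    then show ?thesis using that unfolding e_def excess_def by auto
  qed
  define \<Phi> where "\<Phi> j = (\<integral>\<^sup>+x. indicator (ball c (rad j)) x * ennreal (H x (e j x / r)) \<partial>lebesgue)" for j
  have sub: "ball c (rad j) \<subseteq> \<Omega>" for j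
  proof -
    have "ball c (rad j) \<subseteq> ball c (2 * r)" using rad by (intro subset_ball) auto
    also have "\<dots> \<subseteq> \<Omega>" using B closure_subset by (auto simp: compactly_contained_def)
    finally show ?thesis .
  qed
  have em: "e j \<in> borel_measurable (lebesgue_on \<Omega>)" for j
  proof -
    have [measurable]: "u \<in> borel_measurable (lebesgue_on \<Omega>)" using u by (simp add: modular_class_def)
    show ?thesis unfolding e_def excess_def[abs_def] by measurable
  qed
  have Om: "\<Omega> \<inter> space lebesgue \<in> sets lebesgue" using \<Omega> by simp
  have lift: "(\<lambda>x. indicator S x * F x) \<in> borel_measurable lebesgue"
    if "S \<in> sets lebesgue" "S \<subseteq> \<Omega>" "F \<in> borel_measurable (lebesgue_on \<Omega>)" for S and F :: "real^'n \<Rightarrow> ennreal"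
  proof -
    have "(\<lambda>x. F x * indicator \<Omega> x) \<in> borel_measurable lebesgue"
      using that(3) borel_measurable_restrict_space_iff_ennreal[OF Om, of F] by simp
    from borel_measurable_times_ennreal[OF borel_measurable_indicator[OF that(1)] this]
    have "(\<lambda>x. indicator S x * (F x * indicator \<Omega> x)) \<in> borel_measurable lebesgue" .
    moreover have "indicator S x * (F x * indicator \<Omega> x) = indicator S x * F x" for x using that(2) by (auto simp: indicator_def)
    ultimately show ?thesis by simp
  qed
  have Hm: "(\<lambda>x. ennreal (H x (e j x / r))) \<in> borel_measurable (lebesgue_on \<Omega>)" for j
  proof -
    have "(\<lambda>x. e j x / r) \<in> borel_measurable (lebesgue_on \<Omega>)" using em by measurable
    from H_measurable[OF this] show ?thesis by measurable
  qed
  have step: "\<Phi> (Suc j) \<le> ennreal \<kappa> * \<Phi> j" if IH: "\<Phi> j \<le> ennreal (Y * r ^ ?n * \<kappa> ^ j)" for j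
  proof -
    \<comment> \<open>A lower bound for the difference of the squared radii, so that the cutoff is
      bounded below on the whole next ball.\<close>
    define \<tau> where "\<tau> = r\<^sup>2 / 2 ^ j"
    have \<tau>: "\<tau> > 0" unfolding \<tau>_def using r by simp
    have rj: "rad j > 0" using rad(1)[of j] r by linarith
    define \<eta> where "\<eta> = cutoff Q c (rad j) \<tau>"
    have "compactly_contained (ball c (rad j)) \<Omega>"
      using rad by (intro compactly_contained_subset[OF B subset_ball order_refl]) auto
    then have \<eta>: "\<eta> \<in> test_functions \<Omega>" "\<And>x. 0 \<le> \<eta> x" "\<And>x. \<eta> x \<le> 1"
      unfolding \<eta>_def using Q1 \<tau> rj by (auto intro!: cutoff_test_function)
    \<comment> \<open>8 Q \<open>rad j\<close> / \<tau>, with \<open>rad j\<close> replaced by its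
      upper bound 2 r.\<close>
    define M where "M = 16 * Q * 2 ^ j / r"
    have M0: "0 \<le> M" unfolding M_def using Q1 r by simp
    have grad\<eta>: "norm (grad \<eta> x) \<le> M * \<eta> x powr (1 - 1 / Q)" for x
    proof -
      have "norm (grad \<eta> x) \<le> 8 * Q * rad j / \<tau> * \<eta> x powr (1 - 1 / Q)"
        unfolding \<eta>_def using Q1 \<tau> rj by (intro norm_grad_cutoff_le) auto
      also have "\<dots> \<le> M * \<eta> x powr (1 - 1 / Q)"
      proof (intro mult_right_mono)
        have "8 * Q * rad j / \<tau> \<le> 8 * Q * (2 * r) / \<tau>" using rad(2)[of j] Q1 \<tau> by (intro divide_right_mono mult_left_mono) auto
        also have "\<dots> = M" unfolding \<tau>_def M_def using r by (simp add: power2_eq_square)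
        finally show "8 * Q * rad j / \<tau> \<le> M" .
      qed simp
      finally show ?thesis .
    qed
    define D where "D = {x \<in> \<Omega>. \<eta> x * e (Suc j) x \<noteq> 0}"
    note step_facts = \<Omega> min wg u g \<sigma> \<eta> M0 grad\<eta>
    have Ds: "D \<in> sets lebesgue"
      unfolding D_def e_def by (rule excess_facts(7)[OF step_facts])
    have D_ball: "x \<in> ball c (rad j)" and D_e: "e (Suc j) x > 0" if "x \<in> D" for x
    proof -
      have "\<eta> x \<noteq> 0" "e (Suc j) x \<noteq> 0" using that by (auto simp: D_def)
      then have "\<eta> x > 0" "e (Suc j) x > 0" using \<eta>(2)[of x] e0[of "Suc j" x] by linarith+
      then show "x \<in> ball c (rad j)" "e (Suc j) x > 0" using cutoff_pos_iff[of Q \<tau> "rad j" c x] Q1 \<tau> rj unfolding \<eta>_def by auto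
    qed
    \<comment> \<open>The factor 2^(-Q j) is there to cancel the growth of (M r)^Q in j.\<close>
    define \<rho> where "\<rho> = \<delta> * r * 2 powr (- (Q * j))"
    have \<rho>0: "0 < \<rho>" unfolding \<rho>_def using \<delta> r by simp
    have \<rho>r: "\<rho> \<le> r"
    proof -
      have "2 powr (- (Q * j)) \<le> 1" using Q1 by (simp add: powr_minus inverse_le_1_iff ge_one_powr_ge_zero)
      then have "\<delta> * 2 powr (- (Q * j)) \<le> 1" using \<delta> by (intro mult_le_one) auto
      then show ?thesis unfolding \<rho>_def using mult_right_mono[of "\<delta> * 2 powr (- (Q * j))" 1 r] r by (simp add: mult_ac)
    qed
    have small: "emeasure lebesgue D \<le> ennreal (\<rho> ^ ?n / 2)"
    proof -
      define \<theta> where "\<theta> = (d / 2 ^ Suc j / r) powr p"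
      have \<theta>: "\<theta> > 0" unfolding \<theta>_def using d r by simp
      have "ennreal \<theta> * emeasure lebesgue D = (\<integral>\<^sup>+x. ennreal \<theta> * indicator D x \<partial>lebesgue)"
        using Ds by (subst nn_integral_cmult_indicator) auto
      also have "\<dots> \<le> \<Phi> j"
        unfolding \<Phi>_def
      proof (rule nn_integral_mono)
        fix x
        show "ennreal \<theta> * indicator D x \<le> indicator (ball c (rad j)) x * ennreal (H x (e j x / r))"
        proof (cases "x \<in> D")
          case True
          have "\<theta> \<le> (e j x / r) powr p"
            unfolding \<theta>_def using e_gap[OF D_e[OF True]] d r p by (intro powr_mono2 divide_right_mono) auto
          also have "\<dots> \<le> H x (e j x / r)" by (rule H_ge_powr)
          finally show ?thesis using True D_ball[OF True] by (simp add: ennreal_leI)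
        qed simp
      qed
      also have "\<dots> \<le> ennreal (Y * r ^ ?n * \<kappa> ^ j)" by (rule IH)
      \<comment> \<open>An exact identity, for which d and \<kappa> were chosen. In 2^(p+1) the part
        2^p accounts for the level gap d / 2^(j+1) instead of d / 2^j, and the last 2 for the half
        in \<rho>^n / 2; \<delta>^n cancels.\<close>
      also have "Y * r ^ ?n * \<kappa> ^ j = \<theta> * (\<rho> ^ ?n / 2)"
      proof -
        have t1: "\<theta> = (2 powr (p + 1) * Y / \<delta> ^ ?n) / (2 powr (Suc j)) powr p"
        proof -
          have pw: "2 powr real (Suc j) = (2::real) ^ Suc j" by (rule powr_realpow) simp
          have "\<theta> = ((d / r) / 2 ^ Suc j) powr p" unfolding \<theta>_def by (simp add: mult.commute)
          also have "\<dots> = (d / r) powr p / (2 ^ Suc j) powr p" by (rule powr_divide)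
          finally show ?thesis unfolding dp pw .
        qed
        have t2: "\<rho> ^ ?n = \<delta> ^ ?n * r ^ ?n * 2 powr (- (Q * j) * ?n)"
          unfolding \<rho>_def by (simp add: power_mult_distrib powr_power mult_ac)
        have t3: "\<kappa> ^ j = 2 powr (- (Q * ?n + p) * j)"
          unfolding \<kappa>_def de_giorgi_ratio_def by (simp add: powr_power algebra_simps)
        have "2 powr (p + 1) / (2 powr (Suc j)) powr p * 2 powr (- (Q * j) * ?n) / 2 = 2 powr (p + 1 - Suc j * p + (- (Q * j) * ?n) - 1)"
          by (simp only: powr_powr powr_diff powr_add) simp
        also have "p + 1 - Suc j * p + (- (Q * j) * ?n) - 1 = - (Q * ?n + p) * j" by (simp add: algebra_simps)
        finally have "\<kappa> ^ j = 2 powr (p + 1) / (2 powr (Suc j)) powr p * 2 powr (- (Q * j) * ?n) / 2" unfolding t3 ..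
        then show ?thesis unfolding t1 t2 using \<delta> by simp
      qed
      also have "ennreal (\<theta> * (\<rho> ^ ?n / 2)) = ennreal \<theta> * ennreal (\<rho> ^ ?n / 2)"
        by (rule ennreal_mult) (use \<theta> \<rho>0 in auto)
      finally have "ennreal \<theta> * emeasure lebesgue D \<le> ennreal \<theta> * ennreal (\<rho> ^ ?n / 2)" .
      then show ?thesis using \<theta> by (subst (asm) ennreal_mult_le_mult_iff) (auto simp: less_top)
    qed
    let ?h = "\<lambda>x. \<eta> x * e (Suc j) x"
    \<comment> \<open>On the smaller ball \<eta> >= exp(-Q), so inserting \<eta> costs exp Q in the
      argument of H and hence exp(Q Q) outside.\<close>
    have "\<Phi> (Suc j) \<le> (\<integral>\<^sup>+x. ennreal (exp (Q * Q)) * ennreal (H x (\<bar>?h x\<bar> / r)) \<partial>lebesgue)"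
      unfolding \<Phi>_def
    proof (rule nn_integral_mono)
      fix x
      show "indicator (ball c (rad (Suc j))) x * ennreal (H x (e (Suc j) x / r)) \<le> ennreal (exp (Q * Q)) * ennreal (H x (\<bar>?h x\<bar> / r))"
      proof (cases "x \<in> ball c (rad (Suc j))")
        case True
        then have "norm (x - c) < rad (Suc j)" by (simp add: dist_norm norm_minus_commute)
        then have "norm (x - c) ^ 2 \<le> (rad (Suc j))\<^sup>2" by (intro power_mono) auto
        then have "(rad j)\<^sup>2 - norm (x - c) ^ 2 \<ge> \<tau>" using rad_diff[of j] unfolding \<tau>_def by linarith
        then have "\<eta> x \<ge> exp (- Q)" unfolding \<eta>_def using Q1 \<tau> by (intro cutoff_ge) auto
        then have "exp Q * \<eta> x \<ge> exp Q * exp (- Q)" by (intro mult_left_mono) auto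
        then have "1 \<le> exp Q * \<eta> x" by (simp flip: exp_add)
        from mult_right_mono[OF this e0[of "Suc j" x]]
        have "e (Suc j) x / r \<le> exp Q * (\<bar>?h x\<bar> / r)" using e0[of "Suc j" x] \<eta>(2)[of x] r by (simp add: divide_right_mono mult.assoc abs_mult)
        then have "H x (e (Suc j) x / r) \<le> H x (exp Q * (\<bar>?h x\<bar> / r))" using e0 r by (intro H_mono) auto
        also have "\<dots> \<le> exp Q powr Q * H x (\<bar>?h x\<bar> / r)" using Q1 r by (intro H_scale) auto
        also have "exp Q powr Q = exp (Q * Q)" by (simp add: powr_def)
        finally show ?thesis using True by (simp add: ennreal_leI flip: ennreal_mult)
      qed simp
    qed
    also have "\<dots> = ennreal (exp (Q * Q)) * (\<integral>\<^sup>+x. ennreal (H x (\<bar>?h x\<bar> / r)) \<partial>lebesgue)"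
    proof (rule nn_integral_cmult)
      have "?h \<in> borel_measurable lebesgue"
        unfolding e_def by (rule borel_measurable_integrable[OF excess_weak_gradient(1)[OF \<Omega>(1) wg \<eta>(1)]])
      then have "(\<lambda>x. \<bar>?h x\<bar> / r) \<in> borel_measurable lebesgue" by measurable
      from H_measurable_lebesgue[OF this] show "(\<lambda>x. ennreal (H x (\<bar>?h x\<bar> / r))) \<in> borel_measurable lebesgue" by measurable
    qed
    also have "\<dots> \<le> ennreal (exp (Q * Q)) * (ennreal (L * (\<rho> / r)) * (\<integral>\<^sup>+x. ennreal (H x (norm (excess_grad u g \<sigma> m (lev (Suc j)) \<eta> x))) \<partial>lebesgue))"
      using faber_krahn_H[OF \<Omega>(1) wg \<eta>(1) L(2) \<rho>0 \<rho>r small[unfolded D_def e_def]]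
      unfolding e_def by (intro mult_left_mono) auto
    also have "\<dots> \<le> ennreal (exp (Q * Q)) * (ennreal (L * (\<rho> / r)) * (ennreal (2 * 2 powr Q) * (\<integral>\<^sup>+x. indicator D x * ennreal (H x (M * e (Suc j) x)) \<partial>lebesgue)))"
      using excess_gradient_energy[OF step_facts, of m "lev (Suc j)"]
      unfolding D_def e_def by (intro mult_left_mono) auto
    \<comment> \<open>M times the excess is at most M r >= 1 times the earlier excess divided by r,
      so \<open>H_scale\<close> returns to the density of \<open>\<Phi> j\<close>.\<close>
    also have "(\<integral>\<^sup>+x. indicator D x * ennreal (H x (M * e (Suc j) x)) \<partial>lebesgue) \<le> (\<integral>\<^sup>+x. ennreal ((M * r) powr Q) * (indicator (ball c (rad j)) x * ennreal (H x (e j x / r))) \<partial>lebesgue)"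
    proof (rule nn_integral_mono)
      fix x
      show "indicator D x * ennreal (H x (M * e (Suc j) x)) \<le> ennreal ((M * r) powr Q) * (indicator (ball c (rad j)) x * ennreal (H x (e j x / r)))"
      proof (cases "x \<in> D")
        case True
        have "1 \<le> (2::real) ^ j" by simp
        then have "1 * 1 \<le> Q * 2 ^ j" using Q1 by (intro mult_mono) auto
        then have Mr: "1 \<le> M * r" unfolding M_def using r by simp
        have "M * e (Suc j) x \<le> (M * r) * (e j x / r)" using e_mono[of j x] M0 r by (simp add: mult_left_mono)
        then have "H x (M * e (Suc j) x) \<le> H x ((M * r) * (e j x / r))" using M0 e0 by (intro H_mono) auto
        also have "\<dots> \<le> (M * r) powr Q * H x (e j x / r)" using Mr e0 r by (intro H_scale) auto
        finally have "ennreal (H x (M * e (Suc j) x)) \<le> ennreal ((M * r) powr Q) * ennreal (H x (e j x / r))"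
          by (simp add: ennreal_leI flip: ennreal_mult)
        then show ?thesis using True D_ball[OF True] by simp
      qed simp
    qed
    also have "\<dots> = ennreal ((M * r) powr Q) * \<Phi> j"
      unfolding \<Phi>_def using sub by (intro nn_integral_cmult lift Hm) auto
    finally have "\<Phi> (Suc j) \<le> ennreal (exp (Q * Q)) * (ennreal (L * (\<rho> / r)) * (ennreal (2 * 2 powr Q) * (ennreal ((M * r) powr Q) * \<Phi> j)))"
      by (simp add: mult_left_mono)
    also have "\<dots> = ennreal (exp (Q * Q) * (L * (\<rho> / r)) * (2 * 2 powr Q) * (M * r) powr Q) * \<Phi> j"
    proof -
      have "ennreal (exp (Q * Q) * (L * (\<rho> / r)) * (2 * 2 powr Q) * (M * r) powr Q)
        = ennreal (exp (Q * Q)) * ennreal (L * (\<rho> / r)) * ennreal (2 * 2 powr Q) * ennreal ((M * r) powr Q)"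
        using L(1) \<rho>0 r by (subst ennreal_mult | simp)+
      then show ?thesis by (simp only: mult.assoc)
    qed
    \<comment> \<open>All dependence on j cancels between \<rho> / r and (M r)^Q, leaving only
      \<delta>.\<close>
    also have "exp (Q * Q) * (L * (\<rho> / r)) * (2 * 2 powr Q) * (M * r) powr Q = C * \<delta>"
    proof -
      have e1: "(M * r) powr Q = (16 * Q) powr Q * 2 powr (j * Q)"
      proof -
        have "M * r = 16 * Q * 2 powr j" unfolding M_def using r by (simp add: powr_realpow)
        then show ?thesis using Q1 by (simp only: powr_mult powr_powr)
      qed
      have e2: "\<rho> / r * 2 powr (j * Q) = \<delta>"
        unfolding \<rho>_def using r by (simp add: powr_minus mult.commute)
      have "exp (Q * Q) * (L * (\<rho> / r)) * (2 * 2 powr Q) * (M * r) powr Q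
        = exp (Q * Q) * L * (2 * 2 powr Q) * (16 * Q) powr Q * (\<rho> / r * 2 powr (j * Q))"
        unfolding e1 by (simp only: mult_ac)
      then show ?thesis unfolding e2 C_def de_giorgi_const_def .
    qed
    also have "ennreal (C * \<delta>) * \<Phi> j \<le> ennreal \<kappa> * \<Phi> j" using \<delta> by (intro mult_right_mono ennreal_leI) auto
    finally show ?thesis .
  qed
  have bound: "\<Phi> j \<le> ennreal (Y * r ^ ?n * \<kappa> ^ j)" for j
  proof (induction j)
    case 0
    have z: "rad 0 = 2 * r" "lev 0 = 0" by (simp_all add: rad_def lev_def)
    show ?case using initial unfolding \<Phi>_def e_def z by simp
  next
    case (Suc j)
    have "\<Phi> (Suc j) \<le> ennreal \<kappa> * \<Phi> j" by (rule step[OF Suc])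
    also have "\<dots> \<le> ennreal \<kappa> * ennreal (Y * r ^ ?n * \<kappa> ^ j)" using Suc by (intro mult_left_mono) auto
    also have "\<dots> = ennreal (Y * r ^ ?n * \<kappa> ^ Suc j)" using \<kappa> Y r by (simp add: mult_ac flip: ennreal_mult)
    finally show ?case .
  qed
  \<comment> \<open>All levels lie below d and all radii above r, so the energy at height d on the
    ball of radius r is below every \<open>\<Phi> j\<close>, hence 0.\<close>
  have "excess u \<sigma> m d x \<le> e j x" for j x
  proof -
    have "lev j \<le> d" unfolding lev_def using d by (simp add: mult_left_le)
    then show ?thesis unfolding e_def excess_def by auto
  qed
  then have "(\<integral>\<^sup>+x. indicator (ball c r) x * ennreal (H x (excess u \<sigma> m d x / r)) \<partial>lebesgue) \<le> \<Phi> j" for j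
    unfolding \<Phi>_def using rad(1)[of j] r
    by (intro nn_integral_mono mult_mono ennreal_leI H_mono divide_right_mono) (auto simp: indicator_def)
  then have le: "(\<integral>\<^sup>+x. indicator (ball c r) x * ennreal (H x (excess u \<sigma> m d x / r)) \<partial>lebesgue) \<le> ennreal (Y * r ^ ?n * \<kappa> ^ j)" for j
    using bound order_trans by blast
  have "(\<lambda>j. ennreal (Y * r ^ ?n * \<kappa> ^ j)) \<longlonglongrightarrow> ennreal (Y * r ^ ?n * 0)"
    using \<kappa> by (intro tendsto_ennrealI tendsto_mult tendsto_const LIMSEQ_power_zero) auto
  then have "(\<integral>\<^sup>+x. indicator (ball c r) x * ennreal (H x (excess u \<sigma> m d x / r)) \<partial>lebesgue) \<le> ennreal (Y * r ^ ?n * 0)"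
    using le by (intro LIMSEQ_le_const) auto
  then have zero: "(\<integral>\<^sup>+x. indicator (ball c r) x * ennreal (H x (excess u \<sigma> m d x / r)) \<partial>lebesgue) = 0" by simp
  have "ball c r \<subseteq> \<Omega>" using subset_ball[of r "rad 0" c] sub[of 0] rad(1)[of 0] by auto
  moreover have "(\<lambda>x. ennreal (H x (excess u \<sigma> m d x / r))) \<in> borel_measurable (lebesgue_on \<Omega>)"
  proof -
    have [measurable]: "u \<in> borel_measurable (lebesgue_on \<Omega>)" using u by (simp add: modular_class_def)
    have "(\<lambda>x. excess u \<sigma> m d x / r) \<in> borel_measurable (lebesgue_on \<Omega>)" unfolding excess_def by measurable
    from H_measurable[OF this] show ?thesis by measurable
  qed
  ultimately have "(\<lambda>x. indicator (ball c r) x * ennreal (H x (excess u \<sigma> m d x / r))) \<in> borel_measurable lebesgue"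
    by (intro lift) auto
  then have "AE x in lebesgue. indicator (ball c r) x * ennreal (H x (excess u \<sigma> m d x / r)) = 0"
    using zero nn_integral_0_iff_AE by blast
  then show ?thesis
  proof eventually_elim
    case (elim x)
    show ?case
    proof
      assume "x \<in> ball c r"
      then have "H x (excess u \<sigma> m d x / r) \<le> 0" using elim by (simp add: ennreal_eq_0_iff)
      then have "(excess u \<sigma> m d x / r) powr p \<le> 0" using H_ge_powr order_trans by blast
      then have "(excess u \<sigma> m d x / r) powr p = 0" by (rule antisym) simp
      then show "excess u \<sigma> m d x = 0" using r by simp
    qed
  qed
qed

end

section \<open>Constants in terms of the data, and the estimate\<close>

lemma emeasure_lebesgue_ball: "emeasure lebesgue (ball c r :: (real^'n) set) = ennreal (measure lborel (ball c r))"
proof -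
  have "emeasure lborel (ball c r) = ennreal (measure lborel (ball c r))"
    by (rule emeasure_eq_ennreal_measure) (use emeasure_bounded_finite[OF bounded_ball, of c r] in auto)
  then show ?thesis by simp
qed

text \<open>The weight of the term t^p is 1; viewing it as a Muckenhoupt weight lets
  \<open>muckenhoupt_cell_weight\<close> serve all phases.\<close>

lemma muckenhoupt_class_1:
  assumes "1 < \<gamma>"
  shows "(\<lambda>_ :: real^'n. 1) \<in> muckenhoupt_class \<gamma>" "muckenhoupt_const \<gamma> (\<lambda>_ :: real^'n. 1) = 1"
proof -
  have avg1: "nn_avg (ball c r) (\<lambda>_. 1) = 1" if "r > 0" for c :: "real^'n" and r
  proof -
    note emeasure_lebesgue_ball[of c r]
    moreover have "measure lborel (ball c r) > 0" using that by (subst content_ball_gt_0_iff)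
    ultimately show ?thesis
      unfolding nn_avg_def by (simp add: emeasure_restrict_space divide_ennreal del: emeasure_completion)
  qed
  have "muckenhoupt_const \<gamma> (\<lambda>_ :: real^'n. 1) = (SUP (c :: real^'n, r :: real) \<in> UNIV \<times> {0<..}. 1)"
    unfolding muckenhoupt_const_def by (rule SUP_cong[OF refl]) (auto simp: avg1 ennreal_powr_def)
  also have "\<dots> = 1"
  proof -
    have "(UNIV :: (real^'n) set) \<times> {0 :: real<..} \<noteq> {}" by auto
    then show ?thesis by (simp add: case_prod_unfold)
  qed
  finally show 1: "muckenhoupt_const \<gamma> (\<lambda>_ :: real^'n. 1) = 1" .
  have "locally_integrable UNIV (\<lambda>_ :: real^'n. 1 :: real)"
    unfolding locally_integrable_def
  proof (intro allI impI)
    fix K :: "(real^'n) set" assume K: "compact K \<and> K \<subseteq> UNIV"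
    have "integrable lebesgue (\<lambda>x. indicat_real K x *\<^sub>R (1 :: real))"
      using K lmeasurable_compact[of K]
      by (intro integrable_scaleR_left integrable_real_indicator) (auto simp: fmeasurable_def)
    then show "integrable (lebesgue_on K) (\<lambda>_. 1 :: real)"
      using K lmeasurable_compact[of K] by (subst integrable_restrict_space) (auto simp: fmeasurable_def)
  qed
  then show "(\<lambda>_ :: real^'n. 1) \<in> muckenhoupt_class \<gamma>" using 1 by (simp add: muckenhoupt_class_def)
qed

text \<open>The measure of a ball of radius 2 n l divided by that of a cell of side l. The argument
  of type \<open>itself\<close> makes the dependence on the dimension explicit.\<close>

definition cell_ratio :: "'n itself \<Rightarrow> real"
  where "cell_ratio _ = unit_ball_vol CARD('n) * (2 * CARD('n)) ^ CARD('n)"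

text \<open>A sum dominates each phase constant, as a maximum would. The leading 1 makes it
  positive, and the 2 is [1] + 1 for the weight 1, whose Muckenhoupt constant is 1.\<close>

definition faber_krahn_sum :: "'n itself \<Rightarrow> nat \<Rightarrow> real \<Rightarrow> (nat \<Rightarrow> real) \<Rightarrow> (nat \<Rightarrow> ennreal) \<Rightarrow> real"
  where "faber_krahn_sum n N p q A = 1 + (4 ^ (CARD('n) + 1) * CARD('n)) powr p * (cell_ratio n powr p * 2)
    + (\<Sum>i=1..N. (4 ^ (CARD('n) + 1) * CARD('n)) powr q i * (cell_ratio n powr q i * (enn2real (A i) + 1)))"

lemma faber_krahn_const_muckenhoupt:
  fixes a :: "nat \<Rightarrow> real^'n \<Rightarrow> real"
  assumes "multiphase_integrand N p Q q a"
    and a: "\<And>i. i \<in> {1..N} \<Longrightarrow> a i \<in> muckenhoupt_class (q i) \<and> muckenhoupt_const (q i) (a i) = A i"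
  shows "multiphase_integrand.faber_krahn_const N p q a (faber_krahn_sum TYPE('n) N p q A)"
proof -
  interpret multiphase_integrand N p Q q a by fact
  let ?k = "cell_ratio TYPE('n)" and ?c = "(4 ^ (CARD('n) + 1) * CARD('n))" and ?L = "faber_krahn_sum TYPE('n) N p q A"
  have pos: "0 \<le> ?c powr q i * (?k powr q i * (enn2real (A i) + 1))" for i by simp
  show ?thesis
    unfolding faber_krahn_const_def
  proof (intro conjI ballI)
    obtain w :: "real^'n \<Rightarrow> ennreal" where w: "cell_weight p (ennreal (?k powr p) * (1 + 1)) w" "AE x in lebesgue. ennreal 1 = w x"
      by (rule muckenhoupt_cell_weight[OF p muckenhoupt_class_1(1)[OF p], unfolded muckenhoupt_class_1(2)[OF p]])
         (rule that, unfold cell_ratio_def)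
    have [measurable]: "w \<in> borel_measurable borel" using w(1) by (simp add: cell_weight_def)
    have "AE x in lborel. ennreal 1 = w x" using w(2) by (simp only: AE_completion_iff)
    then have ae: "AE x in lborel. w x = 1" by eventually_elim (metis ennreal_1)
    \<comment> \<open>The Borel weight obtained above equals 1 only a.e.; the inequality contains it
      under integrals, so it passes to the constant weight.\<close>
    have "cell_weight p (ennreal (?k powr p * 2)) (\<lambda>_ :: real^'n. 1)"
      unfolding cell_weight_def
    proof (intro conjI allI impI)
      fix l :: real and x :: "real^'n" and h :: "real^'n \<Rightarrow> real" assume l: "l > 0" and h: "h \<in> borel_measurable borel \<and> (\<forall>y. 0 \<le> h y) \<and> integrable lborel h"
      let ?i = "indicator (cell l (cell_index l x)) :: real^'n \<Rightarrow> ennreal"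
      have [measurable]: "h \<in> borel_measurable borel" using h by simp
      have "(\<integral>\<^sup>+y. ?i y * 1 \<partial>lborel) = (\<integral>\<^sup>+y. ?i y * w y \<partial>lborel)"
        using ae by (intro nn_integral_cong_AE) auto
      moreover have "(\<integral>\<^sup>+y. ?i y * (1 * ennreal (h y powr p)) \<partial>lborel) = (\<integral>\<^sup>+y. ?i y * (w y * ennreal (h y powr p)) \<partial>lborel)"
        using ae by (intro nn_integral_cong_AE) auto
      moreover have "ennreal (?k powr p * 2) = ennreal (?k powr p) * (1 + 1)" by (simp add: ennreal_mult)
      ultimately show "(\<integral>\<^sup>+y. ?i y * 1 \<partial>lborel) * ennreal (cell_avg l h x powr p)
        \<le> ennreal (?k powr p * 2) * (\<integral>\<^sup>+y. ?i y * (1 * ennreal (h y powr p)) \<partial>lborel)"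
        using w(1) l h unfolding cell_weight_def by simp
    qed simp
    moreover have "?c powr p * (?k powr p * 2) \<le> ?L"
      unfolding faber_krahn_sum_def using pos by (simp add: sum_nonneg)
    ultimately show "\<exists>K\<ge>0. cell_weight p (ennreal K) (\<lambda>_ :: real^'n. 1) \<and> ?c powr p * K \<le> ?L"
      by (intro exI[of _ "?k powr p * 2"]) simp
  next
    fix i assume i: "i \<in> {1..N}"
    have q1: "1 < q i" using p q[OF i] by simp
    obtain w :: "real^'n \<Rightarrow> ennreal" where w: "cell_weight (q i) (ennreal (?k powr q i) * (A i + 1)) w" "AE x in lebesgue. ennreal (a i x) = w x"
      by (rule muckenhoupt_cell_weight[OF q1 conjunct1[OF a[OF i]], unfolded conjunct2[OF a[OF i]]])
         (rule that, unfold cell_ratio_def)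
    have "A i < \<infinity>" using a[OF i] by (auto simp: muckenhoupt_class_def)
    then have "A i = ennreal (enn2real (A i))" by simp
    then have "ennreal (?k powr q i) * (A i + 1) = ennreal (?k powr q i * (enn2real (A i) + 1))"
      by (metis ennreal_1 ennreal_mult ennreal_plus enn2real_nonneg add_nonneg_nonneg powr_ge_zero zero_le_one)
    moreover have "?c powr q i * (?k powr q i * (enn2real (A i) + 1)) \<le> ?L"
      unfolding faber_krahn_sum_def
    proof (rule add_increasing)
      show "?c powr q i * (?k powr q i * (enn2real (A i) + 1))
        \<le> (\<Sum>i=1..N. ?c powr q i * (?k powr q i * (enn2real (A i) + 1)))"
        by (rule member_le_sum[OF i pos]) simp
    qed (intro add_nonneg_nonneg mult_nonneg_nonneg; simp)
    ultimately show "\<exists>K\<ge>0. \<exists>w. cell_weight (q i) (ennreal K) w \<and> (AE x in lebesgue. ennreal (a i x) = w x) \<and> ?c powr q i * K \<le> ?L"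
      using w by (intro exI[of _ "?k powr q i * (enn2real (A i) + 1)"]) auto
  qed
qed

theorem corollary1p2:
  fixes N :: nat and p :: real and q :: "nat \<Rightarrow> real" and A :: "nat \<Rightarrow> ennreal"
  assumes "CARD('n::finite) \<ge> 2" and "N \<ge> 1"
    and "1 < p" and "p \<le> q 1" and "mono_on {1..N} q"
  shows "\<exists>C::real. C > 0 \<and>
    (\<forall>(\<Omega> :: (real ^ 'n) set) a u.
       open \<Omega> \<and> bounded \<Omega> \<and>
       (\<forall>i\<in>{1..N}. a i \<in> muckenhoupt_class (q i) \<and> muckenhoupt_const (q i) (a i) = A i) \<and>
       local_minimizer (multiphase N p q a) \<Omega> u \<longrightarrow>
       (\<forall>c r. r > 0 \<and> compactly_contained (ball c (2 * r)) \<Omega> \<longrightarrow>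
          (let m = avg (ball c (2 * r)) u in
           Linf_norm (ball c r) u \<le>
             ennreal (C * r) *
               ennreal_powr
                 (nn_avg (ball c (2 * r)) (\<lambda>x. ennreal (multiphase N p q a x (\<bar>u x - m\<bar> / r))))
                 (1 / p)
             + ennreal \<bar>m\<bar>)))"
proof -
  let ?n = "CARD('n)"
  define Q where "Q = q N"
  define L where "L = faber_krahn_sum TYPE('n) N p q A"
  have L: "L > 0" unfolding L_def faber_krahn_sum_def by (intro add_pos_nonneg sum_nonneg) auto
  have q: "p \<le> q i \<and> q i \<le> Q" if "i \<in> {1..N}" for i
  proof -
    have "q 1 \<le> q i" "q i \<le> q N" using that assms(2) by (auto intro!: mono_onD[OF assms(5)])
    then show ?thesis using assms(4) by (simp add: Q_def)
  qed
  \<comment> \<open>\<open>de_giorgi_delta\<close> written out, since C must be fixed before the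
    coefficients with which the locale is interpreted.\<close>
  define \<delta> where "\<delta> = min 1 ((2 powr (- (Q * ?n + p))) / (exp (Q * Q) * L * (2 * 2 powr Q) * (16 * Q) powr Q))"
  have pQ: "p \<le> Q" using q[of N] assms(2) by simp
  then have Q1: "1 < Q" using assms(3) by simp
  have \<delta>: "\<delta> > 0" unfolding \<delta>_def using L Q1 by simp
  define V where "V = unit_ball_vol ?n * 2 ^ ?n"
  have V: "V > 0" unfolding V_def by simp
  \<comment> \<open>The height d of \<open>de_giorgi\<close> divided by r, for an average equal to
    1: V is the measure of a ball of radius 2 r divided by r^n and turns the integral into an
    average.\<close>
  define C where "C = (2 powr (p + 1) * V / \<delta> ^ ?n) powr (1 / p)"
  have C: "C > 0" unfolding C_def using V \<delta> by simp
  show ?thesis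
  proof (intro exI[of _ C] conjI C allI impI)
    fix \<Omega> :: "(real^'n) set" and a u and c :: "real^'n" and r :: real
    assume asm: "open \<Omega> \<and> bounded \<Omega> \<and>
       (\<forall>i\<in>{1..N}. a i \<in> muckenhoupt_class (q i) \<and> muckenhoupt_const (q i) (a i) = A i) \<and>
       local_minimizer (multiphase N p q a) \<Omega> u"
      and ball: "r > 0 \<and> compactly_contained (ball c (2 * r)) \<Omega>"
    interpret multiphase_integrand N p Q q a
      using asm q assms(3) pQ by unfold_locales (auto simp: muckenhoupt_class_def)
    have fk: "faber_krahn_const L"
      unfolding L_def using asm by (intro faber_krahn_const_muckenhoupt[OF multiphase_integrand_axioms]) auto
    have \<delta>_eq: "de_giorgi_delta L = \<delta>"
      by (simp add: de_giorgi_delta_def de_giorgi_ratio_def de_giorgi_const_def \<delta>_def)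
    have \<Omega>: "open \<Omega>" "bounded \<Omega>" and min: "local_minimizer H \<Omega> u" and r: "r > 0"
      and B: "compactly_contained (ball c (2 * r)) \<Omega>" using asm ball by auto
    obtain g where g: "is_weak_gradient \<Omega> u g" "u \<in> modular_class H \<Omega>" "(\<lambda>x. norm (g x)) \<in> modular_class H \<Omega>"
      by (rule minimizer_gradient[OF \<Omega>(1) min])
    define m where "m = avg (ball c (2 * r)) u"
    define F where "F x = ennreal (H x (\<bar>u x - m\<bar> / r))" for x
    define X where "X = (\<integral>\<^sup>+x. indicator (ball c (2 * r)) x * F x \<partial>lebesgue)"
    have sub: "ball c (2 * r) \<subseteq> \<Omega>" using B closure_subset by (auto simp: compactly_contained_def)
    have um: "u \<in> borel_measurable (lebesgue_on \<Omega>)" using g(2) by (simp add: modular_class_def)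
    have avgX: "nn_avg (ball c (2 * r)) F = X / ennreal (V * r ^ ?n)"
    proof -
      have "emeasure lebesgue (ball c (2 * r)) = ennreal (measure lborel (ball c (2 * r)))"
        by (rule emeasure_lebesgue_ball)
      also have "measure lborel (ball c (2 * r)) = V * r ^ ?n"
        using r by (subst content_ball) (auto simp: V_def power_mult_distrib)
      finally show ?thesis
        unfolding nn_avg_def X_def by (simp add: nn_integral_restrict_space mult.commute del: emeasure_completion)
    qed
    have Vr: "V * r ^ ?n > 0" using V r by simp
    \<comment> \<open>Doubling of H and the finite modular of constants make the right side finite,
      so the height Z is a real number.\<close>
    have Xfin: "X < \<infinity>"
    proof -
      have m: "(\<lambda>x. m) \<in> modular_class H \<Omega>" by (rule modular_class_const[OF \<Omega>(2)]) (use \<Omega>(1) in simp)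
      have "(\<lambda>x. \<bar>u x - m\<bar> / r) \<in> modular_class H \<Omega>"
      proof -
        have "\<bar>\<bar>u x - m\<bar> / r\<bar> \<le> max 1 (1 / r) * (\<bar>u x\<bar> + \<bar>m\<bar>)" for x
        proof -
          have "\<bar>\<bar>u x - m\<bar> / r\<bar> = (1 / r) * \<bar>u x - m\<bar>" using r by simp
          also have "\<dots> \<le> max 1 (1 / r) * (\<bar>u x\<bar> + \<bar>m\<bar>)" using r by (intro mult_mono) auto
          finally show ?thesis .
        qed
        moreover have "(\<lambda>x. \<bar>u x - m\<bar> / r) \<in> borel_measurable (lebesgue_on \<Omega>)" using um by measurable
        ultimately show ?thesis
          using \<Omega>(1) by (intro modular_class_bound[OF g(2) m, of _ "max 1 (1 / r)"]) auto
      qed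
      then have "(\<integral>\<^sup>+x. F x \<partial>lebesgue_on \<Omega>) < \<infinity>"
        using r by (simp add: modular_class_def F_def)
      moreover have "X \<le> (\<integral>\<^sup>+x. F x \<partial>lebesgue_on \<Omega>)"
        unfolding X_def using sub \<Omega>(1) by (subst nn_integral_restrict_space) (auto intro!: nn_integral_mono simp: indicator_def)
      ultimately show ?thesis by (rule le_less_trans[rotated])
    qed
    then obtain X' where X': "X = ennreal X'" "0 \<le> X'" by (cases X) auto
    define Z where "Z = C * r * (X' / (V * r ^ ?n)) powr (1 / p)"
    have Z0: "Z \<ge> 0" unfolding Z_def using C r by simp
    have excess_le: "excess u \<sigma> m 0 x \<le> \<bar>u x - m\<bar>" if "\<sigma> = 1 \<or> \<sigma> = -1" for \<sigma> x
      using that by (auto simp: excess_def)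
    have bound: "AE x in lebesgue. x \<in> ball c r \<longrightarrow> \<bar>u x - m\<bar> \<le> Z"
    \<comment> \<open>\<open>de_giorgi\<close> is stated for Y > 0. If the integral vanishes, u
      equals m a.e. on the larger ball and there is nothing to iterate.\<close>
    proof (cases "X' = 0")
      case True
      have F\<Omega>: "(\<lambda>x. F x * indicator \<Omega> x) \<in> borel_measurable lebesgue"
      proof -
        have "(\<lambda>x. \<bar>u x - m\<bar> / r) \<in> borel_measurable (lebesgue_on \<Omega>)" using um by measurable
        from H_measurable[OF this] have "F \<in> borel_measurable (lebesgue_on \<Omega>)" unfolding F_def by measurable
        then show ?thesis using borel_measurable_restrict_space_iff_ennreal[of \<Omega> lebesgue F] \<Omega>(1) by simp
      qed
      have "(\<lambda>x. indicator (ball c (2 * r)) x * (F x * indicator \<Omega> x)) \<in> borel_measurable lebesgue"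
        by (rule borel_measurable_times_ennreal[OF borel_measurable_indicator F\<Omega>]) simp
      moreover have "indicator (ball c (2 * r)) x * (F x * indicator \<Omega> x) = indicator (ball c (2 * r)) x * F x" for x
        using sub by (auto simp: indicator_def)
      ultimately have "(\<lambda>x. indicator (ball c (2 * r)) x * F x) \<in> borel_measurable lebesgue" by simp
      then have "AE x in lebesgue. indicator (ball c (2 * r)) x * F x = 0"
        using True X' nn_integral_0_iff_AE unfolding X_def by fastforce
      then show ?thesis
      proof eventually_elim
        case (elim x)
        show ?case
        proof
          assume "x \<in> ball c r"
          then have "x \<in> ball c (2 * r)" using r subset_ball[of r "2 * r" c] by auto
          then have "H x (\<bar>u x - m\<bar> / r) \<le> 0" using elim by (simp add: F_def ennreal_eq_0_iff)
          then have "(\<bar>u x - m\<bar> / r) powr p \<le> 0" using H_ge_powr order_trans by blast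
          then have "(\<bar>u x - m\<bar> / r) powr p = 0" by (rule antisym) simp
          then show "\<bar>u x - m\<bar> \<le> Z" using r Z0 by simp
        qed
      qed
    next
      case False
      define Y where "Y = X' / r ^ ?n"
      have Y: "Y > 0" unfolding Y_def using False X' r by simp
      have Yr: "Y * r ^ ?n = X'" unfolding Y_def using r by simp
      have dZ: "r * (2 powr (p + 1) * Y / de_giorgi_delta L ^ ?n) powr (1 / p) = Z"
      proof -
        have "2 powr (p + 1) * Y / \<delta> ^ ?n = (2 powr (p + 1) * V / \<delta> ^ ?n) * (X' / (V * r ^ ?n))"
          unfolding Y_def using V by simp
        then have "(2 powr (p + 1) * Y / \<delta> ^ ?n) powr (1 / p) = C * (X' / (V * r ^ ?n)) powr (1 / p)"
          unfolding C_def by (simp only: powr_mult)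
        then show ?thesis unfolding \<delta>_eq Z_def by (simp only: mult_ac)
      qed
      \<comment> \<open>Both signs have initial energy at most X, so the same height Z bounds u - m
        from above and from below.\<close>
      have one: "AE x in lebesgue. x \<in> ball c r \<longrightarrow> excess u \<sigma> m Z x = 0" if \<sigma>: "\<sigma> = 1 \<or> \<sigma> = -1" for \<sigma>
      proof -
        have "(\<integral>\<^sup>+x. indicator (ball c (2 * r)) x * ennreal (H x (excess u \<sigma> m 0 x / r)) \<partial>lebesgue) \<le> X"
          unfolding X_def F_def using excess_le[OF \<sigma>] r
          by (intro nn_integral_mono mult_left_mono ennreal_leI H_mono divide_right_mono) auto
        then have "(\<integral>\<^sup>+x. indicator (ball c (2 * r)) x * ennreal (H x (excess u \<sigma> m 0 x / r)) \<partial>lebesgue) \<le> ennreal (Y * r ^ ?n)"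
          unfolding Yr X'(1) .
        from de_giorgi[OF \<Omega> min g \<sigma> L fk r B Y this] show ?thesis unfolding dZ .
      qed
      have "AE x in lebesgue. x \<in> ball c r \<longrightarrow> excess u 1 m Z x = 0" "AE x in lebesgue. x \<in> ball c r \<longrightarrow> excess u (- 1) m Z x = 0"
        by (rule one; simp)+
      then show ?thesis
      proof eventually_elim
        case (elim x)
        show ?case
        proof
          assume "x \<in> ball c r"
          then have "excess u 1 m Z x = 0" "excess u (- 1) m Z x = 0" using elim by auto
          then show "\<bar>u x - m\<bar> \<le> Z" unfolding excess_def by (auto simp: max_def split: if_splits)
        qed
      qed
    qed
    have br: "ball c r \<subseteq> \<Omega>" using sub subset_ball[of r "2 * r" c] r by auto
    have "Linf_norm (ball c r) u \<le> ennreal (Z + \<bar>m\<bar>)"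
      unfolding Linf_norm_def
    proof (rule esssup_I)
      have "u \<in> borel_measurable (lebesgue_on (ball c r))" using um br by (rule measurable_restrict_mono)
      then show "(\<lambda>x. ennreal \<bar>u x\<bar>) \<in> borel_measurable (lebesgue_on (ball c r))" by measurable
      show "AE x in lebesgue_on (ball c r). ennreal \<bar>u x\<bar> \<le> ennreal (Z + \<bar>m\<bar>)"
      proof (subst AE_restrict_space_iff)
        show "AE x in lebesgue. x \<in> ball c r \<longrightarrow> ennreal \<bar>u x\<bar> \<le> ennreal (Z + \<bar>m\<bar>)"
          using bound by eventually_elim (auto intro!: ennreal_leI)
      qed simp
    qed
    also have "\<dots> = ennreal (C * r) * ennreal_powr (nn_avg (ball c (2 * r)) F) (1 / p) + ennreal \<bar>m\<bar>"
    proof -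
      have "nn_avg (ball c (2 * r)) F = ennreal (X' / (V * r ^ ?n))"
        unfolding avgX X'(1) using X'(2) Vr by (simp add: divide_ennreal)
      then have "ennreal_powr (nn_avg (ball c (2 * r)) F) (1 / p) = ennreal ((X' / (V * r ^ ?n)) powr (1 / p))"
        using X'(2) Vr by (simp add: ennreal_powr_ennreal)
      moreover have "ennreal Z = ennreal (C * r) * ennreal ((X' / (V * r ^ ?n)) powr (1 / p))"
        unfolding Z_def using C r by (intro ennreal_mult) auto
      ultimately show ?thesis using Z0 by simp
    qed
    finally show "let m = avg (ball c (2 * r)) u in
           Linf_norm (ball c r) u \<le> ennreal (C * r) * ennreal_powr
                 (nn_avg (ball c (2 * r)) (\<lambda>x. ennreal (multiphase N p q a x (\<bar>u x - m\<bar> / r)))) (1 / p) + ennreal \<bar>m\<bar>"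
      unfolding Let_def m_def[symmetric] F_def[symmetric] .
  qed
qed

end
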